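(* Let $G=(V,E)$ be a directed graph with $|V|=n$, $|E|=m$, and integer edge lengths $\ell:E\to\mathbb{Z}$ (possibly negative) such that $G$ has no negative-length cycle. Let $\hat{y}:V\to\mathbb{Z}$ be predicted duals and let $y^*:V\to\mathbb{Z}$ be a feasible reduced edge length dual minimizing $\|\hat{y}-y^*\|_1$. There is an algorithm which, given $G$, $\ell$ and $\hat{y}$, returns a feasible reduced edge length dual $\hat{y}':V\to\mathbb{Z}$ in time \[O\Big(m \min\big\{\|\hat{y}-y^*\|_1 \cdot \|\hat{y}-y^*\|_{\infty},\ \sqrt{n}\, \log(\|\hat{y}-y^*\|_{\infty})\big\}\Big).\]
   Context: A vector $y\in\mathbb{Z}^V$ is a feasible reduced edge length dual (RE dual) if $\ell_y(u,v):=\ell(u,v)+y_u-y_v\ge 0$ for every edge $(u,v)\in E$.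
   Formalization: The time bound is read as O(1 + m(1 + min{‖ŷ−y*‖_1·‖ŷ−y*‖_∞, √n·log(1+‖ŷ−y*‖_∞)})), since the stated bound is zero or undefined when ‖ŷ−y*‖_∞ ≤ 1; for ‖ŷ−y*‖_∞ ≥ 2 the two agree up to a constant. *)

theory Defs
  imports Complex_Main "Graph_Theory.Graph_Theory"
begin

section \<open>Reduced edge length duals\<close>

definition reduced_length :: "(nat \<times> nat \<Rightarrow> int) \<Rightarrow> (nat \<Rightarrow> int) \<Rightarrow> nat \<times> nat \<Rightarrow> int" where
  "reduced_length l y = (\<lambda>(u, v). l (u, v) + y u - y v)"

definition feasible_RE_dual ::
  "nat pair_pre_digraph \<Rightarrow> (nat \<times> nat \<Rightarrow> int) \<Rightarrow> (nat \<Rightarrow> int) \<Rightarrow> bool" where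
  "feasible_RE_dual G l y \<longleftrightarrow> (\<forall>e \<in> parcs G. 0 \<le> reduced_length l y e)"

definition no_negative_cycle :: "nat pair_pre_digraph \<Rightarrow> (nat \<times> nat \<Rightarrow> int) \<Rightarrow> bool" where
  "no_negative_cycle G l \<longleftrightarrow>
     (\<forall>p. pre_digraph.cycle (with_proj G) p \<longrightarrow> 0 \<le> wf_digraph.awalk_cost (\<lambda>e. real_of_int (l e)) p)"

definition l1_dist :: "nat set \<Rightarrow> (nat \<Rightarrow> int) \<Rightarrow> (nat \<Rightarrow> int) \<Rightarrow> int" where
  "l1_dist V x y = (\<Sum>v\<in>V. \<bar>x v - y v\<bar>)"

text \<open>The inserted 0 only gives the maximum a value when there are no vertices.\<close>

definition linf_dist :: "nat set \<Rightarrow> (nat \<Rightarrow> int) \<Rightarrow> (nat \<Rightarrow> int) \<Rightarrow> int" where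
  "linf_dist V x y = Max (insert 0 ((\<lambda>v. \<bar>x v - y v\<bar>) ` V))"

definition closest_feasible_RE_dual ::
  "nat pair_pre_digraph \<Rightarrow> (nat \<times> nat \<Rightarrow> int) \<Rightarrow> (nat \<Rightarrow> int) \<Rightarrow> (nat \<Rightarrow> int) \<Rightarrow> bool" where
  "closest_feasible_RE_dual G l yhat y \<longleftrightarrow> feasible_RE_dual G l y \<and>
     (\<forall>z. feasible_RE_dual G l z \<longrightarrow> l1_dist (pverts G) yhat y \<le> l1_dist (pverts G) yhat z)"

section \<open>The model of computation\<close>

text \<open>
  A unit-cost random access machine over the integers, programmed in a structured language.
  Memory consists of integer arrays, addressed by name and index; a scalar variable is cell 0 of
  an array. The available arithmetic is addition, subtraction, halving and comparison.
  Multiplication is deliberately absent: at unit cost, on unbounded integers, it would make the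
  machine unrealistically powerful, whereas here the bit length of the stored numbers grows by at
  most a constant (depending on the program) per step.
\<close>

type_synonym store = "string \<Rightarrow> int \<Rightarrow> int"

datatype aexp = Const int | Get string aexp | Add aexp aexp | Sub aexp aexp | Half aexp

datatype bexp = Less aexp aexp | Neg bexp | Conj bexp bexp

datatype com =
    Skip
  | Put string aexp aexp
  | Seq com com
  | Cond bexp com com
  | While bexp com

fun aval :: "aexp \<Rightarrow> store \<Rightarrow> int" where
  "aval (Const k) s = k"
| "aval (Get a i) s = s a (aval i s)"
| "aval (Add e f) s = aval e s + aval f s"
| "aval (Sub e f) s = aval e s - aval f s"
| "aval (Half e) s = aval e s div 2"

fun bval :: "bexp \<Rightarrow> store \<Rightarrow> bool" where
  "bval (Less e f) s \<longleftrightarrow> aval e s < aval f s"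
| "bval (Neg b) s \<longleftrightarrow> \<not> bval b s"
| "bval (Conj b c) s \<longleftrightarrow> bval b s \<and> bval c s"

text \<open>
  \<open>exec p s t s'\<close>: started in \<open>s\<close>, program \<open>p\<close> halts in \<open>s'\<close> after \<open>t\<close> steps. Every assignment
  and every evaluation of a test is one step. The expressions in a program have a fixed size that
  does not depend on the input, so this agrees with counting every arithmetic operation and
  memory access up to a constant factor depending on the program only.
\<close>

inductive exec :: "com \<Rightarrow> store \<Rightarrow> nat \<Rightarrow> store \<Rightarrow> bool" where
  Skip: "exec Skip s 0 s"
| Put: "exec (Put a i e) s 1 (s(a := (s a)(aval i s := aval e s)))"
| Seq: "exec p s t s' \<Longrightarrow> exec q s' t' s'' \<Longrightarrow> exec (Seq p q) s (t + t') s''"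
| CondTrue: "bval b s \<Longrightarrow> exec p s t s' \<Longrightarrow> exec (Cond b p q) s (1 + t) s'"
| CondFalse: "\<not> bval b s \<Longrightarrow> exec q s t s' \<Longrightarrow> exec (Cond b p q) s (1 + t) s'"
| WhileFalse: "\<not> bval b s \<Longrightarrow> exec (While b p) s 1 s"
| WhileTrue: "bval b s \<Longrightarrow> exec p s t s' \<Longrightarrow> exec (While b p) s' t' s'' \<Longrightarrow>
    exec (While b p) s (1 + t + t') s''"

inductive_cases exec_SkipE: "exec Skip s t s'"
inductive_cases exec_PutE: "exec (Put a i e) s t s'"
inductive_cases exec_SeqE: "exec (Seq p q) s t s'"
inductive_cases exec_CondE: "exec (Cond b p q) s t s'"
inductive_cases exec_WhileE: "exec (While b p) s t s'"

lemma exec_deterministic: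
  "exec p s t s' \<Longrightarrow> exec p s u s'' \<Longrightarrow> t = u \<and> s' = s''"
proof (induction arbitrary: u s'' rule: exec.induct)
  case (Skip s)
  then show ?case by (auto elim: exec_SkipE)
next
  case (Put a i e s)
  then show ?case by (auto elim: exec_PutE)
next
  case (Seq p s t s1 q t' s2)
  from Seq.prems obtain u1 r u2 where "exec p s u1 r" "exec q r u2 s''" "u = u1 + u2"
    by (rule exec_SeqE)
  then show ?case using Seq.IH by blast
next
  case (CondTrue b s p t s' q)
  from CondTrue.prems CondTrue.hyps obtain u1 where "exec p s u1 s''" "u = 1 + u1"
    by (auto elim: exec_CondE)
  then show ?case using CondTrue.IH by blast
next
  case (CondFalse b s q t s' p)
  from CondFalse.prems CondFalse.hyps obtain u1 where "exec q s u1 s''" "u = 1 + u1"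
    by (auto elim: exec_CondE)
  then show ?case using CondFalse.IH by blast
next
  case (WhileFalse b s p)
  from WhileFalse.prems show ?case
    by (rule exec_WhileE) (use WhileFalse.hyps in auto)
next
  case (WhileTrue b s p t s1 t' s2)
  from WhileTrue.prems obtain u1 r u2
    where "exec p s u1 r" "exec (While b p) r u2 s''" "u = 1 + u1 + u2"
    by (rule exec_WhileE) (use WhileTrue.hyps in auto)
  then show ?case using WhileTrue.IH by blast
qed

section \<open>Input and output\<close>

text \<open>
  A graph is presented by its numbers of vertices and edges and by arrays listing, in the order
  \<open>es\<close>, the endpoints and the length of each edge; vertex \<open>v\<close> is known to the program only
  through its number \<open>idx v\<close>. Array \<open>y\<close> holds the predicted duals, and all remaining memory is 0.
  The returned dual is read off from the same array \<open>y\<close> when the program halts, so that isolated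
  vertices cost no time.
\<close>

definition edge_listing :: "nat pair_pre_digraph \<Rightarrow> (nat \<times> nat) list \<Rightarrow> bool" where
  "edge_listing G es \<longleftrightarrow> distinct es \<and> set es = parcs G"

definition vertex_numbering :: "nat pair_pre_digraph \<Rightarrow> (nat \<Rightarrow> nat) \<Rightarrow> bool" where
  "vertex_numbering G idx \<longleftrightarrow> bij_betw idx (pverts G) {..<card (pverts G)}"

definition array_of :: "int list \<Rightarrow> int \<Rightarrow> int" where
  "array_of xs i = (if 0 \<le> i \<and> i < int (length xs) then xs ! nat i else 0)"

definition input_store ::
  "nat pair_pre_digraph \<Rightarrow> (nat \<Rightarrow> nat) \<Rightarrow> (nat \<times> nat) list \<Rightarrow> (nat \<times> nat \<Rightarrow> int) \<Rightarrow>
   (nat \<Rightarrow> int) \<Rightarrow> store" where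
  "input_store G idx es l yhat = (\<lambda>_ _. 0)
     (''n'' := array_of [int (card (pverts G))],
      ''m'' := array_of [int (card (parcs G))],
      ''src'' := array_of (map (\<lambda>(u, v). int (idx u)) es),
      ''dst'' := array_of (map (\<lambda>(u, v). int (idx v)) es),
      ''len'' := array_of (map l es),
      ''y'' := array_of (map (\<lambda>i. yhat (inv_into (pverts G) idx i)) [0..<card (pverts G)]))"

definition output_dual :: "(nat \<Rightarrow> nat) \<Rightarrow> store \<Rightarrow> nat \<Rightarrow> int" where
  "output_dual idx s v = s ''y'' (int (idx v))"

text \<open>
  The factor of the number of edges in the running time, as a function of the number of vertices
  and of the two distances. The logarithm is \<open>log (1 + D)\<close> rather than \<open>log D\<close>, which would vanish
  at \<open>D = 1\<close>; for \<open>D \<ge> 2\<close> the two differ by a constant factor at most. For the same reason the factor is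
  used below in the form \<open>1 + m * (1 + time_factor n d1 dinf)\<close>: it is 0 for an exact prediction,
  where the edges still have to be inspected, and at least 1 when \<open>dinf \<ge> 2\<close>.
\<close>

definition time_factor :: "nat \<Rightarrow> int \<Rightarrow> int \<Rightarrow> real" where
  "time_factor n d1 dinf =
     min (real_of_int d1 * real_of_int dinf) (sqrt (real n) * log 2 (1 + real_of_int dinf))"

end

theory Submission
  imports Defs
begin

text \<open>
  The algorithm is Goldberg's scaling method started at the prediction. After passing to the reduced
  lengths of the prediction, duals \<open>D\<close> away from a feasible one yield a function \<open>P\<close> with
  \<open>0 \<le> P \<le> 2 D\<close> by which the current duals may be lowered to become feasible. Halving lengths
  (rounding up) and \<open>P\<close> (rounding down) preserves this, so only about \<open>log D\<close> scales are needed until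
  no length is negative; going back, each scale starts with reduced lengths at least \<open>-1\<close>.

  Within a scale, look at the edges of nonpositive length, all of whose cycles have length 0, and let
  the level of a vertex be the largest number of negative edges on a path ending there. If \<open>k\<close>
  vertices are heads of negative edges, then either one level contains at least \<open>sqrt k\<close> of
  them, and lowering everything from this level on by 1 repairs these, or there is a path with at
  least \<open>sqrt k\<close> negative edges, whose heads are repaired simultaneously by one bucket-based
  shortest path computation. No edge gets worse, so \<open>2 sqrt n\<close> rounds suffice. Every round also lowers
  all vertices of positive level by 1, which decreases the maximum of \<open>P\<close>; hence the number of
  rounds is also at most this maximum. The maxima over all scales sum to at most \<open>4 D\<close>, which
  is within the bound \<open>\<parallel>yhat - ystar\<parallel>\<^sub>1 \<cdot> \<parallel>yhat - ystar\<parallel>\<^sub>\<infinity>\<close>.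

  Negative cycles never appear in the argument: that a set of vertices or a path behaves as required
  is always expressed by inequalities for \<open>P\<close>.
\<close>

section \<open>Reasoning about programs\<close>

text \<open>The program never learns the distance \<open>D\<close>; it adds scales until no length
  is negative, and an edge that is negative at scale \<open>i\<close> certifies that the
  \<open>i\<close>-fold half of \<open>2 D\<close> is still at least 1. The function
  \<open>P\<close> is likewise only a ghost of the proof. It exists because adding a constant to a
  feasible dual keeps it feasible: lowering the prediction by \<open>P = D - (ystar - yhat)\<close>
  yields \<open>ystar - D\<close>, and this \<open>P\<close> lies between 0 and \<open>2 D\<close>.
  Both terms of the minimum are met by the same run. Every round lowers the maximum of
  \<open>P\<close> and also a potential of order \<open>sqrt k\<close>, so the smaller of the two
  counts the rounds of a scale. Since distances are integers, \<open>D \<ge> 1\<close> implies that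
  the 1-norm is at least 1, which turns a bound linear in \<open>D\<close> into the product. What
  shapes the programs is that a round may cost only time linear in \<open>m\<close>, with no term in
  \<open>n\<close>. Vertices are therefore visited only as endpoints of edges, possibly several
  times, and work arrays are cleared only where they will be read or are left clean by the
  computation itself.\<close>

definition runs :: "com \<Rightarrow> store \<Rightarrow> nat \<Rightarrow> (store \<Rightarrow> bool) \<Rightarrow> bool" where
  "runs p s B Q \<longleftrightarrow> (\<exists>t s'. exec p s t s' \<and> t \<le> B \<and> Q s')"

lemma runs_mono:
  "runs p s B Q \<Longrightarrow> B \<le> B' \<Longrightarrow> (\<And>s'. Q s' \<Longrightarrow> Q' s') \<Longrightarrow> runs p s B' Q'"
  unfolding runs_def by (meson order_trans)

text \<open>A syntactic bound on the memory that a program can change, at the granularity of whole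
  arrays. All frame facts below are read off from it.\<close>

fun writes :: "com \<Rightarrow> string set" where
  "writes Skip = {}"
| "writes (Put a i e) = {a}"
| "writes (Seq p q) = writes p \<union> writes q"
| "writes (Cond b p q) = writes p \<union> writes q"
| "writes (While b p) = writes p"

definition agree_off :: "string set \<Rightarrow> store \<Rightarrow> store \<Rightarrow> bool" where
  "agree_off X s s' \<longleftrightarrow> (\<forall>a. a \<notin> X \<longrightarrow> s' a = s a)"

lemma agree_offD: "agree_off X s s' \<Longrightarrow> a \<notin> X \<Longrightarrow> s' a = s a"
  by (simp add: agree_off_def)

lemma agree_off_trans:
  "agree_off X s s' \<Longrightarrow> agree_off Y s' s'' \<Longrightarrow> X \<union> Y \<subseteq> Z \<Longrightarrow> agree_off Z s s''"
  unfolding agree_off_def by (metis UnI1 UnI2 subsetD)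

lemma exec_agree_off: "exec p s t s' \<Longrightarrow> agree_off (writes p) s s'"
  by (induction rule: exec.induct) (auto simp: agree_off_def)

lemma runs_agree_off: "runs p s B Q \<Longrightarrow> runs p s B (\<lambda>s'. Q s' \<and> agree_off (writes p) s s')"
  unfolding runs_def using exec_agree_off by blast

text \<open>The frame fact for \<open>p\<close> is passed on to the second premise, so the
  intermediate assertion \<open>Q\<close> has to mention only what \<open>p\<close> changes.\<close>

lemma runs_Seq:
  "runs p s B Q \<Longrightarrow> (\<And>s'. Q s' \<Longrightarrow> agree_off (writes p) s s' \<Longrightarrow> runs q s' C R) \<Longrightarrow>
    runs (Seq p q) s (B + C) R"
  unfolding runs_def by (metis exec_agree_off exec.Seq add_mono)

lemma runs_Cond:
  "(bval b s \<Longrightarrow> runs p s B Q) \<Longrightarrow> (\<not> bval b s \<Longrightarrow> runs q s B Q) \<Longrightarrow>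
    runs (Cond b p q) s (Suc B) Q"
  unfolding runs_def
  by (metis Suc_le_mono exec.CondTrue exec.CondFalse plus_1_eq_Suc)

text \<open>The index of the invariant \<open>I\<close> is the time still available.\<close>

lemma runs_While:
  assumes init: "I k s"
    and step: "\<And>k s'. I k s' \<Longrightarrow> agree_off (writes p) s s' \<Longrightarrow> bval b s' \<Longrightarrow>
      \<exists>k' B. B + k' < k \<and> runs p s' B (I k')"
  shows "runs (While b p) s (Suc k) (\<lambda>s'. (\<exists>k'. I k' s') \<and> \<not> bval b s')"
proof -
  have "I k s' \<Longrightarrow> agree_off (writes p) s s' \<Longrightarrow>
      runs (While b p) s' (Suc k) (\<lambda>s'. (\<exists>k'. I k' s') \<and> \<not> bval b s')" for s'
  \<comment> \<open>The strict inequality \<open>B + k' < k\<close> leaves one step for the test of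
    each iteration; the last, failing test is the extra step in \<open>Suc k\<close>.\<close>
  proof (induction k arbitrary: s' rule: less_induct)
    case (less k)
    show ?case
    proof (cases "bval b s'")
      case False
      then have "exec (While b p) s' 1 s'" by (rule exec.WhileFalse)
      with False less.prems show ?thesis unfolding runs_def by fastforce
    next
      case True
      from step[OF less.prems True] obtain k' B where
        B: "B + k' < k" "runs p s' B (I k')" by blast
      from B(2) obtain t s1 where s1: "exec p s' t s1" "t \<le> B" "I k' s1"
        unfolding runs_def by blast
      have "agree_off (writes p) s s1"
        using less.prems(2) exec_agree_off[OF s1(1)] by (auto simp: agree_off_def)
      with less.IH[of k' s1] B(1) s1(3) obtain t' s2 where s2: "exec (While b p) s1 t' s2"
        "t' \<le> Suc k'" "(\<exists>k'. I k' s2) \<and> \<not> bval b s2" unfolding runs_def by auto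
      from exec.WhileTrue[OF True s1(1) s2(1)] s1(2) s2(2,3) B(1) show ?thesis
        unfolding runs_def by (intro exI[of _ "1 + t + t'"] exI[of _ s2]) auto
    qed
  qed
  with init show ?thesis by (simp add: agree_off_def)
qed

text \<open>Quantifying over the initial store lets phases of a program be chained by
  \<open>also\<close> through the transitivity rule below.\<close>

definition triple :: "(store \<Rightarrow> bool) \<Rightarrow> com \<Rightarrow> nat \<Rightarrow> (store \<Rightarrow> bool) \<Rightarrow> bool" where
  "triple A p B Q \<longleftrightarrow> (\<forall>s. A s \<longrightarrow> runs p s B Q)"

lemma tripleI: "(\<And>s. A s \<Longrightarrow> runs p s B Q) \<Longrightarrow> triple A p B Q"
  by (simp add: triple_def)

lemma tripleD: "triple A p B Q \<Longrightarrow> A s \<Longrightarrow> runs p s B Q"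
  by (simp add: triple_def)

lemma triple_Seq [trans]: "triple A p B Q \<Longrightarrow> triple Q q C R \<Longrightarrow> triple A (Seq p q) (B + C) R"
  unfolding triple_def by (meson runs_Seq)

section \<open>Symbolic evaluation of loop-free programs\<close>

fun straight :: "com \<Rightarrow> bool" where
  "straight (Seq p q) \<longleftrightarrow> straight p \<and> straight q"
| "straight (Cond b p q) \<longleftrightarrow> straight p \<and> straight q"
| "straight (While b p) \<longleftrightarrow> False"
| "straight _ \<longleftrightarrow> True"

text \<open>A conditional is charged for both branches: this costs a constant factor and makes the
  bound independent of the store.\<close>

fun step_bound :: "com \<Rightarrow> nat" where
  "step_bound Skip = 0"
| "step_bound (Put a i e) = 1"
| "step_bound (Seq p q) = step_bound p + step_bound q"
| "step_bound (Cond b p q) = 1 + step_bound p + step_bound q"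
| "step_bound (While b p) = 0"

fun result :: "com \<Rightarrow> store \<Rightarrow> store" where
  "result (Put a i e) s = s(a := (s a)(aval i s := aval e s))"
| "result (Seq p q) s = result q (result p s)"
| "result (Cond b p q) s = (if bval b s then result p s else result q s)"
| "result _ s = s"

lemma exec_straight: "straight p \<Longrightarrow> \<exists>t \<le> step_bound p. exec p s t (result p s)"
proof (induction p arbitrary: s)
  case (Seq p q)
  then obtain t t' where "t \<le> step_bound p" "exec p s t (result p s)"
    "t' \<le> step_bound q" "exec q (result p s) t' (result q (result p s))" by force
  then show ?case using exec.Seq by (metis add_mono result.simps(2) step_bound.simps(3))
next
  case (Cond b p q)
  then obtain t t' where "t \<le> step_bound p" "exec p s t (result p s)"
    "t' \<le> step_bound q" "exec q s t' (result q s)" by force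
  then show ?case
    using exec.CondTrue[of b s p t _ q] exec.CondFalse[of b s q t' _ p]
    by (cases "bval b s") (simp_all add: exI[of _ "Suc t"] exI[of _ "Suc t'"])
next
  case (Put a i e)
  have "exec (Put a i e) s (Suc 0) (result (Put a i e) s)" using exec.Put[of a i e s] by simp
  then show ?case by (metis le_refl One_nat_def step_bound.simps(2))
qed (auto intro: exec.intros)

lemma runs_straight: "straight p \<Longrightarrow> Q (result p s) \<Longrightarrow> runs p s (step_bound p) Q"
  unfolding runs_def using exec_straight by blast

lemma triple_straight:
  "straight p \<Longrightarrow> (\<And>s. A s \<Longrightarrow> Q (result p s)) \<Longrightarrow> triple A p (step_bound p) Q"
  by (simp add: triple_def runs_straight)

text \<open>With a loop-free body all iterations have a common cost, so the invariant
  \<open>I\<close> may count iterations instead of steps.\<close>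

lemma runs_While_straight:
  assumes "straight p" and init: "I k s"
    and step: "\<And>k s'. I k s' \<Longrightarrow> agree_off (writes p) s s' \<Longrightarrow> bval b s' \<Longrightarrow>
      \<exists>k' < k. I k' (result p s')"
  shows "runs (While b p) s (Suc (Suc (step_bound p) * k)) (\<lambda>s'. (\<exists>k'. I k' s') \<and> \<not> bval b s')"
proof -
  let ?c = "Suc (step_bound p)"
  define J where "J = (\<lambda>j s'. \<exists>k. j = ?c * k \<and> I k s')"
  have "runs (While b p) s (Suc (?c * k)) (\<lambda>s'. (\<exists>j. J j s') \<and> \<not> bval b s')"
  proof (rule runs_While)
    show "J (?c * k) s" using init J_def by blast
    fix j s' assume "J j s'" "agree_off (writes p) s s'" "bval b s'"
    with step obtain k k' where k: "j = ?c * k" "k' < k" "I k' (result p s')"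
      unfolding J_def by blast
    then obtain d where d: "k = Suc (k' + d)" by (auto dest: less_imp_Suc_add)
    have "step_bound p + ?c * k' < j" unfolding k(1) d by (simp add: algebra_simps)
    moreover have "runs p s' (step_bound p) (J (?c * k'))"
      using k(3) \<open>straight p\<close> by (intro runs_straight) (auto simp: J_def)
    ultimately show "\<exists>k' B. B + k' < j \<and> runs p s' B (J k')" by blast
  qed
  then show ?thesis by (rule runs_mono) (auto simp: J_def)
qed

abbreviation var :: "string \<Rightarrow> aexp" where "var x \<equiv> Get x (Const 0)"

abbreviation assign :: "string \<Rightarrow> aexp \<Rightarrow> com" where "assign x \<equiv> Put x (Const 0)"

abbreviation seq :: "com \<Rightarrow> com \<Rightarrow> com" (infixl ";;" 55) where "p ;; q \<equiv> Seq p q"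

abbreviation plus1 :: "aexp \<Rightarrow> aexp" where "plus1 a \<equiv> Add a (Const 1)"

abbreviation minus1 :: "aexp \<Rightarrow> aexp" where "minus1 a \<equiv> Sub a (Const 1)"

abbreviation pos :: "aexp \<Rightarrow> bexp" where "pos \<equiv> Less (Const 0)"

definition for_edges :: "com \<Rightarrow> com" where
  "for_edges p = (assign ''e'' (Const 0) ;;
     While (Less (var ''e'') (var ''m'')) (p ;; assign ''e'' (plus1 (var ''e''))))"

text \<open>\<open>I i\<close> describes the store when exactly the edges below \<open>i\<close>
  have been treated. The 2 per edge pay for the test and the increment, the final 2 for resetting
  the counter and for the last test.\<close>

lemma runs_for_edges:
  assumes "straight p" and m: "s ''m'' 0 = m" "0 \<le> m"
    and w: "''e'' \<notin> writes p" "''m'' \<notin> writes p"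
    and init: "I 0 (s(''e'' := (s ''e'')(0 := 0)))"
    and step: "\<And>i s'. I i s' \<Longrightarrow> agree_off (insert ''e'' (writes p)) s s' \<Longrightarrow> 0 \<le> i \<Longrightarrow> i < m \<Longrightarrow>
      s' ''e'' 0 = i \<Longrightarrow> I (i + 1) (result (p ;; assign ''e'' (plus1 (var ''e''))) s')"
  shows "runs (for_edges p) s ((step_bound p + 2) * nat m + 2) (I m)"
proof -
  let ?s = "s(''e'' := (s ''e'')(0 := 0))"
  let ?p = "p ;; assign ''e'' (plus1 (var ''e''))"
  define J where "J = (\<lambda>k s'. \<exists>i. k = nat (m - i) \<and> 0 \<le> i \<and> i \<le> m \<and> s' ''e'' 0 = i \<and> I i s')"
  have "runs (While (Less (var ''e'') (var ''m'')) ?p) ?s (Suc (Suc (step_bound ?p) * nat m))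
    (\<lambda>s'. (\<exists>k'. J k' s') \<and> \<not> bval (Less (var ''e'') (var ''m'')) s')"
  proof (rule runs_While_straight)
    show "straight ?p" using \<open>straight p\<close> by simp
    show "J (nat m) ?s" unfolding J_def using init m by (intro exI[of _ 0]) auto
    fix k s' assume "J k s'" and a: "agree_off (writes ?p) ?s s'"
      and b: "bval (Less (var ''e'') (var ''m'')) s'"
    then obtain i where i: "k = nat (m - i)" "0 \<le> i" "i \<le> m" "s' ''e'' 0 = i" "I i s'"
      unfolding J_def by blast
    have "s' ''m'' 0 = m" using agree_offD[OF a, of "''m''"] w m by simp
    with b i have im: "i < m" by simp
    have a': "agree_off (insert ''e'' (writes p)) s s'"
      using a by (auto simp: agree_off_def)
    have "result p s' ''e'' = s' ''e''"
      using exec_straight[OF \<open>straight p\<close>, of s'] exec_agree_off agree_offD w(1) by metis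
    then have "J (nat (m - (i + 1))) (result ?p s')"
      unfolding J_def using i im step[OF i(5) a' i(2) im i(4)] by (intro exI[of _ "i + 1"]) auto
    then show "\<exists>k'<k. J k' (result ?p s')" using i im by (intro exI[of _ "nat (m - (i+1))"]) auto
  qed
  then have "runs (While (Less (var ''e'') (var ''m'')) ?p) ?s (Suc (Suc (step_bound ?p) * nat m)) (I m)"
  proof (rule runs_agree_off[THEN runs_mono])
    fix s' assume h: "((\<exists>k'. J k' s') \<and> \<not> bval (Less (var ''e'') (var ''m'')) s') \<and>
      agree_off (writes (While (Less (var ''e'') (var ''m'')) ?p)) ?s s'"
    then have "s' ''m'' 0 = m" using agree_offD[of _ _ s' "''m''"] w m by fastforce
    with h show "I m s'" unfolding J_def by fastforce
  qed simp
  then have "runs (for_edges p) s (1 + Suc (Suc (step_bound ?p) * nat m)) (I m)"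
    unfolding for_edges_def
    by (intro runs_Seq[where Q = "\<lambda>s'. s' = ?s"])
      (use runs_straight[of "assign ''e'' (Const 0)" "\<lambda>s'. s' = ?s" s] in auto)
  then show ?thesis by (rule runs_mono) auto
qed

section \<open>Linked lists and adjacency\<close>

text \<open>Links store \<open>e + 1\<close> for the edge number \<open>e\<close>, so that the initial memory, which is 0,
  consists of empty lists.\<close>

fun linked :: "(int \<Rightarrow> int) \<Rightarrow> int \<Rightarrow> int list \<Rightarrow> bool" where
  "linked nx h [] \<longleftrightarrow> h = 0"
| "linked nx h (e # es) \<longleftrightarrow> h = e + 1 \<and> linked nx (nx e) es"

lemma linked_upd [simp]: "e \<notin> set es \<Longrightarrow> linked (nx(e := h')) h es = linked nx h es"
  by (induction es arbitrary: h) auto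

lemma linked_cases:
  assumes "linked nx h es" "\<forall>e\<in>set es. 0 \<le> e"
  obtains (Nil) "h = 0" "es = []"
    | (Cons) es' where "0 < h" "es = (h - 1) # es'" "linked nx (nx (h - 1)) es'"
  using assms by (cases es) fastforce+

section \<open>Adjacency lists and cursors into them\<close>

locale arcs =
  fixes m :: int and src dst :: "int \<Rightarrow> int"
    and oh on ih inx :: "int \<Rightarrow> int" and outs ins :: "int \<Rightarrow> int list"
  assumes m_nonneg: "0 \<le> m"
    and outs: "linked on (oh v) (outs v)" "distinct (outs v)" "set (outs v) = {e \<in> {0..<m}. src e = v}"
    and ins: "linked inx (ih v) (ins v)" "distinct (ins v)" "set (ins v) = {e \<in> {0..<m}. dst e = v}"
begin

definition E :: "int set" where "E = {0..<m}"

text \<open>Only endpoints of edges count as vertices here, so that a pass over \<open>T\<close> is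
  possible in time linear in \<open>m\<close>.\<close>

definition T :: "int set" where "T = src ` E \<union> dst ` E"

lemma finite_E [simp]: "finite E" and finite_T [simp]: "finite T"
  by (auto simp: E_def T_def)

lemma card_E [simp]: "card E = nat m"
  by (simp add: E_def)

lemma src_T [simp]: "e \<in> E \<Longrightarrow> src e \<in> T" and dst_T [simp]: "e \<in> E \<Longrightarrow> dst e \<in> T"
  by (auto simp: T_def)

text \<open>Current-edge pointers: \<open>rest v\<close> is the ghost list of edges at
  \<open>v\<close> that are still to be scanned, \<open>cur v\<close> its head in memory. With
  \<open>key = src\<close> the outgoing edges are traversed, with \<open>key = dst\<close> the
  incoming ones.\<close>

definition cursor :: "(int \<Rightarrow> int) \<Rightarrow> (int \<Rightarrow> int) \<Rightarrow> (int \<Rightarrow> int) \<Rightarrow> (int \<Rightarrow> int list) \<Rightarrow> bool" where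
  "cursor nx key cur rest \<longleftrightarrow> (\<forall>v\<in>T. linked nx (cur v) (rest v) \<and> distinct (rest v) \<and>
     set (rest v) \<subseteq> {e \<in> E. key e = v})"

text \<open>The size of this set is the part of the time budget that pays for scanning; each advance
  of a cursor removes exactly one element.\<close>

definition pending :: "(int \<Rightarrow> int) \<Rightarrow> (int \<Rightarrow> int list) \<Rightarrow> int set" where
  "pending key rest = {e \<in> E. e \<in> set (rest (key e))}"

lemma pending_subset: "pending key rest \<subseteq> E"
  by (auto simp: pending_def)

lemma finite_pending [simp]: "finite (pending key rest)"
  by (rule finite_subset[OF pending_subset]) simp

lemma cursor_outs: "\<forall>v\<in>T. cur v = oh v \<Longrightarrow> cursor on src cur outs"
  using outs by (auto simp: cursor_def E_def)

lemma cursor_ins: "\<forall>v\<in>T. cur v = ih v \<Longrightarrow> cursor inx dst cur ins"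
  using ins by (auto simp: cursor_def E_def)

lemma cursor_end:
  assumes "cursor nx key cur rest" "v \<in> T" "\<not> 0 < cur v"
  shows "rest v = []"
proof -
  have "linked nx (cur v) (rest v)" "\<forall>e\<in>set (rest v). 0 \<le> e"
    using assms by (auto simp: cursor_def E_def)
  then show ?thesis using assms(3) by (cases rule: linked_cases) auto
qed

lemma cursor_advance:
  assumes "cursor nx key cur rest" "v \<in> T" "0 < cur v"
  defines "e \<equiv> cur v - 1"
  obtains es where "rest v = e # es" "e \<in> E" "key e = v" "e \<in> pending key rest"
    "cursor nx key (cur(v := nx e)) (rest(v := es))"
    "pending key (rest(v := es)) = pending key rest - {e}"
proof -
  have l: "linked nx (cur v) (rest v)" "\<forall>e\<in>set (rest v). 0 \<le> e"
    using assms by (auto simp: cursor_def E_def)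
  then obtain es where es: "rest v = e # es" "linked nx (nx e) es"
    using assms(3) unfolding e_def by (cases rule: linked_cases) auto
  have d: "distinct (e # es)" "set (e # es) \<subseteq> {e \<in> E. key e = v}"
    using assms(1,2) es(1) unfolding cursor_def by fastforce+
  show ?thesis
  proof (rule that)
    show "rest v = e # es" "e \<in> E" "key e = v" using es d by auto
    then show "e \<in> pending key rest" by (auto simp: pending_def)
    show "cursor nx key (cur(v := nx e)) (rest(v := es))"
      using assms(1) es d unfolding cursor_def by auto
    show "pending key (rest(v := es)) = pending key rest - {e}"
      using es d by (auto simp: pending_def split: if_splits)
  qed
qed

end

text \<open>\<open>P\<close> certifies that there is no negative cycle: lowering every dual by
  \<open>P\<close> would make all lengths nonnegative. The program never sees it. All facts about
  paths below are expressed as inequalities between values of \<open>P\<close>.\<close>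

locale weighted = arcs +
  fixes r P :: "int \<Rightarrow> int"
  assumes P_nonneg: "0 \<le> P v"
    and feasible: "e \<in> E \<Longrightarrow> P (src e) \<le> r e + P (dst e)"
begin

lemma P_mono: "e \<in> E \<Longrightarrow> r e \<le> 0 \<Longrightarrow> P (src e) \<le> P (dst e)"
  using feasible by fastforce

section \<open>Depth-first search\<close>

text \<open>The argument \<open>k\<close> is the remaining time. A vertex \<open>v\<close> is discovered if \<open>0 < lw v\<close> and
  finished if \<open>ps v \<noteq> 0\<close>; then \<open>ps v\<close> is its postorder number, \<open>od\<close> is the inverse of \<open>ps\<close>, and
  the descendants of \<open>v\<close> are the vertices with postorder number in the interval from \<open>lw v\<close> to
  \<open>ps v\<close>. Reachability along edges with \<open>r e \<le> 0\<close> is only recorded through its effect on \<open>P\<close>.\<close>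

definition finished_ok :: "(int \<Rightarrow> int) \<Rightarrow> (int \<Rightarrow> int) \<Rightarrow> (int \<Rightarrow> int) \<Rightarrow> int \<Rightarrow> bool" where
  "finished_ok lw ps od c \<longleftrightarrow> 0 \<le> c \<and>
     (\<forall>i. 1 \<le> i \<and> i \<le> c \<longrightarrow> od i \<in> T \<and> ps (od i) = i) \<and>
     (\<forall>v\<in>T. ps v \<noteq> 0 \<longrightarrow> 1 \<le> ps v \<and> ps v \<le> c \<and> od (ps v) = v \<and> 1 \<le> lw v \<and> lw v \<le> ps v) \<and>
     (\<forall>v\<in>T. \<forall>x\<in>T. ps v \<noteq> 0 \<and> ps x \<noteq> 0 \<and> lw v \<le> ps x \<and> ps x \<le> ps v \<longrightarrow> P v \<le> P x \<and> lw v \<le> lw x) \<and>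
     (\<forall>e\<in>E. ps (src e) \<noteq> 0 \<and> r e \<le> 0 \<longrightarrow> 1 \<le> lw (dst e) \<and>
        (ps (dst e) \<noteq> 0 \<and> ps (dst e) < ps (src e) \<or> lw (dst e) \<le> ps (src e)))"

text \<open>The stack is a path of the search, recorded by its consequences: \<open>lw\<close> and
  \<open>P\<close> do not decrease towards the top, and every vertex finished since a stack vertex
  was discovered behaves as its descendant.\<close>

definition stack_ok :: "int \<Rightarrow> (int \<Rightarrow> int) \<Rightarrow> (int \<Rightarrow> int) \<Rightarrow> (int \<Rightarrow> int) \<Rightarrow> int \<Rightarrow> bool" where
  "stack_ok sp st lw ps c \<longleftrightarrow> 0 \<le> sp \<and>
     (\<forall>i. 1 \<le> i \<and> i \<le> sp \<longrightarrow> st i \<in> T \<and> ps (st i) = 0 \<and> 1 \<le> lw (st i) \<and> lw (st i) \<le> c + 1) \<and>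
     (\<forall>i j. 1 \<le> i \<and> i < j \<and> j \<le> sp \<longrightarrow> st i \<noteq> st j \<and> lw (st i) \<le> lw (st j) \<and> P (st i) \<le> P (st j)) \<and>
     (\<forall>v\<in>T. 1 \<le> lw v \<and> ps v = 0 \<longrightarrow> (\<exists>i. 1 \<le> i \<and> i \<le> sp \<and> st i = v)) \<and>
     (\<forall>i. 1 \<le> i \<and> i \<le> sp \<longrightarrow> (\<forall>x\<in>T. ps x \<noteq> 0 \<and> lw (st i) \<le> ps x \<longrightarrow> P (st i) \<le> P x \<and> lw (st i) \<le> lw x))"

text \<open>The roots are the sources of the edges in order, and \<open>e\<close> is the next
  candidate. A pending edge and a remaining candidate each hold 2 units of \<open>k\<close>, one for
  being treated and one for popping the vertex they may push. Since every push uses up an edge or a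
  candidate, \<open>c + sp\<close> plus the pending edges stays below \<open>e + m\<close>; this
  bounds the numbers in use by \<open>2 * m\<close>.\<close>

definition dfs_inv where
  "dfs_inv k rest e sp st lw cur ps od c \<longleftrightarrow>
     0 \<le> e \<and> e \<le> m \<and> cursor on src cur rest \<and> stack_ok sp st lw ps c \<and> finished_ok lw ps od c \<and>
     (\<forall>x\<in>E. x < e \<longrightarrow> 1 \<le> lw (src x)) \<and>
     (\<forall>x\<in>E. x \<notin> pending src rest \<and> r x \<le> 0 \<longrightarrow> 1 \<le> lw (dst x)) \<and>
     (\<forall>v\<in>T. ps v \<noteq> 0 \<longrightarrow> rest v = []) \<and>
     c + sp + int (card (pending src rest)) \<le> e + m \<and>
     k = 2 * card (pending src rest) + nat sp + 2 * nat (m - e)"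

lemma dfs_init:
  assumes "\<forall>v\<in>T. lw v = 0 \<and> ps v = 0 \<and> cur v = oh v"
  shows "dfs_inv (4 * nat m) outs 0 0 st lw cur ps od 0"
proof -
  have p: "pending src outs = E" using outs(3) by (auto simp: pending_def E_def)
  have "cursor on src cur outs" using assms cursor_outs by blast
  moreover have "stack_ok 0 st lw ps 0" using assms by (auto simp: stack_ok_def)
  moreover have "finished_ok lw ps od 0" using assms by (auto simp: finished_ok_def)
  moreover have "\<not> x < 0" if "x \<in> E" for x using that by (simp add: E_def)
  ultimately show ?thesis
    unfolding dfs_inv_def p using assms m_nonneg by auto
qed

text \<open>The value \<open>c + 1\<close> is the first postorder number that a descendant of
  \<open>v\<close> can get. No finished vertex has a number that large, so the new top starts
  without descendants.\<close>

lemma stack_push: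
  assumes st: "stack_ok sp st lw ps c" and fin: "finished_ok lw ps od c"
    and v: "v \<in> T" "lw v < 1"
    and par: "0 < sp \<Longrightarrow> P (st sp) \<le> P v"
  shows "stack_ok (sp + 1) (st(sp + 1 := v)) (lw(v := c + 1)) ps c"
    and "finished_ok (lw(v := c + 1)) ps od c"
proof -
  have pv: "ps v = 0" using fin v unfolding finished_ok_def by fastforce
  have neq: "st i \<noteq> v" if "1 \<le> i" "i \<le> sp" for i
    using st that v unfolding stack_ok_def by fastforce
  have c0: "0 \<le> c" using fin by (simp add: finished_ok_def)
  have P: "P (st i) \<le> P v" if "1 \<le> i" "i \<le> sp" for i
  proof (cases "i = sp")
    case False
    with that st have "P (st i) \<le> P (st sp)" unfolding stack_ok_def by fastforce
    with par that show ?thesis by simp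
  qed (use par that in auto)
  show "finished_ok (lw(v := c + 1)) ps od c"
    using fin v pv c0 unfolding finished_ok_def by auto
  show "stack_ok (sp + 1) (st(sp + 1 := v)) (lw(v := c + 1)) ps c"
    unfolding stack_ok_def
  proof (intro conjI allI impI ballI; (elim conjE)?)
    show "0 \<le> sp + 1" using st by (simp add: stack_ok_def)
  next
    fix i assume i: "1 \<le> i" "i \<le> sp + 1"
    show "(st(sp + 1 := v)) i \<in> T" "ps ((st(sp + 1 := v)) i) = 0"
      "1 \<le> (lw(v := c + 1)) ((st(sp + 1 := v)) i)"
      "(lw(v := c + 1)) ((st(sp + 1 := v)) i) \<le> c + 1"
      using st v pv i c0 by (auto simp: stack_ok_def)
    fix x assume x: "x \<in> T" "ps x \<noteq> 0" "(lw(v := c + 1)) ((st(sp + 1 := v)) i) \<le> ps x"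
    have "ps x \<le> c" using fin x by (auto simp: finished_ok_def)
    then have "i \<le> sp" using x(3) i by (cases "i = sp + 1") auto
    then show "P ((st(sp + 1 := v)) i) \<le> P x"
      "(lw(v := c + 1)) ((st(sp + 1 := v)) i) \<le> (lw(v := c + 1)) x"
      using st x i neq[of i] pv by (auto simp: stack_ok_def split: if_splits)
  next
    fix i j assume ij: "1 \<le> i" "i < j" "j \<le> sp + 1"
    show "(st(sp + 1 := v)) i \<noteq> (st(sp + 1 := v)) j"
      "(lw(v := c + 1)) ((st(sp + 1 := v)) i) \<le> (lw(v := c + 1)) ((st(sp + 1 := v)) j)"
      "P ((st(sp + 1 := v)) i) \<le> P ((st(sp + 1 := v)) j)"
      using st ij neq[of i] neq[of j] P[of i] by (auto simp: stack_ok_def)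
  next
    fix x assume "x \<in> T" "1 \<le> (lw(v := c + 1)) x" "ps x = 0"
    then show "\<exists>i. 1 \<le> i \<and> i \<le> sp + 1 \<and> (st(sp + 1 := v)) i = x"
    proof (cases "x = v")
      case True
      then show ?thesis using st by (intro exI[of _ "sp + 1"]) (auto simp: stack_ok_def)
    next
      case False
      then obtain i where "1 \<le> i" "i \<le> sp" "st i = x"
        using st \<open>x \<in> T\<close> \<open>1 \<le> (lw(v := c + 1)) x\<close> \<open>ps x = 0\<close> unfolding stack_ok_def by fastforce
      then show ?thesis by (intro exI[of _ i]) auto
    qed
  qed
qed

lemma dfs_root:
  assumes inv: "dfs_inv k rest e sp st lw cur ps od c" and "\<not> 0 < sp" "e < m"
  shows "lw (src e) < 1 \<Longrightarrow> \<exists>k'<k. dfs_inv k' rest (e + 1) (sp + 1) (st(sp + 1 := src e))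
      (lw(src e := c + 1)) cur ps od c"
    and "\<not> lw (src e) < 1 \<Longrightarrow> \<exists>k'<k. dfs_inv k' rest (e + 1) sp st lw cur ps od c"
proof -
  have eE: "e \<in> E" using assms by (simp add: dfs_inv_def E_def)
  have sp: "sp = 0" and c: "0 \<le> c" using assms by (auto simp: dfs_inv_def stack_ok_def finished_ok_def)
  note i = inv[unfolded dfs_inv_def]
  {
    assume l: "lw (src e) < 1"
    have "stack_ok (sp + 1) (st(sp + 1 := src e)) (lw(src e := c + 1)) ps c"
      "finished_ok (lw(src e := c + 1)) ps od c"
      using stack_push[of sp st lw ps c od "src e"] i l eE assms(2) by auto
    then show "\<exists>k'<k. dfs_inv k' rest (e + 1) (sp + 1) (st(sp + 1 := src e))
        (lw(src e := c + 1)) cur ps od c"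
      using i assms(3) eE c sp by (intro exI[of _ "k - 1"]) (auto simp: dfs_inv_def)
  next
    assume l: "\<not> lw (src e) < 1"
    have "x < e \<or> x = e" if "x < e + 1" for x using that by auto
    then show "\<exists>k'<k. dfs_inv k' rest (e + 1) sp st lw cur ps od c"
      using i assms(3) eE c sp l by (intro exI[of _ "k - 2"]) (auto simp: dfs_inv_def)
  }
qed

lemma dfs_edge:
  assumes inv: "dfs_inv k rest e sp st lw cur ps od c" and sp: "0 < sp" and cur: "0 < cur (st sp)"
  defines "x \<equiv> cur (st sp) - 1"
  defines "cur' \<equiv> cur(st sp := on x)"
  shows "r x < 1 \<Longrightarrow> lw (dst x) < 1 \<Longrightarrow> \<exists>k'<k. \<exists>rest'. dfs_inv k' rest' e (sp + 1)
      (st(sp + 1 := dst x)) (lw(dst x := c + 1)) cur' ps od c"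
    and "\<not> (r x < 1 \<and> lw (dst x) < 1) \<Longrightarrow> \<exists>k'<k. \<exists>rest'. dfs_inv k' rest' e sp st lw cur' ps od c"
    and "x \<in> E"
proof -
  note i = inv[unfolded dfs_inv_def]
  have v: "st sp \<in> T" "ps (st sp) = 0" using i sp by (auto simp: stack_ok_def)
  have c: "0 \<le> c" using i by (auto simp: finished_ok_def)
  obtain es where es: "rest (st sp) = x # es" "x \<in> E" "src x = st sp" "x \<in> pending src rest"
    "cursor on src cur' (rest(st sp := es))"
    "pending src (rest(st sp := es)) = pending src rest - {x}"
    using cursor_advance[of on src cur rest "st sp"] i v cur unfolding x_def cur'_def by metis
  show "x \<in> E" by fact
  have card: "card (pending src rest) = Suc (card (pending src rest - {x}))"
    using es(4) card_Suc_Diff1[OF finite_pending] by metis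
  have keep: "\<forall>v\<in>T. ps v \<noteq> 0 \<longrightarrow> (rest(st sp := es)) v = []" using i v by auto
  {
    assume l: "r x < 1" "lw (dst x) < 1"
    have "P (st sp) \<le> P (dst x)" using P_mono[OF es(2)] l es(3) by simp
    then have "stack_ok (sp + 1) (st(sp + 1 := dst x)) (lw(dst x := c + 1)) ps c"
      "finished_ok (lw(dst x := c + 1)) ps od c"
      using stack_push[of sp st lw ps c od "dst x"] i l es(2) by auto
    then have "dfs_inv (k - 1) (rest(st sp := es)) e (sp + 1)
      (st(sp + 1 := dst x)) (lw(dst x := c + 1)) cur' ps od c"
      unfolding dfs_inv_def es(6) using i es(5) keep card c sp by auto
    moreover have "k - 1 < k" using i card by simp
    ultimately show "\<exists>k'<k. \<exists>rest'. dfs_inv k' rest' e (sp + 1)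
      (st(sp + 1 := dst x)) (lw(dst x := c + 1)) cur' ps od c" by blast
  next
    assume l: "\<not> (r x < 1 \<and> lw (dst x) < 1)"
    then have "dfs_inv (k - 2) (rest(st sp := es)) e sp st lw cur' ps od c"
      unfolding dfs_inv_def es(6) using i es(5) keep card c by auto
    moreover have "k - 2 < k" using i card by simp
    ultimately show "\<exists>k'<k. \<exists>rest'. dfs_inv k' rest' e sp st lw cur' ps od c" by blast
  }
qed

text \<open>The vertices finished while \<open>st sp\<close> was on the stack have exactly the
  numbers from its \<open>lw\<close> to \<open>c\<close>. Giving it the number \<open>c + 1\<close>
  therefore closes its interval of descendants.\<close>

lemma dfs_finish:
  assumes inv: "dfs_inv k rest e sp st lw cur ps od c" and sp: "0 < sp" and cur: "\<not> 0 < cur (st sp)"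
  shows "\<exists>k'<k. dfs_inv k' rest e (sp - 1) st lw cur (ps(st sp := c + 1)) (od(c + 1 := st sp)) (c + 1)"
proof -
  note i = inv[unfolded dfs_inv_def]
  define v where "v = st sp"
  have st: "stack_ok sp st lw ps c" and fin: "finished_ok lw ps od c" using i by auto
  have v: "v \<in> T" "ps v = 0" "1 \<le> lw v" "lw v \<le> c + 1"
    and desc: "\<And>x. x \<in> T \<Longrightarrow> ps x \<noteq> 0 \<Longrightarrow> lw v \<le> ps x \<Longrightarrow> P v \<le> P x \<and> lw v \<le> lw x"
    using st sp unfolding stack_ok_def v_def by auto
  have c: "0 \<le> c" using fin by (auto simp: finished_ok_def)
  have psc: "ps x \<le> c" if "x \<in> T" for x using fin that c by (cases "ps x = 0") (auto simp: finished_ok_def)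
  have re: "rest v = []" using cursor_end[of on src cur rest v] i v(1) cur unfolding v_def by auto
  have vis: "1 \<le> lw (dst x)" if "x \<in> E" "src x = v" "r x \<le> 0" for x
    using i that re by (auto simp: pending_def)
  \<comment> \<open>Whatever has been discovered by now was discovered with a value of at most
    \<open>c + 1\<close>, the number just assigned. For the out-edges of the finished vertex this is
    the second alternative of the edge clause.\<close>
  have lwc: "lw x \<le> c + 1" if x: "x \<in> T" "1 \<le> lw x" for x
  proof (cases "ps x = 0")
    case True
    then obtain j where "1 \<le> j" "j \<le> sp" "st j = x" using st x unfolding stack_ok_def by blast
    then show ?thesis using st unfolding stack_ok_def by blast
  next
    case False
    then have "lw x \<le> ps x" using fin x unfolding finished_ok_def by blast
    then show ?thesis using psc[OF x(1)] by simp
  qed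
  let ?ps = "ps(v := c + 1)"
  have fin': "finished_ok lw ?ps (od(c + 1 := v)) (c + 1)"
    unfolding finished_ok_def
  proof (intro conjI allI impI ballI; (elim conjE)?)
    show "0 \<le> c + 1" using c by simp
  next
    fix j assume j: "1 \<le> j" "j \<le> c + 1"
    show "(od(c + 1 := v)) j \<in> T" using fin v j by (auto simp: finished_ok_def)
    show "?ps ((od(c + 1 := v)) j) = j"
      using fin v j by (auto simp: finished_ok_def)
  next
    fix x assume x: "x \<in> T" "?ps x \<noteq> 0"
    show "1 \<le> ?ps x" "?ps x \<le> c + 1" "(od(c + 1 := v)) (?ps x) = x" "1 \<le> lw x" "lw x \<le> ?ps x"
      using x fin v c psc[OF x(1)] by (auto simp: finished_ok_def split: if_splits)
  next
    fix w x assume wx: "w \<in> T" "x \<in> T" "?ps w \<noteq> 0" "?ps x \<noteq> 0" "lw w \<le> ?ps x" "?ps x \<le> ?ps w"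
    have "P w \<le> P x \<and> lw w \<le> lw x"
    proof (cases "x = v")
      case True
      then have "w = v" using wx psc[OF wx(1)] by (auto split: if_splits)
      with True show ?thesis by simp
    next
      case False
      then show ?thesis using wx desc[of x] fin unfolding finished_ok_def by (cases "w = v") auto
    qed
    then show "P w \<le> P x" "lw w \<le> lw x" by auto
  next
    fix x assume x: "x \<in> E" "?ps (src x) \<noteq> 0" "r x \<le> 0"
    have "1 \<le> lw (dst x) \<and> (?ps (dst x) \<noteq> 0 \<and> ?ps (dst x) < ?ps (src x) \<or> lw (dst x) \<le> ?ps (src x))"
    proof (cases "src x = v")
      case True
      with vis x have "1 \<le> lw (dst x)" by auto
      with lwc[of "dst x"] x True show ?thesis by auto
    next
      case False
      then have "1 \<le> lw (dst x) \<and> (ps (dst x) \<noteq> 0 \<and> ps (dst x) < ps (src x) \<or> lw (dst x) \<le> ps (src x))"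
        using fin x unfolding finished_ok_def by auto
      then show ?thesis using False v by auto
    qed
    then show "1 \<le> lw (dst x)" 
      "?ps (dst x) \<noteq> 0 \<and> ?ps (dst x) < ?ps (src x) \<or> lw (dst x) \<le> ?ps (src x)" by auto
  qed
  have neq: "st j \<noteq> v" if "1 \<le> j" "j \<le> sp - 1" for j
    using st that sp unfolding stack_ok_def v_def by fastforce
  have st': "stack_ok (sp - 1) st lw ?ps (c + 1)"
    unfolding stack_ok_def
  proof (intro conjI allI impI ballI; (elim conjE)?)
    show "0 \<le> sp - 1" using sp by simp
  next
    fix j assume j: "1 \<le> j" "j \<le> sp - 1"
    show "st j \<in> T" "?ps (st j) = 0" "1 \<le> lw (st j)" "lw (st j) \<le> c + 1 + 1"
      using st j neq[OF j] by (fastforce simp: stack_ok_def)+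
    fix x assume x: "x \<in> T" "?ps x \<noteq> 0" "lw (st j) \<le> ?ps x"
    have "P (st j) \<le> P x \<and> lw (st j) \<le> lw x"
      using st x j by (cases "x = v") (auto simp: stack_ok_def v_def)
    then show "P (st j) \<le> P x" "lw (st j) \<le> lw x" by auto
  next
    fix i j assume ij: "1 \<le> i" "i < j" "j \<le> sp - 1"
    show "st i \<noteq> st j" "lw (st i) \<le> lw (st j)" "P (st i) \<le> P (st j)"
      using st ij by (auto simp: stack_ok_def)
  next
    fix x assume x: "x \<in> T" "1 \<le> lw x" "?ps x = 0"
    then have "x \<noteq> v" using c by auto
    then have "ps x = 0" using x by simp
    then obtain j where j: "1 \<le> j" "j \<le> sp" "st j = x"
      using st x unfolding stack_ok_def by blast
    then have "j \<noteq> sp" using \<open>x \<noteq> v\<close> v_def by auto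
    with j show "\<exists>j. 1 \<le> j \<and> j \<le> sp - 1 \<and> st j = x" by (intro exI[of _ j]) auto
  qed
  show ?thesis
    using i fin' st' re sp c unfolding dfs_inv_def v_def[symmetric]
    by (intro exI[of _ "k - 1"]) auto
qed

text \<open>Every source is a root candidate and hence numbered, but the head of a positive edge may
  remain without a number. Such a vertex ends up in the default class 0.\<close>

definition postorder :: "(int \<Rightarrow> int) \<Rightarrow> (int \<Rightarrow> int) \<Rightarrow> (int \<Rightarrow> int) \<Rightarrow> int \<Rightarrow> bool" where
  "postorder lw ps od c \<longleftrightarrow> finished_ok lw ps od c \<and> (\<forall>e\<in>E. ps (src e) \<noteq> 0) \<and>
     (\<forall>e\<in>E. r e \<le> 0 \<longrightarrow> ps (dst e) \<noteq> 0) \<and> c \<le> 2 * m"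

lemma dfs_done:
  assumes inv: "dfs_inv k rest e sp st lw cur ps od c" and "\<not> 0 < sp" "\<not> e < m"
  shows "postorder lw ps od c"
proof -
  note i = inv[unfolded dfs_inv_def]
  have "sp = 0" using i assms(2) by (auto simp: stack_ok_def)
  then have bl: "ps v \<noteq> 0" if "v \<in> T" "1 \<le> lw v" for v
    using that i unfolding stack_ok_def by (metis int_one_le_iff_zero_less linorder_not_le order_less_le_trans)
  have s: "ps (src x) \<noteq> 0" if "x \<in> E" for x
    using bl[of "src x"] i that assms(3) by (auto simp: E_def)
  moreover have "ps (dst x) \<noteq> 0" if "x \<in> E" "r x \<le> 0" for x
    using bl[of "dst x"] i that s[of x] by (auto simp: finished_ok_def)
  moreover have "c \<le> 2 * m" using i \<open>sp = 0\<close> by linarith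
  ultimately show ?thesis using i unfolding postorder_def by blast
qed

end

context weighted
begin

section \<open>Levels\<close>

text \<open>Backward searches from the vertices in decreasing postorder split the vertices into classes
  on which \<open>P\<close> is constant; \<open>cm v\<close> is the postorder number of the first vertex of the class of \<open>v\<close>,
  and \<open>la\<close> and \<open>vi\<close> are indexed by these numbers.\<close>

definition via_ok where
  "via_ok od cm la j x (l :: int) \<longleftrightarrow> x \<in> E \<and> r x < 0 \<and> j < cm (src x) \<and> la (cm (src x)) = l - 1 \<and>
     P (dst x) \<le> P (od j)"

text \<open>Decreasing postorder treats classes in topological order: a scanned nonpositive edge
  into class \<open>i\<close> comes from this class or from one with a larger number, whose level is
  final. The clause with \<open>lw (od (cm v))\<close> keeps each class among the descendants of its
  first vertex. The value \<open>la 0 = 0\<close> is the level of all vertices in no class.\<close>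

definition scan_inv where
  "scan_inv k rest i sp st cm ci (la :: int \<Rightarrow> int) vi lw ps od c \<longleftrightarrow>
     1 \<le> i \<and> i \<le> c + 1 \<and> 0 \<le> sp \<and> cursor inx dst ci rest \<and> la 0 = 0 \<and>
     (\<forall>j. 1 \<le> j \<and> j \<le> sp \<longrightarrow> st j \<in> T \<and> cm (st j) = i) \<and>
     (\<forall>v\<in>T. cm v \<noteq> 0 \<longrightarrow> i \<le> cm v \<and> cm v \<le> c \<and> ps v \<noteq> 0 \<and> cm (od (cm v)) = cm v \<and>
        lw (od (cm v)) \<le> ps v \<and> ps v \<le> cm v \<and> P v = P (od (cm v))) \<and>
     (\<forall>j. i \<le> j \<and> j \<le> c \<longrightarrow> cm (od j) \<noteq> 0) \<and>
     (\<forall>v\<in>T. cm v \<noteq> 0 \<longrightarrow> rest v = [] \<or> (\<exists>j. 1 \<le> j \<and> j \<le> sp \<and> st j = v)) \<and>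
     (\<forall>e\<in>E. e \<notin> pending dst rest \<and> r e \<le> 0 \<longrightarrow> cm (dst e) \<noteq> 0 \<and> cm (dst e) \<le> cm (src e) \<and>
        la (cm (src e)) + (if r e < 0 then 1 else 0) \<le> la (cm (dst e))) \<and>
     (\<forall>j. i \<le> j \<and> j \<le> c \<and> cm (od j) = j \<longrightarrow> 0 \<le> la j \<and>
        (0 < la j \<longrightarrow> via_ok od cm la j (vi j - 1) (la j))) \<and>
     k = 2 * card (pending dst rest) + nat sp + 2 * nat i"

lemma scan_invD:
  assumes "scan_inv k rest i sp st cm ci la vi lw ps od c"
  shows "1 \<le> i" "i \<le> c + 1" "0 \<le> sp" "cursor inx dst ci rest" "la 0 = 0"
    "\<forall>j. 1 \<le> j \<and> j \<le> sp \<longrightarrow> st j \<in> T \<and> cm (st j) = i"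
    "\<forall>v\<in>T. cm v \<noteq> 0 \<longrightarrow> i \<le> cm v \<and> cm v \<le> c \<and> ps v \<noteq> 0 \<and> cm (od (cm v)) = cm v \<and>
        lw (od (cm v)) \<le> ps v \<and> ps v \<le> cm v \<and> P v = P (od (cm v))"
    "\<forall>j. i \<le> j \<and> j \<le> c \<longrightarrow> cm (od j) \<noteq> 0"
    "\<forall>v\<in>T. cm v \<noteq> 0 \<longrightarrow> rest v = [] \<or> (\<exists>j. 1 \<le> j \<and> j \<le> sp \<and> st j = v)"
    "\<forall>e\<in>E. e \<notin> pending dst rest \<and> r e \<le> 0 \<longrightarrow> cm (dst e) \<noteq> 0 \<and> cm (dst e) \<le> cm (src e) \<and>
        la (cm (src e)) + (if r e < 0 then 1 else 0) \<le> la (cm (dst e))"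
    "\<forall>j. i \<le> j \<and> j \<le> c \<and> cm (od j) = j \<longrightarrow> 0 \<le> la j \<and>
        (0 < la j \<longrightarrow> via_ok od cm la j (vi j - 1) (la j))"
    "k = 2 * card (pending dst rest) + nat sp + 2 * nat i"
  using assms unfolding scan_inv_def by blast+

lemma scan_init:
  assumes "postorder lw ps od c" "\<forall>v\<in>T. cm v = 0 \<and> ci v = ih v" "la 0 = 0"
  shows "\<exists>k. k \<le> 6 * nat m + 2 \<and> scan_inv k ins (c + 1) 0 st cm ci la vi lw ps od c"
proof -
  have p: "pending dst ins = E" using ins(3) by (auto simp: pending_def E_def)
  have c: "0 \<le> c" "c \<le> 2 * m" using assms(1) by (auto simp: postorder_def finished_ok_def)
  have "cursor inx dst ci ins" using assms cursor_ins by blast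
  then have "scan_inv (2 * nat m + 2 * nat (c + 1)) ins (c + 1) 0 st cm ci la vi lw ps od c"
    using assms c unfolding scan_inv_def p by auto
  moreover have "2 * nat m + 2 * nat (c + 1) \<le> 6 * nat m + 2" using c by linarith
  ultimately show ?thesis by blast
qed

lemma scan_pop:
  assumes inv: "scan_inv k rest i sp st cm ci la vi lw ps od c" and "0 < sp" "\<not> 0 < ci (st sp)"
  shows "\<exists>k'<k. scan_inv k' rest i (sp - 1) st cm ci la vi lw ps od c"
proof -
  note i = scan_invD[OF inv]
  have stk: "\<forall>j. 1 \<le> j \<and> j \<le> sp \<longrightarrow> st j \<in> T \<and> cm (st j) = i"
    and asg: "\<forall>v\<in>T. cm v \<noteq> 0 \<longrightarrow> rest v = [] \<or> (\<exists>j. 1 \<le> j \<and> j \<le> sp \<and> st j = v)"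
    and cur: "cursor inx dst ci rest"
    and k: "k = 2 * card (pending dst rest) + nat sp + 2 * nat i"
    by (fact i)+
  have re: "rest (st sp) = []" using cursor_end[OF cur] stk assms by auto
  have emp: "\<forall>v\<in>T. cm v \<noteq> 0 \<longrightarrow> rest v = [] \<or> (\<exists>j. 1 \<le> j \<and> j \<le> sp - 1 \<and> st j = v)"
  proof (intro ballI impI)
    fix v assume v: "v \<in> T" "cm v \<noteq> 0"
    show "rest v = [] \<or> (\<exists>j. 1 \<le> j \<and> j \<le> sp - 1 \<and> st j = v)"
    proof (cases "rest v = []")
      case False
      then obtain j where j: "1 \<le> j" "j \<le> sp" "st j = v" using asg v by blast
      then have "j \<noteq> sp" using False re by auto
      then show ?thesis using j by (intro disjI2 exI[of _ j]) auto
    qed simp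
  qed
  have stk': "\<forall>j. 1 \<le> j \<and> j \<le> sp - 1 \<longrightarrow> st j \<in> T \<and> cm (st j) = i" using stk by auto
  have "nat sp = Suc (nat (sp - 1))" using assms(2) by simp
  then have k': "k - 1 = 2 * card (pending dst rest) + nat (sp - 1) + 2 * nat i" using k by simp
  have sp': "0 \<le> sp - 1" using assms(2) by simp
  have "scan_inv (k - 1) rest i (sp - 1) st cm ci la vi lw ps od c"
    unfolding scan_inv_def by (intro conjI; fact i emp stk' k' sp')
  moreover have "k - 1 < k" using k assms(2) by simp
  ultimately show ?thesis by blast
qed

lemma scan_root:
  assumes post: "postorder lw ps od c"
    and inv: "scan_inv k rest i sp st cm ci la vi lw ps od c" and sp: "\<not> 0 < sp" and i1: "1 < i"
  shows "cm (od (i - 1)) < 1 \<Longrightarrow> \<exists>k'<k. scan_inv k' rest (i - 1) (sp + 1) (st(sp + 1 := od (i - 1)))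
      (cm(od (i - 1) := i - 1)) ci (la(i - 1 := 0)) vi lw ps od c"
    and "\<not> cm (od (i - 1)) < 1 \<Longrightarrow> \<exists>k'<k. scan_inv k' rest (i - 1) sp st cm ci la vi lw ps od c"
proof -
  note i = inv[unfolded scan_inv_def]
  have sp0: "sp = 0" using i sp by simp
  have emp: "rest v = []" if "v \<in> T" "cm v \<noteq> 0" for v using i that sp0 by auto
  have fin: "finished_ok lw ps od c" using post by (simp add: postorder_def)
  define v where "v = od (i - 1)"
  have v: "v \<in> T" "ps v = i - 1" using fin i i1 unfolding finished_ok_def v_def by auto
  have odps: "od (ps w) = w" if "w \<in> T" "ps w \<noteq> 0" for w using fin that by (auto simp: finished_ok_def)
  have psod: "ps (od j) = j" "od j \<in> T" if "1 \<le> j" "j \<le> c" for j using fin that by (auto simp: finished_ok_def)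
  {
    assume "cm (od (i - 1)) < 1"
    then have cmv: "cm v = 0" using i v(1) unfolding v_def by fastforce
    let ?cm = "cm(v := i - 1)" and ?la = "la(i - 1 := 0)"
    have lwv: "lw v \<le> i - 1" using fin v i1 by (auto simp: finished_ok_def)
    have ne: "od j \<noteq> v" if "i \<le> j" "j \<le> c" for j using psod[of j] v that i1 by auto
    have cls: "i - 1 \<le> ?cm w \<and> ?cm w \<le> c \<and> ps w \<noteq> 0 \<and> ?cm (od (?cm w)) = ?cm w \<and>
        lw (od (?cm w)) \<le> ps w \<and> ps w \<le> ?cm w \<and> P w = P (od (?cm w))" if "w \<in> T" "?cm w \<noteq> 0" for w
    proof (cases "w = v")
      case True
      then show ?thesis using v lwv i i1 unfolding v_def by auto
    next
      case False
      then have "i \<le> cm w \<and> cm w \<le> c \<and> ps w \<noteq> 0 \<and> cm (od (cm w)) = cm w \<and>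
        lw (od (cm w)) \<le> ps w \<and> ps w \<le> cm w \<and> P w = P (od (cm w))" using i that by auto
      then show ?thesis using False ne[of "cm w"] by auto
    qed
    have "scan_inv (k - 1) rest (i - 1) (sp + 1) (st(sp + 1 := v)) ?cm ci ?la vi lw ps od c"
      unfolding scan_inv_def
    proof (intro conjI allI impI ballI; (elim conjE)?)
      show "1 \<le> i - 1" "i - 1 \<le> c + 1" "0 \<le> sp + 1" "cursor inx dst ci rest" "?la 0 = 0"
        using i i1 by auto
    next
      fix j assume j: "1 \<le> j" "j \<le> sp + 1"
      show "(st(sp + 1 := v)) j \<in> T" "?cm ((st(sp + 1 := v)) j) = i - 1" using j sp0 v by auto
    next
      fix w assume w: "w \<in> T" "?cm w \<noteq> 0"
      from cls[OF w] show "i - 1 \<le> ?cm w" "?cm w \<le> c" "ps w \<noteq> 0" "?cm (od (?cm w)) = ?cm w"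
        "lw (od (?cm w)) \<le> ps w" "ps w \<le> ?cm w" "P w = P (od (?cm w))" by blast+
      show "rest w = [] \<or> (\<exists>j. 1 \<le> j \<and> j \<le> sp + 1 \<and> (st(sp + 1 := v)) j = w)"
        using emp[of w] w sp0 by (cases "w = v") auto
    next
      fix j assume j: "i - 1 \<le> j" "j \<le> c"
      show "?cm (od j) \<noteq> 0" using i j i1 unfolding v_def by (cases "j = i - 1") auto
    next
      fix e assume e: "e \<in> E" "e \<notin> pending dst rest" "r e \<le> 0"
      then have a: "cm (dst e) \<noteq> 0 \<and> cm (dst e) \<le> cm (src e) \<and>
        la (cm (src e)) + (if r e < 0 then 1 else 0) \<le> la (cm (dst e))" using i by blast
      then have b: "dst e \<noteq> v" "i \<le> cm (dst e)" "cm (src e) \<noteq> 0" "src e \<noteq> v" using cmv i dst_T[OF e(1)] i1 by auto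
      show "?cm (dst e) \<noteq> 0" "?cm (dst e) \<le> ?cm (src e)" 
        "?la (?cm (src e)) + (if r e < 0 then 1 else 0) \<le> ?la (?cm (dst e))"
        using a b by auto
    next
      fix j assume j: "i - 1 \<le> j" "j \<le> c" "?cm (od j) = j"
      have a: "0 \<le> la j \<and> (0 < la j \<longrightarrow> via_ok od cm la j (vi j - 1) (la j))" if "j \<noteq> i - 1"
        using i j that ne[of j] by auto
      then show "0 \<le> ?la j" by auto
      assume "0 < ?la j"
      then have "j \<noteq> i - 1" by auto
      with a \<open>0 < ?la j\<close> have b: "via_ok od cm la j (vi j - 1) (la j)" by auto
      then have "src (vi j - 1) \<noteq> v" using cmv j i1 by (auto simp: via_ok_def)
      with b \<open>j \<noteq> i - 1\<close> j show "via_ok od ?cm ?la j (vi j - 1) (?la j)" by (auto simp: via_ok_def)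
    next
      show "k - 1 = 2 * card (pending dst rest) + nat (sp + 1) + 2 * nat (i - 1)"
        using i i1 sp0 by auto
    qed
    moreover have "k - 1 < k" using i i1 by auto
    ultimately show "\<exists>k'<k. scan_inv k' rest (i - 1) (sp + 1) (st(sp + 1 := od (i - 1)))
      (cm(od (i - 1) := i - 1)) ci (la(i - 1 := 0)) vi lw ps od c" unfolding v_def by blast
  next
    assume "\<not> cm (od (i - 1)) < 1"
    then have cmv: "cm v \<noteq> 0" by (auto simp: v_def)
    \<comment> \<open>The vertex numbered \<open>i - 1\<close> was absorbed by a class with a larger
      number, so \<open>i - 1\<close> names no class and the clause about \<open>la\<close> gains no
      instance.\<close>
    then have "cm v \<noteq> i - 1" using i v(1) by fastforce
    then have j: "i \<le> j" if "i - 1 \<le> j" "cm (od j) = j" for j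
      using that v_def by (cases "j = i - 1") auto
    have "\<forall>j. i \<le> j \<and> j \<le> c \<longrightarrow> cm (od j) \<noteq> 0" using i by blast
    then have n1: "\<forall>j. i - 1 \<le> j \<and> j \<le> c \<longrightarrow> cm (od j) \<noteq> 0"
    proof (intro allI impI)
      fix j assume h: "\<forall>j. i \<le> j \<and> j \<le> c \<longrightarrow> cm (od j) \<noteq> 0" "i - 1 \<le> j \<and> j \<le> c"
      show "cm (od j) \<noteq> 0" using h cmv v_def by (cases "j = i - 1") auto
    qed
    have n2: "\<forall>v\<in>T. cm v \<noteq> 0 \<longrightarrow> i - 1 \<le> cm v \<and> cm v \<le> c \<and> ps v \<noteq> 0 \<and> cm (od (cm v)) = cm v \<and>
        lw (od (cm v)) \<le> ps v \<and> ps v \<le> cm v \<and> P v = P (od (cm v))"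
    proof (intro ballI impI)
      fix w assume "w \<in> T" "cm w \<noteq> 0"
      then have "i \<le> cm w \<and> cm w \<le> c \<and> ps w \<noteq> 0 \<and> cm (od (cm w)) = cm w \<and>
        lw (od (cm w)) \<le> ps w \<and> ps w \<le> cm w \<and> P w = P (od (cm w))" using i by blast
      then show "i - 1 \<le> cm w \<and> cm w \<le> c \<and> ps w \<noteq> 0 \<and> cm (od (cm w)) = cm w \<and>
        lw (od (cm w)) \<le> ps w \<and> ps w \<le> cm w \<and> P w = P (od (cm w))" by simp
    qed
    have n3: "\<forall>j. i - 1 \<le> j \<and> j \<le> c \<and> cm (od j) = j \<longrightarrow> 0 \<le> la j \<and>
        (0 < la j \<longrightarrow> via_ok od cm la j (vi j - 1) (la j))" using i j by blast
    have k: "k = 2 * card (pending dst rest) + nat sp + 2 * nat i" using i by blast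
    have n4: "k - 2 = 2 * card (pending dst rest) + nat sp + 2 * nat (i - 1)" using k i1 by auto
    have n5: "1 \<le> i - 1" "i - 1 \<le> c + 1" using i i1 by auto
    have n6: "\<forall>j. 1 \<le> j \<and> j \<le> sp \<longrightarrow> st j \<in> T \<and> cm (st j) = i - 1" using sp0 by auto
    have "scan_inv (k - 2) rest (i - 1) sp st cm ci la vi lw ps od c"
      unfolding scan_inv_def by (intro conjI; fact n1 n2 n3 n4 n5 n6 scan_invD[OF inv])
    moreover have "k - 2 < k" using k i1 by auto
    ultimately show "\<exists>k'<k. scan_inv k' rest (i - 1) sp st cm ci la vi lw ps od c" by blast
  }
qed

text \<open>Kosaraju's argument in terms of numbers: an unassigned source \<open>u\<close> of a
  nonpositive edge into class \<open>i\<close> is a descendant of \<open>od i\<close>, whence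
  \<open>P (od i) \<le> P u\<close>, and the edge gives the converse. The outcomes are that the
  source joins the class, that a negative edge raises the level, that a zero edge passes on the
  level together with its predecessor edge, or that nothing changes.\<close>

lemma scan_edge:
  assumes post: "postorder lw ps od c"
    and inv: "scan_inv k rest i sp st cm ci la vi lw ps od c" and sp: "0 < sp" and ci: "0 < ci (st sp)"
  defines "x \<equiv> ci (st sp) - 1"
  defines "ci' \<equiv> ci(st sp := inx x)"
  shows "r x < 1 \<Longrightarrow> cm (src x) < 1 \<Longrightarrow> \<exists>k'<k. \<exists>rest'. scan_inv k' rest' i (sp + 1)
      (st(sp + 1 := src x)) (cm(src x := i)) ci' la vi lw ps od c"
    and "\<not> cm (src x) < 1 \<Longrightarrow> r x < 0 \<Longrightarrow> la i < la (cm (src x)) + 1 \<Longrightarrow>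
      \<exists>k'<k. \<exists>rest'. scan_inv k' rest' i sp st cm ci' (la(i := la (cm (src x)) + 1)) (vi(i := x + 1)) lw ps od c"
    and "\<not> cm (src x) < 1 \<Longrightarrow> r x < 1 \<Longrightarrow> \<not> r x < 0 \<Longrightarrow> la i < la (cm (src x)) \<Longrightarrow>
      \<exists>k'<k. \<exists>rest'. scan_inv k' rest' i sp st cm ci' (la(i := la (cm (src x)))) (vi(i := vi (cm (src x)))) lw ps od c"
    and "\<not> r x < 1 \<or> \<not> cm (src x) < 1 \<and> \<not> la i < la (cm (src x)) + (if r x < 0 then 1 else 0) \<Longrightarrow>
      \<exists>k'<k. \<exists>rest'. scan_inv k' rest' i sp st cm ci' la vi lw ps od c"
    and "x \<in> E"
proof -
  note i = inv[unfolded scan_inv_def]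
  have fin: "finished_ok lw ps od c" using post by (simp add: postorder_def)
  define v where "v = st sp"
  have v: "v \<in> T" "cm v = i" using i sp by (auto simp: v_def)
  have cls: "i \<le> cm w \<and> cm w \<le> c \<and> ps w \<noteq> 0 \<and> cm (od (cm w)) = cm w \<and>
      lw (od (cm w)) \<le> ps w \<and> ps w \<le> cm w \<and> P w = P (od (cm w))" if "w \<in> T" "cm w \<noteq> 0" for w
    using i that by blast
  have cmv: "i \<le> c" "ps v \<noteq> 0" "cm (od i) = i" "lw (od i) \<le> ps v" "ps v \<le> i" "P v = P (od i)" "1 \<le> i"
    using cls[OF v(1)] v(2) i by auto
  have odi: "ps (od i) = i" "od i \<in> T" using fin cmv unfolding finished_ok_def by auto
  obtain es where es: "rest v = x # es" "x \<in> E" "dst x = v" "x \<in> pending dst rest"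
    "cursor inx dst ci' (rest(v := es))"
    "pending dst (rest(v := es)) = pending dst rest - {x}"
    using cursor_advance[of inx dst ci rest v] i v(1) ci unfolding x_def ci'_def v_def by metis
  show "x \<in> E" by fact
  have card: "card (pending dst rest) = Suc (card (pending dst rest - {x}))"
    using es(4) card_Suc_Diff1[OF finite_pending] by metis
  have stv: "\<exists>j. 1 \<le> j \<and> j \<le> sp \<and> st j = v" using sp v_def by (intro exI[of _ sp]) auto
  define u where "u = src x"
  have u: "u \<in> T" "ps u \<noteq> 0" using es(2) post by (auto simp: u_def postorder_def)
  have nonpend: "cm (dst e) \<noteq> 0 \<and> cm (dst e) \<le> cm (src e) \<and>
        la (cm (src e)) + (if r e < 0 then 1 else 0) \<le> la (cm (dst e))"
    if "e \<in> E" "e \<notin> pending dst rest" "r e \<le> 0" for e using i that by blast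
  have viaj: "0 \<le> la j \<and> (0 < la j \<longrightarrow> via_ok od cm la j (vi j - 1) (la j))"
    if "i \<le> j" "j \<le> c" "cm (od j) = j" for j using i that by blast
  \<comment> \<open>All outcomes that leave the classes alone are instances of one update of level
    and predecessor; no change is the instance \<open>la i\<close>, \<open>vi i\<close>.\<close>
  have upd: "\<exists>k'<k. \<exists>rest'. scan_inv k' rest' i sp st cm ci' (la(i := a)) (vi(i := b)) lw ps od c"
    if cu: "r x < 1 \<Longrightarrow> cm u \<noteq> 0 \<and> la (cm u) + (if r x < 0 then 1 else 0) \<le> a \<and> (r x < 0 \<longrightarrow> i < cm u)"
      and a: "la i \<le> a" and b: "0 < a \<Longrightarrow> via_ok od cm la i (b - 1) a" for a b
  proof -
    have "scan_inv (k - 2) (rest(v := es)) i sp st cm ci' (la(i := a)) (vi(i := b)) lw ps od c"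
      unfolding scan_inv_def
    proof (intro conjI allI impI ballI; (elim conjE)?)
      show "1 \<le> i" "i \<le> c + 1" "0 \<le> sp" "cursor inx dst ci' (rest(v := es))" "(la(i := a)) 0 = 0"
        using i es(5) by auto
    next
      fix j assume "1 \<le> j" "j \<le> sp" then show "st j \<in> T" "cm (st j) = i" using i by auto
    next
      fix w assume w: "w \<in> T" "cm w \<noteq> 0"
      from cls[OF w] show "i \<le> cm w" "cm w \<le> c" "ps w \<noteq> 0" "cm (od (cm w)) = cm w"
        "lw (od (cm w)) \<le> ps w" "ps w \<le> cm w" "P w = P (od (cm w))" by blast+
      show "(rest(v := es)) w = [] \<or> (\<exists>j. 1 \<le> j \<and> j \<le> sp \<and> st j = w)"
        using i w stv by (cases "w = v") auto
    next
      fix j assume "i \<le> j" "j \<le> c" then show "cm (od j) \<noteq> 0" using i by auto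
    next
      fix e assume e: "e \<in> E" "e \<notin> pending dst (rest(v := es))" "r e \<le> 0"
      have "cm (dst e) \<noteq> 0 \<and> cm (dst e) \<le> cm (src e) \<and>
        (la(i := a)) (cm (src e)) + (if r e < 0 then 1 else 0) \<le> (la(i := a)) (cm (dst e))"
      proof (cases "e = x")
        case True
        have "i \<le> cm u" using cu e(3) True u(1) cls[of u] by auto
        with cu e(3) v es(3) cmv True a show ?thesis by (auto simp: u_def)
      next
        case False
        then have 1: "cm (dst e) \<noteq> 0 \<and> cm (dst e) \<le> cm (src e) \<and>
          la (cm (src e)) + (if r e < 0 then 1 else 0) \<le> la (cm (dst e))"
          using nonpend e es(6) by auto
        moreover have "i \<le> cm (dst e)" using cls[of "dst e"] 1 e(1) by auto
        ultimately show ?thesis using a by auto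
      qed
      then show "cm (dst e) \<noteq> 0" "cm (dst e) \<le> cm (src e)"
        "(la(i := a)) (cm (src e)) + (if r e < 0 then 1 else 0) \<le> (la(i := a)) (cm (dst e))" by auto
    next
      fix j assume j: "i \<le> j" "j \<le> c" "cm (od j) = j"
      show "0 \<le> (la(i := a)) j" using viaj[of i] viaj[OF j] cmv a by auto
      assume l: "0 < (la(i := a)) j"
      show "via_ok od cm (la(i := a)) j ((vi(i := b)) j - 1) ((la(i := a)) j)"
        using l b viaj[OF j] j by (auto simp: via_ok_def split: if_splits)
    next
      show "k - 2 = 2 * card (pending dst (rest(v := es))) + nat sp + 2 * nat i"
        unfolding es(6) using i card by auto
    qed
    moreover have "k - 2 < k" using i card by auto
    ultimately show ?thesis by blast
  qed
  \<comment> \<open>Equal values of \<open>P\<close> at both ends leave no room for a negative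
    length. Negative edges thus never lie inside a class, and levels cannot grow without
    bound.\<close>
  have rx: "0 \<le> r x" if "cm u = i"
  proof -
    have "P u = P v" using cls[OF u(1)] cmv that by auto
    then show ?thesis using feasible[OF es(2)] es(3) by (simp add: u_def)
  qed
  have gt: "i < cm u" if "cm u \<noteq> 0" "r x < 0" using rx that cls[OF u(1)] by force
  {
    assume "\<not> cm (src x) < 1" "r x < 0" "la i < la (cm (src x)) + 1"
    then show "\<exists>k'<k. \<exists>rest'. scan_inv k' rest' i sp st cm ci' (la(i := la (cm (src x)) + 1)) (vi(i := x + 1)) lw ps od c"
      using es cmv gt unfolding u_def[symmetric]
      by (intro upd) (auto simp: via_ok_def u_def)
  next
    assume a: "\<not> cm (src x) < 1" "r x < 1" "\<not> r x < 0" "la i < la (cm (src x))"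
    then have "i < cm u" using cls[OF u(1)] by (cases "cm u = i") (auto simp: u_def)
    moreover have "P u \<le> P (od i)" using P_mono[OF es(2)] es(3) a cmv by (simp add: u_def)
    moreover have "P (od (cm u)) = P u" using cls[OF u(1)] a by (auto simp: u_def)
    moreover have "0 < la (cm u)" using a viaj[of i] cmv by (auto simp: u_def)
    moreover have "via_ok od cm la (cm u) (vi (cm u) - 1) (la (cm u))"
      using viaj[of "cm u"] cls[OF u(1)] a calculation by (auto simp: u_def)
    ultimately have "via_ok od cm la i (vi (cm u) - 1) (la (cm u))" by (auto simp: via_ok_def)
    then show "\<exists>k'<k. \<exists>rest'. scan_inv k' rest' i sp st cm ci' (la(i := la (cm (src x)))) (vi(i := vi (cm (src x)))) lw ps od c"
      using a unfolding u_def[symmetric] by (intro upd) auto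
  next
    assume a: "\<not> r x < 1 \<or> \<not> cm (src x) < 1 \<and> \<not> la i < la (cm (src x)) + (if r x < 0 then 1 else 0)"
    have "\<exists>k'<k. \<exists>rest'. scan_inv k' rest' i sp st cm ci' (la(i := la i)) (vi(i := vi i)) lw ps od c"
      using a viaj[of i] cmv gt by (intro upd) (auto simp: u_def)
    then show "\<exists>k'<k. \<exists>rest'. scan_inv k' rest' i sp st cm ci' la vi lw ps od c" by simp
  next
    assume a: "r x < 1" "cm (src x) < 1"
    have cmu: "cm u = 0" using a cls[OF u(1)] cmv by (fastforce simp: u_def)
    let ?cm = "cm(u := i)" and ?st = "st(sp + 1 := u)"
    have odps: "od (ps u) = u" "ps u \<le> c" "1 \<le> ps u" using fin u by (auto simp: finished_ok_def)
    have psu: "ps u < i"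
    proof (rule ccontr)
      assume "\<not> ps u < i"
      then have "cm (od (ps u)) \<noteq> 0" using scan_invD(8)[OF inv] odps(2) by (meson linorder_not_le)
      then show False using odps cmu by simp
    qed
    \<comment> \<open>Either \<open>u\<close> is numbered after \<open>v\<close>, which already lies
      in the interval of \<open>od i\<close>, or \<open>v\<close> was numbered after
      \<open>u\<close> and the edge clause gives \<open>lw v \<le> ps u\<close>. In the second case
      nesting of intervals leads from \<open>v\<close> to \<open>od i\<close>.\<close>
    have lwu: "lw (od i) \<le> ps u"
    proof (cases "ps v < ps u")
      case True then show ?thesis using cmv by simp
    next
      case False
      then have "ps v \<noteq> ps u \<or> v = u" using fin u v(1) cmv(2) unfolding finished_ok_def by metis
      with False cmu v cmv have "ps u < ps v" by auto
      then have "lw v \<le> ps u" using fin es(2,3) u a unfolding finished_ok_def u_def by auto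
      moreover have "lw (od i) \<le> lw v" using fin odi v(1) cmv unfolding finished_ok_def by auto
      ultimately show ?thesis by simp
    qed
    have Pu: "P u = P (od i)"
    proof (rule antisym)
      show "P u \<le> P (od i)" using P_mono[OF es(2)] es(3) a cmv by (simp add: u_def)
      show "P (od i) \<le> P u" using fin odi u lwu psu cmv(7) unfolding finished_ok_def by auto
    qed
    have rx0: "r x = 0" using Pu cmv feasible[OF es(2)] es(3) a(1) by (simp add: u_def)
    have ne: "od j \<noteq> u" if "cm (od j) \<noteq> 0" for j using that cmu by auto
    have uv: "u \<noteq> v" using cmu v cmv by auto
    have "scan_inv (k - 1) (rest(v := es)) i (sp + 1) ?st ?cm ci' la vi lw ps od c"
      unfolding scan_inv_def
    proof (intro conjI allI impI ballI; (elim conjE)?)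
      show "1 \<le> i" "i \<le> c + 1" "0 \<le> sp + 1" "cursor inx dst ci' (rest(v := es))" "la 0 = 0"
        using i es(5) by auto
    next
      fix j assume "1 \<le> j" "j \<le> sp + 1" 
      then show "?st j \<in> T" "?cm (?st j) = i" using i u by auto
    next
      fix w assume w: "w \<in> T" "?cm w \<noteq> 0"
      have "i \<le> ?cm w \<and> ?cm w \<le> c \<and> ps w \<noteq> 0 \<and> ?cm (od (?cm w)) = ?cm w \<and>
        lw (od (?cm w)) \<le> ps w \<and> ps w \<le> ?cm w \<and> P w = P (od (?cm w))"
        using cls[of w] w cmv u lwu psu Pu ne[of "cm w"] ne[of i] by (cases "w = u") auto
      then show "i \<le> ?cm w" "?cm w \<le> c" "ps w \<noteq> 0" "?cm (od (?cm w)) = ?cm w"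
        "lw (od (?cm w)) \<le> ps w" "ps w \<le> ?cm w" "P w = P (od (?cm w))" by blast+
      show "(rest(v := es)) w = [] \<or> (\<exists>j. 1 \<le> j \<and> j \<le> sp + 1 \<and> ?st j = w)"
      proof (cases "w = u")
        case True
        then show ?thesis using sp by (intro disjI2 exI[of _ "sp + 1"]) auto
      next
        case False
        then have "rest w = [] \<or> (\<exists>j. 1 \<le> j \<and> j \<le> sp \<and> st j = w)" using i w by auto
        then have "(rest(v := es)) w = [] \<or> (\<exists>j. 1 \<le> j \<and> j \<le> sp \<and> st j = w)" using stv by (cases "w = v") auto
        then show ?thesis
        proof
          assume "\<exists>j. 1 \<le> j \<and> j \<le> sp \<and> st j = w"
          then obtain j where "1 \<le> j" "j \<le> sp" "st j = w" by blast
          then show ?thesis by (intro disjI2 exI[of _ j]) auto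
        qed simp
      qed
    next
      fix j assume "i \<le> j" "j \<le> c" then show "?cm (od j) \<noteq> 0" using i cmv(7) by auto
    next
      fix e assume e: "e \<in> E" "e \<notin> pending dst (rest(v := es))" "r e \<le> 0"
      have "?cm (dst e) \<noteq> 0 \<and> ?cm (dst e) \<le> ?cm (src e) \<and>
        la (?cm (src e)) + (if r e < 0 then 1 else 0) \<le> la (?cm (dst e))"
      proof (cases "e = x")
        case True
        then show ?thesis using rx0 es(3) v cmv(7) uv by (auto simp: u_def)
      next
        case False
        then have 1: "cm (dst e) \<noteq> 0 \<and> cm (dst e) \<le> cm (src e) \<and>
          la (cm (src e)) + (if r e < 0 then 1 else 0) \<le> la (cm (dst e))"
          using nonpend e es(6) by auto
        moreover have "i \<le> cm (dst e)" using cls[of "dst e"] 1 e(1) by auto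
        ultimately have "dst e \<noteq> u" "src e \<noteq> u" using cmu cmv(7) by auto
        with 1 show ?thesis by auto
      qed
      then show "?cm (dst e) \<noteq> 0" "?cm (dst e) \<le> ?cm (src e)"
        "la (?cm (src e)) + (if r e < 0 then 1 else 0) \<le> la (?cm (dst e))" by auto
    next
      fix j assume j: "i \<le> j" "j \<le> c" "?cm (od j) = j"
      have "od j \<noteq> u" using j i cmu by auto
      then have jj: "cm (od j) = j" using j by auto
      show "0 \<le> la j" using viaj j jj by auto
      assume l: "0 < la j"
      then have v1: "via_ok od cm la j (vi j - 1) (la j)" using viaj j jj by auto
      then have "src (vi j - 1) \<noteq> u" using cmu j cmv(7) by (auto simp: via_ok_def)
      with v1 show "via_ok od ?cm la j (vi j - 1) (la j)" by (auto simp: via_ok_def)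
    next
      show "k - 1 = 2 * card (pending dst (rest(v := es))) + nat (sp + 1) + 2 * nat i"
        unfolding es(6) using i card sp by auto
    qed
    moreover have "k - 1 < k" using i card by auto
    ultimately show "\<exists>k'<k. \<exists>rest'. scan_inv k' rest' i (sp + 1)
      (st(sp + 1 := src x)) (cm(src x := i)) ci' la vi lw ps od c" unfolding u_def by blast
  }
qed

text \<open>Longest paths reduced to what is used later: the inequality along nonpositive edges, and
  for each positive level a last negative edge \<open>via v\<close> whose source lies one level
  lower. The path from the head of \<open>via v\<close> on to \<open>v\<close> survives only as an
  inequality for \<open>P\<close>.\<close>

definition levels :: "(int \<Rightarrow> int) \<Rightarrow> (int \<Rightarrow> int) \<Rightarrow> bool" where
  "levels lv via \<longleftrightarrow>
     (\<forall>v\<in>T. 0 \<le> lv v \<and> (0 < lv v \<longrightarrow> via v \<in> E \<and> r (via v) < 0 \<and> lv (src (via v)) = lv v - 1 \<and>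
        P (dst (via v)) \<le> P v)) \<and>
     (\<forall>e\<in>E. r e \<le> 0 \<longrightarrow> lv (src e) + (if r e < 0 then 1 else 0) \<le> lv (dst e))"

lemma scan_done:
  assumes post: "postorder lw ps od c"
    and inv: "scan_inv k rest i sp st cm ci la vi lw ps od c" and "\<not> 0 < sp" "\<not> 1 < i"
  shows "levels (\<lambda>v. la (cm v)) (\<lambda>v. vi (cm v) - 1)"
proof -
  note i = inv[unfolded scan_inv_def]
  have i1: "i = 1" "sp = 0" using i assms by auto
  have fin: "finished_ok lw ps od c" using post by (simp add: postorder_def)
  have asg: "cm v \<noteq> 0" if "v \<in> T" "ps v \<noteq> 0" for v
  proof -
    have "1 \<le> ps v" "ps v \<le> c" "od (ps v) = v" using fin that by (auto simp: finished_ok_def)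
    moreover have "cm (od (ps v)) \<noteq> 0" using i i1 calculation by blast
    ultimately show ?thesis by simp
  qed
  have "0 \<le> la (cm v) \<and> (0 < la (cm v) \<longrightarrow> vi (cm v) - 1 \<in> E \<and> r (vi (cm v) - 1) < 0 \<and>
      la (cm (src (vi (cm v) - 1))) = la (cm v) - 1 \<and> P (dst (vi (cm v) - 1)) \<le> P v)" if "v \<in> T" for v
    using i that unfolding via_ok_def by (cases "cm v = 0") auto
  moreover have "la (cm (src e)) + (if r e < 0 then 1 else 0) \<le> la (cm (dst e))" if "e \<in> E" "r e \<le> 0" for e
  proof -
    have "cm (dst e) \<noteq> 0" using asg[of "dst e"] post that by (auto simp: postorder_def)
    then have "rest (dst e) = []" using i i1 that(1) by auto
    then have "e \<notin> pending dst rest" by (simp add: pending_def)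
    then show ?thesis using i that by blast
  qed
  ultimately show ?thesis unfolding levels_def by blast
qed

text \<open>Following \<open>via\<close> backwards from \<open>v\<close> crosses \<open>lv v\<close>
  negative edges, and across each of them \<open>P\<close> drops by at least 1 while staying
  nonnegative. Hence vertices of positive level can be lowered without violating
  \<open>L \<le> P\<close>.\<close>

lemma level_le_P:
  assumes "levels lv via" "v \<in> T"
  shows "lv v \<le> P v"
proof -
  have "v \<in> T \<Longrightarrow> lv v = int n \<Longrightarrow> lv v \<le> P v" for n v
  proof (induction n arbitrary: v)
    case 0
    then show ?case using P_nonneg[of v] by simp
  next
    case (Suc n)
    then have e: "via v \<in> E" "r (via v) < 0" "lv (src (via v)) = lv v - 1" "P (dst (via v)) \<le> P v"
      using assms(1) by (auto simp: levels_def)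
    then have "lv (src (via v)) \<le> P (src (via v))" using Suc by (intro Suc.IH) auto
    then show ?case using feasible[OF e(1)] e by linarith
  qed
  then show ?thesis using assms by (metis levels_def nonneg_int_cases)
qed

end

section \<open>Lowering the duals\<close>

context arcs
begin

text \<open>Progress is measured by heads instead of edges because there are at most
  \<open>n\<close> of them; this is the origin of \<open>sqrt n\<close>.\<close>

definition heads :: "(int \<Rightarrow> int) \<Rightarrow> int set" where
  "heads r = dst ` {e \<in> E. r e < 0}"

text \<open>The reduced lengths after lowering the duals by \<open>L\<close>.\<close>

definition shifted :: "(int \<Rightarrow> int) \<Rightarrow> (int \<Rightarrow> int) \<Rightarrow> int \<Rightarrow> int" where
  "shifted r L e = r e - L (src e) + L (dst e)"

lemma finite_heads [simp]: "finite (heads r)"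
  by (simp add: heads_def)

lemma heads_subset_T: "heads r \<subseteq> T"
  by (auto simp: heads_def)

end

context weighted
begin

text \<open>The bounds on \<open>L\<close> make \<open>P - L\<close> a certificate for the new
  lengths; the bound on edges says that no edge becomes negative and no negative edge gets
  worse.\<close>

definition good_lowering :: "(int \<Rightarrow> int) \<Rightarrow> bool" where
  "good_lowering L \<longleftrightarrow> (\<forall>v\<in>T. 0 \<le> L v \<and> L v \<le> P v) \<and> (\<forall>e\<in>E. min (r e) 0 \<le> shifted r L e)"

lemma good_lowering_heads: "good_lowering L \<Longrightarrow> heads (shifted r L) \<subseteq> heads r"
  by (force simp: good_lowering_def heads_def)

lemma good_lowering_bound: "good_lowering L \<Longrightarrow> \<forall>e\<in>E. - 1 \<le> r e \<Longrightarrow> \<forall>e\<in>E. - 1 \<le> shifted r L e"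
  by (force simp: good_lowering_def)

lemma weighted_lower:
  assumes "good_lowering L"
  shows "weighted m src dst oh on ih inx outs ins (shifted r L) (\<lambda>v. if v \<in> T then P v - L v else 0)"
proof unfold_locales
  show "0 \<le> (if v \<in> T then P v - L v else 0)" for v
    using assms by (auto simp: good_lowering_def)
  show "(if src e \<in> T then P (src e) - L (src e) else 0) \<le>
      shifted r L e + (if dst e \<in> T then P (dst e) - L (dst e) else 0)" if "e \<in> E" for e
    using feasible[OF that] that by (simp add: shifted_def)
qed

definition cut :: "(int \<Rightarrow> int) \<Rightarrow> int \<Rightarrow> int \<Rightarrow> int" where
  "cut lv j v = (if j \<le> lv v then 1 else 0)"

text \<open>Levels do not decrease along nonpositive edges, so such an edge never has only its
  source lowered. A positive edge loses at most 1 and stays nonnegative by integrality.\<close>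

lemma cut_good:
  assumes lv: "levels lv via" and j: "1 \<le> j"
  shows "good_lowering (cut lv j)"
  unfolding good_lowering_def
proof (intro conjI ballI)
  fix v assume v: "v \<in> T"
  show "0 \<le> cut lv j v" by (simp add: cut_def)
  show "cut lv j v \<le> P v" using level_le_P[OF lv v] P_nonneg[of v] j by (auto simp: cut_def)
next
  fix e assume e: "e \<in> E"
  show "min (r e) 0 \<le> shifted r (cut lv j) e"
  proof (cases "r e \<le> 0")
    case True
    then have "lv (src e) + (if r e < 0 then 1 else 0) \<le> lv (dst e)" using lv e by (auto simp: levels_def)
    then have "lv (src e) \<le> lv (dst e)" by (simp split: if_splits)
    then show ?thesis by (auto simp: shifted_def cut_def)
  qed (auto simp: shifted_def cut_def)
qed

text \<open>A negative edge into level \<open>j\<close> starts below level \<open>j\<close>; it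
  gains the 1 that it lacks. A nonnegative edge into a lowered vertex loses nothing.\<close>

lemma cut_heads:
  assumes lv: "levels lv via" and r: "\<forall>e\<in>E. - 1 \<le> r e" and v: "lv v = j" "v \<in> heads (shifted r (cut lv j))"
  shows False
proof -
  obtain e where e: "e \<in> E" "dst e = v" "shifted r (cut lv j) e < 0" using v by (auto simp: heads_def)
  have "r e < 0"
  proof (rule ccontr)
    assume "\<not> r e < 0"
    then show False using e v(1) by (auto simp: shifted_def cut_def split: if_splits)
  qed
  then have "lv (src e) + 1 \<le> lv v" using lv e by (auto simp: levels_def)
  then show False using e v(1) r by (force simp: shifted_def cut_def split: if_splits)
qed

text \<open>A vertex at which \<open>P\<close> attains its maximum \<open>M\<close> and which is not lowered has only incoming edges
  of nonnegative length afterwards, so \<open>P\<close> may be truncated at \<open>M - 1\<close>.\<close>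

lemma weighted_cut1:
  assumes lv: "levels lv via" and r: "\<forall>e\<in>E. - 1 \<le> r e" and M: "\<forall>v\<in>T. P v \<le> M" "1 \<le> M"
  shows "weighted m src dst oh on ih inx outs ins (shifted r (cut lv 1))
    (\<lambda>v. if v \<in> T then min (P v - cut lv 1 v) (M - 1) else 0)"
proof unfold_locales
  show "0 \<le> (if v \<in> T then min (P v - cut lv 1 v) (M - 1) else 0)" for v
    using cut_good[OF lv, of 1] M by (auto simp: good_lowering_def)
  fix e assume e: "e \<in> E"
  let ?p = "P (src e) - cut lv 1 (src e)" and ?q = "P (dst e) - cut lv 1 (dst e)"
  have f: "?p \<le> shifted r (cut lv 1) e + ?q" using feasible[OF e] by (simp add: shifted_def)
  have "min ?p (M - 1) \<le> shifted r (cut lv 1) e + min ?q (M - 1)"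
  proof (cases "?q \<le> M - 1")
    case False
    moreover have "P (dst e) \<le> M" using M(1) e by simp
    ultimately have d: "\<not> 1 \<le> lv (dst e)" by (auto simp: cut_def split: if_splits)
    have "0 \<le> lv (src e)" using lv src_T[OF e] unfolding levels_def by blast
    moreover have "r e \<le> 0 \<longrightarrow> lv (src e) + (if r e < 0 then 1 else 0) \<le> lv (dst e)"
      using lv e unfolding levels_def by blast
    ultimately have "0 \<le> r e \<and> (r e \<le> 0 \<longrightarrow> \<not> 1 \<le> lv (src e))" using d by (auto split: if_splits)
    then have "0 \<le> shifted r (cut lv 1) e" by (auto simp: shifted_def cut_def)
    then show ?thesis using False by auto
  qed (use f in auto)
  then show "(if src e \<in> T then min (P (src e) - cut lv 1 (src e)) (M - 1) else 0) \<le>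
    shifted r (cut lv 1) e + (if dst e \<in> T then min (P (dst e) - cut lv 1 (dst e)) (M - 1) else 0)"
    using e by simp
qed

text \<open>This is why the maximum of \<open>P\<close> counts rounds: once it has reached 0, no
  negative edge is left.\<close>

lemma heads_empty_if_zero: "\<forall>v\<in>T. P v \<le> 0 \<Longrightarrow> heads r = {}"
proof -
  assume "\<forall>v\<in>T. P v \<le> 0"
  then have "P v = 0" if "v \<in> T" for v using P_nonneg[of v] that by force
  then show ?thesis using feasible by (fastforce simp: heads_def)
qed

lemma level_head:
  assumes "levels lv via" "v \<in> heads r"
  shows "1 \<le> lv v"
proof -
  obtain e where e: "e \<in> E" "r e < 0" "dst e = v" using assms(2) by (auto simp: heads_def)
  then have "lv (src e) + 1 \<le> lv v" "0 \<le> lv (src e)" using assms(1) by (auto simp: levels_def)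
  then show ?thesis by simp
qed

end

text \<open>Pigeonhole on levels. It follows that the size of a fullest level or the number of
  levels is at least the square root of the number of heads.\<close>

lemma card_le_classes:
  assumes "finite N" "\<forall>v\<in>N. 1 \<le> f v \<and> f v \<le> (t :: int)" "\<forall>v\<in>N. int (card {w \<in> N. f w = f v}) \<le> b" "0 \<le> b"
    and N: "N \<noteq> {}"
  shows "int (card N) \<le> b * t"
proof -
  have t: "1 \<le> t" using assms(2) N by fastforce
  have "N = (\<Union>j\<in>{1..t}. {w \<in> N. f w = j})" using assms(2) by auto
  then have "card N = card (\<Union>j\<in>{1..t}. {w \<in> N. f w = j})" by (rule arg_cong)
  also have "\<dots> \<le> (\<Sum>j\<in>{1..t}. card {w \<in> N. f w = j})" by (rule card_UN_le) simp
  also have "\<dots> \<le> (\<Sum>j\<in>{1..t}. nat b)"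
  proof (rule sum_mono)
    fix j assume "j \<in> {1..t}"
    show "card {w \<in> N. f w = j} \<le> nat b"
    proof (cases "{w \<in> N. f w = j} = {}")
      case False
      then obtain v where "v \<in> N" "f v = j" by blast
      then have "int (card {w \<in> N. f w = j}) \<le> b" using assms(3) by blast
      then show ?thesis by simp
    qed (simp only: card.empty le0)
  qed
  finally have "card N \<le> nat t * nat b" using t by simp
  then have "int (card N) \<le> int (nat t * nat b)" by (rule of_nat_mono)
  then show ?thesis using t \<open>0 \<le> b\<close> by (simp add: mult.commute)
qed

section \<open>Lowering along a chain\<close>

text \<open>Dial's algorithm with the lengths \<open>max 0 (r e)\<close>, in which the final vertex of the \<open>j\<close>-th
  edge of a chain of \<open>t\<close> negative edges gets the start value \<open>t - j\<close>. In place of the distance,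
  \<open>d v\<close> records \<open>t\<close> minus the distance.\<close>

primrec chain :: "(int \<Rightarrow> int) \<Rightarrow> (int \<Rightarrow> int) \<Rightarrow> int \<Rightarrow> nat \<Rightarrow> int" where
  "chain src via e 0 = e"
| "chain src via e (Suc k) = via (src (chain src via e k))"

text \<open>\<open>te\<close> is the last edge of the chain. Its source has level
  \<open>t - 1\<close>, so that following \<open>via\<close> backwards produces exactly
  \<open>t\<close> negative edges.\<close>

locale chained = weighted +
  fixes lv via :: "int \<Rightarrow> int" and te t :: int
  assumes levels: "levels lv via" and bound: "\<forall>e\<in>E. - 1 \<le> r e"
    and te: "te \<in> E" "r te < 0" "lv (src te) = t - 1" and t_pos: "1 \<le> t"
begin

text \<open>Seeds are numbered from the start of the chain, whereas \<open>chain\<close> counts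
  backwards from its end.\<close>

definition seed :: "int \<Rightarrow> int" where
  "seed j = dst (chain src via te (nat (t - j)))"

lemma chain_props:
  "int k < t \<Longrightarrow> chain src via te k \<in> E \<and> r (chain src via te k) < 0 \<and>
    lv (src (chain src via te k)) = t - 1 - int k"
proof (induction k)
  case 0
  then show ?case using te by simp
next
  case (Suc k)
  then have h: "chain src via te k \<in> E" "lv (src (chain src via te k)) = t - 1 - int k" by auto
  then have "0 < lv (src (chain src via te k))" using Suc by simp
  then show ?case using levels h src_T[OF h(1)] unfolding levels_def by auto
qed

lemma seed_edge:
  assumes "1 \<le> j" "j \<le> t"
  obtains e where "e \<in> E" "r e < 0" "dst e = seed j" "lv (src e) = j - 1"
    "1 < j \<Longrightarrow> P (seed (j - 1)) \<le> P (src e)"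
proof
  let ?e = "chain src via te (nat (t - j))"
  show e: "?e \<in> E" "r ?e < 0" "lv (src ?e) = j - 1" "dst ?e = seed j"
    using chain_props[of "nat (t - j)"] assms by (auto simp: seed_def)
  assume "1 < j"
  have "nat (t - (j - 1)) = Suc (nat (t - j))" using assms by simp
  then have "seed (j - 1) = dst (via (src ?e))" by (simp add: seed_def)
  then show "P (seed (j - 1)) \<le> P (src ?e)"
    using levels e src_T[OF e(1)] \<open>1 < j\<close> unfolding levels_def by auto
qed

lemma seed_T: "1 \<le> j \<Longrightarrow> j \<le> t \<Longrightarrow> seed j \<in> T"
  by (metis seed_edge dst_T)

lemma seed_ge: 
  assumes "1 \<le> j" "j \<le> t"
  shows "j \<le> P (seed j)"
proof -
  obtain e where e: "e \<in> E" "r e < 0" "dst e = seed j" "lv (src e) = j - 1" using seed_edge[OF assms] by metis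
  then show ?thesis using level_le_P[OF levels src_T[OF e(1)]] feasible[OF e(1)] by simp
qed

text \<open>From one seed to the next there is a step on which \<open>P\<close> does not fall,
  followed by a negative edge. Strictness makes the seeds distinct and lets a smaller index be
  traded for a smaller \<open>P\<close>.\<close>

lemma seed_less: "1 \<le> i \<Longrightarrow> i < j \<Longrightarrow> j \<le> t \<Longrightarrow> P (seed i) < P (seed j)"
proof (induction "nat (j - i)" arbitrary: j)
  case (Suc n)
  obtain e where e: "e \<in> E" "r e < 0" "dst e = seed j" "1 < j \<Longrightarrow> P (seed (j - 1)) \<le> P (src e)"
    using seed_edge[of j] Suc.prems by auto
  have "P (seed (j - 1)) < P (seed j)" using feasible[OF e(1)] e Suc.prems by auto
  moreover have "P (seed i) < P (seed (j - 1))" if "i \<noteq> j - 1"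
    using Suc.hyps(1)[of "j - 1"] Suc.hyps(2) Suc.prems that by auto
  ultimately show ?case by fastforce
qed simp

lemma seed_mono: "1 \<le> i \<Longrightarrow> i \<le> j \<Longrightarrow> j \<le> t \<Longrightarrow> P (seed i) \<le> P (seed j)"
  using seed_less[of i j] by (cases "i = j") auto

lemma seeds: "seed ` {1..t} \<subseteq> heads r" "int (card (seed ` {1..t})) = t"
proof -
  have "inj_on seed {1..t}"
  proof (rule inj_onI)
    fix a b assume "a \<in> {1..t}" "b \<in> {1..t}" "seed a = seed b"
    then show "a = b" using seed_less[of a b] seed_less[of b a] by (cases a b rule: linorder_cases) auto
  qed
  then show "int (card (seed ` {1..t})) = t" using t_pos by (simp add: card_image)
  show "seed ` {1..t} \<subseteq> heads r"
  proof
    fix v assume "v \<in> seed ` {1..t}"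
    then obtain j where j: "1 \<le> j" "j \<le> t" "v = seed j" by auto
    then show "v \<in> heads r" using seed_edge[OF j(1,2)] unfolding heads_def
      by (metis (mono_tags, lifting) imageI mem_Collect_eq)
  qed
qed

text \<open>Keeps the number of buckets, and so the time for walking through them, linear in
  \<open>m\<close>.\<close>

lemma t_le_m: "t \<le> m"
proof -
  have "card (seed ` {1..t}) \<le> card (heads r)" using seeds(1) by (simp add: card_mono)
  also have "\<dots> \<le> card {e \<in> E. r e < 0}" unfolding heads_def by (rule card_image_le) simp
  also have "\<dots> \<le> card E" by (rule card_mono) auto
  finally show ?thesis using seeds(2) m_nonneg by simp
qed

text \<open>The value 0 means unsettled, and in the end a distance of at least \<open>t\<close>.
  That \<open>v\<close> was reached from the chain is recorded as
  \<open>P (seed (d v)) \<le> P v\<close>; together with \<open>seed_ge\<close> this gives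
  \<open>d v \<le> P v\<close>.\<close>

definition settled_ok where
  "settled_ok i d \<longleftrightarrow> 0 \<le> i \<and> i \<le> t + 1 \<and>
     (\<forall>v\<in>T. d v = 0 \<or> i \<le> d v \<and> 1 \<le> d v \<and> d v \<le> t \<and> P (seed (d v)) \<le> P v)"

text \<open>Buckets contain edges: an edge in bucket \<open>j\<close> offers the value
  \<open>j\<close> to its head, and outdated offers are dropped when they are taken out. Each edge
  is in at most one bucket, so one link array serves all of them. The list \<open>pl\<close> is the
  unscanned rest of the out-edges of the vertex settled last.\<close>

definition buckets_ok where
  "buckets_ok pl bl i p d bk lk \<longleftrightarrow>
     linked on p pl \<and> distinct pl \<and> (\<forall>e\<in>set pl. e \<in> E \<and> d (src e) = i \<and> 1 \<le> i) \<and>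
     (\<forall>j. linked lk (bk j) (bl j) \<and> distinct (bl j)) \<and>
     (\<forall>j. \<forall>e\<in>set (bl j). 1 \<le> j \<and> j \<le> i \<and> j \<le> t \<and> e \<in> E \<and> d (src e) \<noteq> 0 \<and> P (seed j) \<le> P (dst e) \<and>
        e \<notin> set pl) \<and>
     (\<forall>j j'. j \<noteq> j' \<longrightarrow> set (bl j) \<inter> set (bl j') = {})"

text \<open>The exception set \<open>X\<close> is for an edge that has left its bucket while its
  head is about to be settled.\<close>

definition relaxed where
  "relaxed X pl bl d \<longleftrightarrow> (\<forall>e\<in>E. e \<notin> X \<and> d (src e) \<noteq> 0 \<longrightarrow> e \<in> set pl \<or>
     (\<exists>j. e \<in> set (bl j) \<and> d (src e) - max 0 (r e) \<le> j) \<or> d (src e) - max 0 (r e) \<le> d (dst e))"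

text \<open>An edge waits for its source, then sits in \<open>pl\<close>, then possibly in a bucket;
  the weights 3, 2, 1 fall as it proceeds.\<close>

definition dial_time :: "int list \<Rightarrow> (int \<Rightarrow> int list) \<Rightarrow> (int \<Rightarrow> int) \<Rightarrow> nat" where
  "dial_time pl bl d = 3 * card {e \<in> E. d (src e) = 0} + 2 * length pl + card (\<Union>j. set (bl j))"

text \<open>\<open>ce\<close> is one position ahead: its head is seed \<open>i - 1\<close>, the next
  one to be settled if no shorter way has done so. For \<open>i = 1\<close> it has run past the
  start of the chain, and its head is not looked up any more.\<close>

definition dial_inv where
  "dial_inv k pl bl i ce p d bk lk \<longleftrightarrow> settled_ok i d \<and> buckets_ok pl bl i p d bk lk \<and>
     relaxed {} pl bl d \<and> (0 < i \<longrightarrow> ce = chain src via te (nat (t + 1 - i))) \<and>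
     (\<forall>j. i \<le> j \<and> 1 \<le> j \<and> j \<le> t \<longrightarrow> j \<le> d (seed j)) \<and>
     k = nat i + dial_time pl bl d"

lemma finite_buckets: "buckets_ok pl bl i p d bk lk \<Longrightarrow> finite (\<Union>j. set (bl j))"
  by (rule finite_subset[of _ E]) (auto simp: buckets_ok_def)

lemma dial_init:
  assumes "\<forall>v\<in>T. d v = 0" "\<forall>j. bk j = 0"
  shows "dial_inv (nat (t + 1) + 3 * nat m) [] (\<lambda>_. []) (t + 1) te 0 d bk lk"
proof -
  have "{e \<in> E. d (src e) = 0} = E" using assms by auto
  then show ?thesis using assms t_pos
    by (auto simp: dial_inv_def settled_ok_def buckets_ok_def relaxed_def dial_time_def)
qed

text \<open>Common to the two ways of receiving a value, as a seed and through an edge from a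
  bucket. The weight 3 of the out-edges of \<open>y\<close> covers the 2 they need in the
  list.\<close>

lemma settle:
  assumes s: "settled_ok i d" and b: "buckets_ok [] bl i p d bk lk" and x: "relaxed X [] bl d"
    and y: "y \<in> T" "d y < 1" "1 \<le> i" "i \<le> t" "P (seed i) \<le> P y"
    and X: "\<forall>e\<in>X. dst e = y \<and> d (src e) - max 0 (r e) \<le> i"
  shows "settled_ok i (d(y := i))" "buckets_ok (outs y) bl i (oh y) (d(y := i)) bk lk"
    "relaxed {} (outs y) bl (d(y := i))" "dial_time (outs y) bl (d(y := i)) \<le> dial_time [] bl d"
proof -
  have d0: "d y = 0" using s y unfolding settled_ok_def by force
  have out: "set (outs y) = {e \<in> E. src e = y}" using outs(3) by (simp add: E_def)
  show "settled_ok i (d(y := i))" using s y by (auto simp: settled_ok_def)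
  show "buckets_ok (outs y) bl i (oh y) (d(y := i)) bk lk"
    using b outs(1,2)[of y] out y d0 unfolding buckets_ok_def by auto
  show "relaxed {} (outs y) bl (d(y := i))"
    unfolding relaxed_def
  proof (intro ballI impI)
    fix e assume e: "e \<in> E" "e \<notin> {} \<and> (d(y := i)) (src e) \<noteq> 0"
    show "e \<in> set (outs y) \<or> (\<exists>j. e \<in> set (bl j) \<and> (d(y := i)) (src e) - max 0 (r e) \<le> j) \<or>
       (d(y := i)) (src e) - max 0 (r e) \<le> (d(y := i)) (dst e)"
    proof (cases "src e = y")
      case True
      then show ?thesis using e out by auto
    next
      case False
      then have de: "d (src e) \<noteq> 0" using e by simp
      show ?thesis
      proof (cases "e \<in> X")
        case True
        then show ?thesis using X False by auto
      next
        case nX: False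
        then have "(\<exists>j. e \<in> set (bl j) \<and> d (src e) - max 0 (r e) \<le> j) \<or> d (src e) - max 0 (r e) \<le> d (dst e)"
          using x e de unfolding relaxed_def by auto
        then show ?thesis using False d0 y(3) by (cases "dst e = y") auto
      qed
    qed
  qed
  have "{e \<in> E. d (src e) = 0} = {e \<in> E. (d(y := i)) (src e) = 0} \<union> set (outs y)"
    using out d0 y by auto
  moreover have "{e \<in> E. (d(y := i)) (src e) = 0} \<inter> set (outs y) = {}" using out y by auto
  ultimately have "card {e \<in> E. d (src e) = 0} = card {e \<in> E. (d(y := i)) (src e) = 0} + length (outs y)"
    using outs(2)[of y] by (simp add: card_Un_disjoint distinct_card)
  then show "dial_time (outs y) bl (d(y := i)) \<le> dial_time [] bl d" by (simp add: dial_time_def)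
qed

lemma dial_next:
  assumes inv: "dial_inv k pl bl i ce p d bk lk" and "0 < i" "\<not> 0 < p" "\<not> 0 < bk i"
  shows "\<not> 0 < i - 1 \<Longrightarrow> \<exists>k'<k. \<exists>pl' bl'. dial_inv k' pl' bl' (i - 1) ce' p d bk lk"
    and "0 < i - 1 \<Longrightarrow> d (dst ce) < 1 \<Longrightarrow> \<exists>k'<k. \<exists>pl' bl'.
      dial_inv k' pl' bl' (i - 1) (via (src ce)) (oh (dst ce)) (d(dst ce := i - 1)) bk lk"
    and "0 < i - 1 \<Longrightarrow> \<not> d (dst ce) < 1 \<Longrightarrow> \<exists>k'<k. \<exists>pl' bl'.
      dial_inv k' pl' bl' (i - 1) (via (src ce)) p d bk lk"
proof -
  have s: "settled_ok i d" and b: "buckets_ok pl bl i p d bk lk" and x: "relaxed {} pl bl d"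
    and ce: "ce = chain src via te (nat (t + 1 - i))"
    and sd: "\<forall>j. i \<le> j \<and> 1 \<le> j \<and> j \<le> t \<longrightarrow> j \<le> d (seed j)"
    and k: "k = nat i + dial_time pl bl d"
    using inv \<open>0 < i\<close> by (auto simp: dial_inv_def)
  have pl: "pl = []"
  proof -
    have "linked on p pl" "\<forall>e\<in>set pl. 0 \<le> e" using b by (auto simp: buckets_ok_def E_def)
    then show ?thesis using assms(3) by (cases rule: linked_cases) auto
  qed
  have bli: "bl i = []"
  proof -
    have "linked lk (bk i) (bl i)" "\<forall>e\<in>set (bl i). 0 \<le> e" using b by (auto simp: buckets_ok_def E_def)
    then show ?thesis using assms(4) by (cases rule: linked_cases) auto
  qed
  have s': "settled_ok (i - 1) d" using s \<open>0 < i\<close> by (auto simp: settled_ok_def)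
  have "j \<noteq> i" if "e \<in> set (bl j)" for e j using that bli by auto
  then have b': "buckets_ok [] bl (i - 1) p d bk lk"
    using b unfolding pl buckets_ok_def by force
  have x': "relaxed {} [] bl d" using x pl by simp
  {
    assume "\<not> 0 < i - 1"
    then have "i = 1" using \<open>0 < i\<close> by simp
    then have "dial_inv (k - 1) [] bl (i - 1) ce' p d bk lk"
      using s' b' x' sd k pl by (auto simp: dial_inv_def)
    then show "\<exists>k'<k. \<exists>pl' bl'. dial_inv k' pl' bl' (i - 1) ce' p d bk lk"
      using k \<open>0 < i\<close> by (intro exI[of _ "k - 1"]) auto
  next
    assume i1: "0 < i - 1"
    have it: "i - 1 \<le> t" using s by (simp add: settled_ok_def)
    have y: "dst ce = seed (i - 1)" by (simp add: ce seed_def algebra_simps)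
    have "nat (t + 1 - (i - 1)) = Suc (nat (t + 1 - i))" using it by auto
    then have ce1: "via (src ce) = chain src via te (nat (t + 1 - (i - 1)))" by (simp add: ce)
    have dnn: "0 \<le> d (seed j)" if "1 \<le> j" "j \<le> t" for j
      using s seed_T[OF that] by (force simp: settled_ok_def)
    {
      assume d: "d (dst ce) < 1"
      have "dial_inv (nat (i - 1) + dial_time (outs (dst ce)) bl (d(dst ce := i - 1))) (outs (dst ce)) bl (i - 1)
        (via (src ce)) (oh (dst ce)) (d(dst ce := i - 1)) bk lk"
        unfolding dial_inv_def
      proof (intro conjI)
        have yT: "dst ce \<in> T" using y seed_T[of "i - 1"] i1 it by simp
        note st = settle[OF s' b' x' yT d, simplified]
        show "settled_ok (i - 1) (d(dst ce := i - 1))"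
          "buckets_ok (outs (dst ce)) bl (i - 1) (oh (dst ce)) (d(dst ce := i - 1)) bk lk"
          "relaxed {} (outs (dst ce)) bl (d(dst ce := i - 1))"
          using st i1 it y by auto
        show "0 < i - 1 \<longrightarrow> via (src ce) = chain src via te (nat (t + 1 - (i - 1)))" using ce1 by simp
        show "\<forall>j. i - 1 \<le> j \<and> 1 \<le> j \<and> j \<le> t \<longrightarrow> j \<le> (d(dst ce := i - 1)) (seed j)"
        proof (intro allI impI)
          fix j assume j: "i - 1 \<le> j \<and> 1 \<le> j \<and> j \<le> t"
          show "j \<le> (d(dst ce := i - 1)) (seed j)"
          proof (cases "j = i - 1")
            case False
            then have "j \<le> d (seed j)" using sd j by auto
            moreover have "seed j \<noteq> dst ce" using calculation d j by auto
            ultimately show ?thesis by simp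
          qed (simp add: y)
        qed
      qed simp
      moreover have "dial_time (outs (dst ce)) bl (d(dst ce := i - 1)) \<le> dial_time [] bl d"
        using settle(4)[OF s' b' x', of "dst ce"] d i1 it y seed_T[of "i - 1"] by simp
      ultimately show "\<exists>k'<k. \<exists>pl' bl'.
          dial_inv k' pl' bl' (i - 1) (via (src ce)) (oh (dst ce)) (d(dst ce := i - 1)) bk lk"
        using k i1 pl by (intro exI[of _ "nat (i - 1) + dial_time (outs (dst ce)) bl (d(dst ce := i - 1))"]) auto
    next
      assume d: "\<not> d (dst ce) < 1"
      have "i - 1 \<le> d (seed (i - 1))" using s' seed_T[of "i - 1"] i1 it d y by (force simp: settled_ok_def)
      then have "\<forall>j. i - 1 \<le> j \<and> 1 \<le> j \<and> j \<le> t \<longrightarrow> j \<le> d (seed j)"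
        using sd by (metis order_le_less zle_diff1_eq linorder_not_le)
      then have "dial_inv (k - 1) [] bl (i - 1) (via (src ce)) p d bk lk"
        using s' b' x' k pl ce1 i1 by (auto simp: dial_inv_def)
      then show "\<exists>k'<k. \<exists>pl' bl'. dial_inv k' pl' bl' (i - 1) (via (src ce)) p d bk lk"
        using k \<open>0 < i\<close> by (intro exI[of _ "k - 1"]) auto
    }
  }
qed

lemma dial_pop:
  assumes inv: "dial_inv k pl bl i ce p d bk lk" and "0 < i" "\<not> 0 < p" "0 < bk i"
  defines "x \<equiv> bk i - 1"
  shows "d (dst x) < 1 \<Longrightarrow> \<exists>k'<k. \<exists>pl' bl'.
      dial_inv k' pl' bl' i ce (oh (dst x)) (d(dst x := i)) (bk(i := lk x)) lk"
    and "\<not> d (dst x) < 1 \<Longrightarrow> \<exists>k'<k. \<exists>pl' bl'. dial_inv k' pl' bl' i ce p d (bk(i := lk x)) lk"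
proof -
  have s: "settled_ok i d" and b: "buckets_ok pl bl i p d bk lk" and rl: "relaxed {} pl bl d"
    and ce: "ce = chain src via te (nat (t + 1 - i))"
    and sd: "\<forall>j. i \<le> j \<and> 1 \<le> j \<and> j \<le> t \<longrightarrow> j \<le> d (seed j)"
    and k: "k = nat i + dial_time pl bl d"
    using inv \<open>0 < i\<close> by (auto simp: dial_inv_def)
  have pl: "pl = []"
  proof -
    have "linked on p pl" "\<forall>e\<in>set pl. 0 \<le> e" using b by (auto simp: buckets_ok_def E_def)
    then show ?thesis using assms(3) by (cases rule: linked_cases) auto
  qed
  obtain xs where xs: "bl i = x # xs" "linked lk (lk x) xs"
  proof -
    have "linked lk (bk i) (bl i)" "\<forall>e\<in>set (bl i). 0 \<le> e" using b by (auto simp: buckets_ok_def E_def)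
    then show ?thesis using assms(4) that unfolding x_def by (cases rule: linked_cases) auto
  qed
  define bl' where "bl' = bl(i := xs)"
  have "x \<in> set (bl i)" using xs(1) by simp
  have "distinct (bl i)" using b unfolding buckets_ok_def by blast
  have b5: "1 \<le> j \<and> j \<le> i \<and> j \<le> t \<and> e \<in> E \<and> d (src e) \<noteq> 0 \<and> P (seed j) \<le> P (dst e)"
    if "e \<in> set (bl j)" for e j using b that unfolding buckets_ok_def by blast
  have b6: "set (bl j) \<inter> set (bl j') = {}" if "j \<noteq> j'" for j j'
    using b that unfolding buckets_ok_def by blast
  have x: "i \<le> t" "x \<in> E" "P (seed i) \<le> P (dst x)" "d (src x) \<noteq> 0"
    using b5[OF \<open>x \<in> set (bl i)\<close>] by auto
  have xd: "x \<notin> set (bl j)" if "j \<noteq> i" for j using b6[OF that] \<open>x \<in> set (bl i)\<close> by blast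
  have xx: "x \<notin> set xs" "distinct xs" using \<open>distinct (bl i)\<close> xs(1) by auto
  have sub: "set (bl' j) \<subseteq> set (bl j)" for j using xs(1) by (auto simp: bl'_def)
  have b': "buckets_ok [] bl' i p d (bk(i := lk x)) lk"
  proof -
    have "linked lk ((bk(i := lk x)) j) (bl' j) \<and> distinct (bl' j)" for j
      using b xs(2) xx by (cases "j = i") (auto simp: bl'_def buckets_ok_def)
    moreover have "1 \<le> j \<and> j \<le> i \<and> j \<le> t \<and> e \<in> E \<and> d (src e) \<noteq> 0 \<and> P (seed j) \<le> P (dst e)"
      if "e \<in> set (bl' j)" for e j using that sub[of j] b5 by blast
    moreover have "set (bl' j) \<inter> set (bl' j') = {}" if "j \<noteq> j'" for j j'
      using b6[OF that] sub[of j] sub[of j'] by blast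
    moreover have "linked on p []" using b unfolding pl buckets_ok_def by blast
    ultimately show ?thesis unfolding buckets_ok_def by simp
  qed
  have X: "d (src x) - max 0 (r x) \<le> i \<or> d (src x) - max 0 (r x) \<le> d (dst x)"
  proof -
    have "(\<exists>j. x \<in> set (bl j) \<and> d (src x) - max 0 (r x) \<le> j) \<or> d (src x) - max 0 (r x) \<le> d (dst x)"
      using rl x unfolding relaxed_def pl by auto
    then show ?thesis using xd by metis
  qed
  have rl': "relaxed {x} [] bl' d"
  proof -
    have "e \<in> set (bl' j)" if "e \<in> set (bl j)" "e \<noteq> x" for e j
      using that xs(1) by (cases "j = i") (auto simp: bl'_def)
    then show ?thesis using rl unfolding pl relaxed_def by (metis empty_iff insertI1 list.set(1))
  qed
  have "(\<Union>j. set (bl j)) = insert x (\<Union>j. set (bl' j))"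
  proof (intro equalityI subsetI)
    fix e assume "e \<in> (\<Union>j. set (bl j))"
    then obtain j where "e \<in> set (bl j)" by blast
    then have "e = x \<or> e \<in> set (bl' j)" using xs(1) by (cases "j = i") (auto simp: bl'_def)
    then show "e \<in> insert x (\<Union>j. set (bl' j))" by blast
  next
    fix e assume "e \<in> insert x (\<Union>j. set (bl' j))"
    then show "e \<in> (\<Union>j. set (bl j))" using sub \<open>x \<in> set (bl i)\<close> by blast
  qed
  moreover have "x \<notin> set (bl' j)" for j using xd[of j] xx by (cases "j = i") (auto simp: bl'_def)
  then have "x \<notin> (\<Union>j. set (bl' j))" by blast
  ultimately have "card (\<Union>j. set (bl j)) = Suc (card (\<Union>j. set (bl' j)))"
    using finite_buckets[OF b'] by simp
  then have time: "dial_time pl bl d = Suc (dial_time [] bl' d)" by (simp add: dial_time_def pl)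
  {
    assume d: "d (dst x) < 1"
    have "d (dst x) = 0" using s x d unfolding settled_ok_def by force
    then have "\<forall>e\<in>{x}. dst e = dst x \<and> d (src e) - max 0 (r e) \<le> i" using X \<open>0 < i\<close> by auto
    note st = settle[OF s b' rl' dst_T[OF x(2)] d _ x(1) x(3) this]
    have "\<forall>j. i \<le> j \<and> 1 \<le> j \<and> j \<le> t \<longrightarrow> j \<le> (d(dst x := i)) (seed j)"
      using sd \<open>d (dst x) = 0\<close> \<open>0 < i\<close> by force
    then have "dial_inv (nat i + dial_time (outs (dst x)) bl' (d(dst x := i))) (outs (dst x)) bl' i ce
        (oh (dst x)) (d(dst x := i)) (bk(i := lk x)) lk"
      using st \<open>0 < i\<close> ce unfolding dial_inv_def by auto
    moreover have "nat i + dial_time (outs (dst x)) bl' (d(dst x := i)) < k"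
      using k time st(4) \<open>0 < i\<close> by auto
    ultimately show "\<exists>k'<k. \<exists>pl' bl'.
      dial_inv k' pl' bl' i ce (oh (dst x)) (d(dst x := i)) (bk(i := lk x)) lk" by blast
  next
    assume d: "\<not> d (dst x) < 1"
    then have "i \<le> d (dst x)" using s dst_T[OF x(2)] unfolding settled_ok_def by force
    then have "d (src x) - max 0 (r x) \<le> d (dst x)" using X by auto
    then have "relaxed {} [] bl' d" using rl' unfolding relaxed_def by (metis empty_iff singletonD)
    then have "dial_inv (nat i + dial_time [] bl' d) [] bl' i ce p d (bk(i := lk x)) lk"
      using s b' sd ce unfolding dial_inv_def by auto
    moreover have "nat i + dial_time [] bl' d < k" using k time by auto
    ultimately show "\<exists>k'<k. \<exists>pl' bl'. dial_inv k' pl' bl' i ce p d (bk(i := lk x)) lk" by blast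
  }
qed

lemma dial_scan:
  assumes inv: "dial_inv k pl bl i ce p d bk lk" and "0 < i" "0 < p"
  defines "x \<equiv> p - 1"
  defines "q \<equiv> i - max 0 (r x)"
  shows "0 < q \<Longrightarrow> d (dst x) < 1 \<Longrightarrow> \<exists>k'<k. \<exists>pl' bl'.
      dial_inv k' pl' bl' i ce (on x) d (bk(q := x + 1)) (lk(x := bk q))"
    and "\<not> (0 < q \<and> d (dst x) < 1) \<Longrightarrow> \<exists>k'<k. \<exists>pl' bl'. dial_inv k' pl' bl' i ce (on x) d bk lk"
proof -
  have s: "settled_ok i d" and b: "buckets_ok pl bl i p d bk lk" and rl: "relaxed {} pl bl d"
    and ce: "ce = chain src via te (nat (t + 1 - i))"
    and sd: "\<forall>j. i \<le> j \<and> 1 \<le> j \<and> j \<le> t \<longrightarrow> j \<le> d (seed j)"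
    and k: "k = nat i + dial_time pl bl d"
    using inv \<open>0 < i\<close> by (auto simp: dial_inv_def)
  obtain xs where xs: "pl = x # xs" "linked on (on x) xs"
  proof -
    have "linked on p pl" "\<forall>e\<in>set pl. 0 \<le> e" using b by (auto simp: buckets_ok_def E_def)
    then show ?thesis using assms(3) that unfolding x_def by (cases rule: linked_cases) auto
  qed
  have x: "x \<in> E" "d (src x) = i" "x \<notin> set xs" "distinct xs" "\<And>j. x \<notin> set (bl j)"
    using b xs unfolding buckets_ok_def by auto
  have it: "i \<le> t" and Px: "P (seed i) \<le> P (src x)"
    using s src_T[OF x(1)] x(2) \<open>0 < i\<close> unfolding settled_ok_def by auto
  {
    assume q: "0 < q" "d (dst x) < 1"
    define bl' where "bl' = bl(q := x # bl q)"
    have qi: "q \<le> i" by (simp add: q_def)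
    \<comment> \<open>The offer \<open>q\<close> again needs a seed as certificate. Along the edge
      \<open>P\<close> drops by at most \<open>r x\<close>; moving back \<open>r x\<close> positions
      on the chain makes \<open>P\<close> drop by at least as much.\<close>
    have Pq: "P (seed q) \<le> P (dst x)"
    proof (cases "q = i")
      case True
      then have "r x \<le> 0" by (simp add: q_def)
      then show ?thesis using P_mono[OF x(1)] Px True by simp
    next
      case False
      have less: "P (seed (i - int n)) + int n \<le> P (seed i)" if "int n < i" for n
        using that
      proof (induction n)
        case (Suc n)
        then have "P (seed (i - int (Suc n))) < P (seed (i - int n))" using it by (intro seed_less) auto
        then show ?case using Suc by simp
      qed simp
      have "q = i - int (nat (r x))" using False by (simp add: q_def max_def split: if_splits)
      then have "P (seed q) + r x \<le> P (seed i)" using less[of "nat (r x)"] q False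
        by (simp add: q_def max_def split: if_splits)
      then show ?thesis using feasible[OF x(1)] Px by simp
    qed
    have "buckets_ok xs bl' i (on x) d (bk(q := x + 1)) (lk(x := bk q))"
      unfolding buckets_ok_def
    proof (intro conjI allI ballI impI)
      show "linked on (on x) xs" "distinct xs" by fact+
      fix e assume "e \<in> set xs" then show "e \<in> E" "d (src e) = i" "1 \<le> i"
        using b xs \<open>0 < i\<close> unfolding buckets_ok_def by auto
    next
      fix j
      show "linked (lk(x := bk q)) ((bk(q := x + 1)) j) (bl' j)"
        using b x unfolding buckets_ok_def by (auto simp: bl'_def)
      show "distinct (bl' j)" using b x unfolding buckets_ok_def by (auto simp: bl'_def)
    next
      fix j e assume e: "e \<in> set (bl' j)"
      have "1 \<le> j \<and> j \<le> i \<and> j \<le> t \<and> e \<in> E \<and> d (src e) \<noteq> 0 \<and> P (seed j) \<le> P (dst e) \<and> e \<notin> set xs"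
      proof (cases "e = x")
        case True
        then have "j = q" using e x(5)[of j] by (auto simp: bl'_def split: if_splits)
        then show ?thesis using True q qi it x Pq \<open>0 < i\<close> by auto
      next
        case False
        then have "e \<in> set (bl j)" using e by (auto simp: bl'_def split: if_splits)
        then have "1 \<le> j \<and> j \<le> i \<and> j \<le> t \<and> e \<in> E \<and> d (src e) \<noteq> 0 \<and> P (seed j) \<le> P (dst e) \<and> e \<notin> set pl"
          using b unfolding buckets_ok_def by blast
        then show ?thesis using xs by auto
      qed
      then show "1 \<le> j" "j \<le> i" "j \<le> t" "e \<in> E" "d (src e) \<noteq> 0" "P (seed j) \<le> P (dst e)" "e \<notin> set xs"
        by auto
    next
      fix j j' :: int assume "j \<noteq> j'"
      moreover have "set (bl j) \<inter> set (bl j') = {}" using b \<open>j \<noteq> j'\<close> unfolding buckets_ok_def by blast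
      ultimately show "set (bl' j) \<inter> set (bl' j') = {}" using x(5) by (auto simp: bl'_def)
    qed
    moreover have "relaxed {} xs bl' d"
      unfolding relaxed_def
    proof (intro ballI impI)
      fix e assume e: "e \<in> E" "e \<notin> {} \<and> d (src e) \<noteq> 0"
      show "e \<in> set xs \<or> (\<exists>j. e \<in> set (bl' j) \<and> d (src e) - max 0 (r e) \<le> j) \<or>
         d (src e) - max 0 (r e) \<le> d (dst e)"
      proof (cases "e = x")
        case True
        then have "e \<in> set (bl' q) \<and> d (src e) - max 0 (r e) \<le> q" using x by (simp add: bl'_def q_def)
        then show ?thesis by blast
      next
        case False
        have "set (bl j) \<subseteq> set (bl' j)" for j by (auto simp: bl'_def)
        then show ?thesis using rl e False xs unfolding relaxed_def by (metis set_ConsD subsetD)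
      qed
    qed
    ultimately have "dial_inv (nat i + dial_time xs bl' d) xs bl' i ce (on x) d (bk(q := x + 1)) (lk(x := bk q))"
      using s sd ce unfolding dial_inv_def by auto
    moreover have "nat i + dial_time xs bl' d < k"
    proof -
      have "(\<Union>j. set (bl' j)) = insert x (\<Union>j. set (bl j))" by (auto simp: bl'_def split: if_splits)
      then have "card (\<Union>j. set (bl' j)) = Suc (card (\<Union>j. set (bl j)))"
        using x(5) finite_buckets[OF b] by simp
      then show ?thesis unfolding k dial_time_def xs by simp
    qed
    ultimately show "\<exists>k'<k. \<exists>pl' bl'.
      dial_inv k' pl' bl' i ce (on x) d (bk(q := x + 1)) (lk(x := bk q))" by blast
  next
    assume q: "\<not> (0 < q \<and> d (dst x) < 1)"
    \<comment> \<open>No entry is necessary: either the head is settled with a value of at least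
      \<open>i\<close>, or the offer is not positive and the default 0 already meets it.\<close>
    have "d (dst x) = 0 \<or> i \<le> d (dst x)" using s dst_T[OF x(1)] unfolding settled_ok_def by blast
    then have "i - max 0 (r x) \<le> d (dst x)" using q by (auto simp: q_def)
    then have "relaxed {} xs bl d" using rl x(2) unfolding relaxed_def xs by auto
    moreover have "buckets_ok xs bl i (on x) d bk lk" using b xs unfolding buckets_ok_def by auto
    ultimately have "dial_inv (nat i + dial_time xs bl d) xs bl i ce (on x) d bk lk"
      using s sd ce unfolding dial_inv_def by auto
    moreover have "nat i + dial_time xs bl d < k" unfolding k dial_time_def xs by simp
    ultimately show "\<exists>k'<k. \<exists>pl' bl'. dial_inv k' pl' bl' i ce (on x) d bk lk" by blast
  }
qed

text \<open>The buckets are drained on the way down to 0, so \<open>bk\<close> is clean for the next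
  call without a clearing pass. Being relaxed makes \<open>d\<close> a good lowering, and the seeds
  are the repaired heads.\<close>

lemma dial_done:
  assumes inv: "dial_inv k pl bl i ce p d bk lk" and "\<not> 0 < i"
  shows "\<forall>j. bk j = 0" and "good_lowering d"
    and "int (card (heads (shifted r d))) + t \<le> int (card (heads r))"
proof -
  have s: "settled_ok i d" and b: "buckets_ok pl bl i p d bk lk" and rl: "relaxed {} pl bl d"
    and sd: "\<forall>j. i \<le> j \<and> 1 \<le> j \<and> j \<le> t \<longrightarrow> j \<le> d (seed j)"
    using inv by (auto simp: dial_inv_def)
  have i0: "i = 0" using s assms(2) by (simp add: settled_ok_def)
  have "1 \<le> i" if "e \<in> set pl" for e using b that unfolding buckets_ok_def by blast
  then have pl: "pl = []" using i0 by (cases pl) auto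
  have "1 \<le> j \<and> j \<le> i" if "e \<in> set (bl j)" for e j using b that unfolding buckets_ok_def by blast
  then have "e \<notin> set (bl j)" for e j using i0 by fastforce
  then have bl: "bl j = []" for j by (metis list.set_intros(1) neq_Nil_conv)
  have "linked lk (bk j) (bl j)" for j using b by (auto simp: buckets_ok_def)
  then show "\<forall>j. bk j = 0" using bl by simp
  have d: "d v = 0 \<or> 1 \<le> d v \<and> d v \<le> t \<and> P (seed (d v)) \<le> P v" if "v \<in> T" for v
    using s that unfolding settled_ok_def by blast
  have rx: "d (src e) - max 0 (r e) \<le> d (dst e)" if "e \<in> E" for e
    using rl that d[OF dst_T[OF that]] unfolding relaxed_def pl bl by (cases "d (src e) = 0") auto
  show good: "good_lowering d"
    unfolding good_lowering_def
  proof (intro conjI ballI)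
    fix v assume v: "v \<in> T"
    show "0 \<le> d v" using d[OF v] by auto
    show "d v \<le> P v" using d[OF v] P_nonneg[of v] seed_ge[of "d v"] by auto
  next
    fix e assume "e \<in> E"
    then show "min (r e) 0 \<le> shifted r d e" using rx[of e] by (auto simp: shifted_def)
  qed
  let ?S = "seed ` {1..t}"
  note SN = seeds(1) and cS = seeds(2)
  have "v \<notin> heads (shifted r d)" if vS: "v \<in> ?S" for v
  proof
    assume "v \<in> heads (shifted r d)"
    then obtain e where e: "e \<in> E" "dst e = v" "shifted r d e < 0" by (auto simp: heads_def)
    obtain j where j: "1 \<le> j" "j \<le> t" "v = seed j" using vS by auto
    have dv: "j \<le> d v" using sd j i0 by auto
    have re: "r e < 0" using rx[OF e(1)] e(3) by (auto simp: shifted_def max_def split: if_splits)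
    \<comment> \<open>The source of a negative edge into seed \<open>j\<close> has smaller
      \<open>P\<close> than that seed. A value of \<open>j\<close> or more would have to be
      certified by a seed with at least this \<open>P\<close>. So the source is lowered less than
      the seed, and the edge gains the 1 it lacked.\<close>
    have "P (src e) < P v" using feasible[OF e(1)] re e(2) by simp
    have "d (src e) < j"
    proof (rule ccontr)
      assume "\<not> d (src e) < j"
      then have "j \<le> d (src e)" "d (src e) \<le> t" "P (seed (d (src e))) \<le> P (src e)"
        using d[OF src_T[OF e(1)]] j by auto
      then show False using seed_mono[of j "d (src e)"] j \<open>P (src e) < P v\<close> by auto
    qed
    moreover have "- 1 \<le> r e" using bound e by blast
    ultimately show False using e(3) dv e(2) by (simp add: shifted_def)
  qed
  then have "heads (shifted r d) \<subseteq> heads r - ?S" using good_lowering_heads[OF good] by blast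
  then have "card (heads (shifted r d)) \<le> card (heads r) - card ?S"
    by (metis SN card_Diff_subset card_mono finite_Diff finite_heads finite_subset)
  moreover have "card ?S \<le> card (heads r)" using SN by (simp add: card_mono)
  ultimately show "int (card (heads (shifted r d))) + t \<le> int (card (heads r))" using cS by linarith
qed

end

section \<open>Programs on the arrays of a graph\<close>

text \<open>The edges leaving and entering a vertex are linked by \<open>on\<close> and \<open>in\<close>, starting from \<open>oh\<close> and \<open>ih\<close>.
  The lengths of the current scale are the \<open>m\<close> cells of \<open>q\<close> from address \<open>b\<close> on; the duals \<open>y\<close> are
  relative to the prediction, which is kept in \<open>y0\<close>.\<close>

definition wt :: "aexp \<Rightarrow> aexp" where
  "wt x = Sub (Add (Get ''q'' (Add (var ''b'') x)) (Get ''y'' (Get ''src'' x))) (Get ''y'' (Get ''dst'' x))"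

text \<open>A vertex is visited once for every edge end at it, so the action must be one that can be
  repeated without effect.\<close>

definition for_vertices :: "(aexp \<Rightarrow> com) \<Rightarrow> com" where
  "for_vertices act = for_edges (act (Get ''src'' (var ''e'')) ;; act (Get ''dst'' (var ''e'')))"

context arcs
begin

definition has_arcs :: "store \<Rightarrow> bool" where
  "has_arcs s \<longleftrightarrow> s ''m'' 0 = m \<and> s ''src'' = src \<and> s ''dst'' = dst \<and> s ''oh'' = oh \<and> s ''on'' = on \<and>
     s ''ih'' = ih \<and> s ''in'' = inx"

definition rw :: "store \<Rightarrow> int \<Rightarrow> int" where
  "rw s x = s ''q'' (s ''b'' 0 + x) + s ''y'' (src x) - s ''y'' (dst x)"

lemma has_arcs_agree:
  assumes "agree_off X s s'" "has_arcs s"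
    and "X \<inter> {''m'', ''src'', ''dst'', ''oh'', ''on'', ''ih'', ''in''} = {}"
  shows "has_arcs s'"
  using assms unfolding has_arcs_def agree_off_def by auto

lemma rw_agree:
  assumes "agree_off X s s'" "X \<inter> {''q'', ''b'', ''y''} = {}"
  shows "rw s' = rw s"
  using assms unfolding rw_def agree_off_def by (intro ext) auto

lemma runs_for_vertices:
  assumes s: "has_arcs s"
    and act: "\<And>x s'. agree_off {a, ''e''} s s' \<Longrightarrow>
      result (act x) s' = s'(a := (s' a)(aval x s' := F (aval x s')))"
    and str: "\<And>x. straight (act x)" "\<And>x. writes (act x) = {a}" "\<And>x. step_bound (act x) \<le> 3"
    and a: "a \<notin> {''e'', ''m'', ''src'', ''dst''}"
  shows "runs (for_vertices act) s (8 * nat m + 2)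
    (\<lambda>s'. agree_off {a, ''e''} s s' \<and> s' a = (\<lambda>v. if v \<in> T then F v else s a v))"
proof -
  let ?x = "Get ''src'' (var ''e'')" and ?y = "Get ''dst'' (var ''e'')"
  define I where "I = (\<lambda>i s'. agree_off {a, ''e''} s s' \<and>
    s' a = (\<lambda>v. if v \<in> src ` {0..<i} \<union> dst ` {0..<i} then F v else s a v))"
  have "runs (for_edges (act ?x ;; act ?y)) s ((step_bound (act ?x ;; act ?y) + 2) * nat m + 2) (I m)"
  proof (rule runs_for_edges)
    show "straight (act ?x ;; act ?y)" using str by simp
    show "s ''m'' 0 = m" "0 \<le> m" using s m_nonneg by (auto simp: has_arcs_def)
    show "''e'' \<notin> writes (act ?x ;; act ?y)" "''m'' \<notin> writes (act ?x ;; act ?y)" using str a by auto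
    show "I 0 (s(''e'' := (s ''e'')(0 := 0)))" using a by (simp add: I_def agree_off_def)
    fix i s' assume I: "I i s'" and i: "0 \<le> i" "i < m" "s' ''e'' 0 = i"
    have ag: "agree_off {a, ''e''} s s'" using I by (simp add: I_def)
    have sd: "s' ''src'' = src" "s' ''dst'' = dst"
      using agree_offD[OF ag] a s by (auto simp: has_arcs_def)
    have na: "a \<noteq> ''e''" "''e'' \<noteq> a" "a \<noteq> ''src''" "''src'' \<noteq> a" "a \<noteq> ''dst''" "''dst'' \<noteq> a"
      using a by auto
    let ?s = "s'(a := (s' a)(src i := F (src i)))"
    have 1: "result (act ?x) s' = ?s" using act[OF ag] sd i by simp
    have "agree_off {a, ''e''} s ?s" using ag by (simp add: agree_off_def)
    then have 2: "result (act ?y) ?s = s'(a := ((s' a)(src i := F (src i)))(dst i := F (dst i)))"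
      using act sd i na by simp
    have "{0..<i + 1} = insert i {0..<i}" using i by auto
    then show "I (i + 1) (result ((act ?x ;; act ?y) ;; assign ''e'' (plus1 (var ''e''))) s')"
      using I na i unfolding I_def by (auto simp: 1 2 agree_off_def fun_eq_iff)
  qed
  then show ?thesis unfolding for_vertices_def
  proof (rule runs_mono)
    have "step_bound (act ?x ;; act ?y) + 2 \<le> 8" using str(3)[of ?x] str(3)[of ?y] by simp
    then show "(step_bound (act ?x ;; act ?y) + 2) * nat m + 2 \<le> 8 * nat m + 2"
      by (intro add_mono mult_mono) auto
  qed (simp add: I_def T_def E_def)
qed

lemma runs_set_vertices:
  assumes "has_arcs s" and f: "\<And>x s'. agree_off {a, ''e''} s s' \<Longrightarrow> aval (f x) s' = F (aval x s')"
    and "a \<notin> {''e'', ''m'', ''src'', ''dst''}"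
  shows "runs (for_vertices (\<lambda>x. Put a x (f x))) s (8 * nat m + 2)
    (\<lambda>s'. agree_off {a, ''e''} s s' \<and> s' a = (\<lambda>v. if v \<in> T then F v else s a v))"
  using assms by (intro runs_for_vertices) auto

end

section \<open>Programs for the two searches that compute the levels\<close>

definition push_dfs :: com where
  "push_dfs = (Put ''lw'' (var ''u'') (plus1 (var ''c'')) ;; assign ''sp'' (plus1 (var ''sp'')) ;;
     Put ''st'' (var ''sp'') (var ''u''))"

definition dfs_body :: com where
  "dfs_body = Cond (pos (var ''sp''))
     (assign ''v'' (Get ''st'' (var ''sp'')) ;;
      Cond (pos (Get ''cu'' (var ''v'')))
        (assign ''x'' (minus1 (Get ''cu'' (var ''v''))) ;;
         Put ''cu'' (var ''v'') (Get ''on'' (var ''x'')) ;;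
         assign ''u'' (Get ''dst'' (var ''x'')) ;;
         Cond (Conj (Less (wt (var ''x'')) (Const 1)) (Less (Get ''lw'' (var ''u'')) (Const 1)))
           push_dfs Skip)
        (assign ''c'' (plus1 (var ''c'')) ;; Put ''ps'' (var ''v'') (var ''c'') ;;
         Put ''od'' (var ''c'') (var ''v'') ;; assign ''sp'' (minus1 (var ''sp''))))
     (assign ''u'' (Get ''src'' (var ''e'')) ;; assign ''e'' (plus1 (var ''e'')) ;;
      Cond (Less (Get ''lw'' (var ''u'')) (Const 1)) push_dfs Skip)"

definition dfs_loop :: com where
  "dfs_loop = While (Neg (Conj (Neg (pos (var ''sp''))) (Neg (Less (var ''e'') (var ''m''))))) dfs_body"

definition push_scan :: com where
  "push_scan = (Put ''cm'' (var ''u'') (var ''i'') ;; assign ''sp'' (plus1 (var ''sp'')) ;;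
     Put ''st'' (var ''sp'') (var ''u''))"

definition scan_body :: com where
  "scan_body = Cond (pos (var ''sp''))
     (assign ''v'' (Get ''st'' (var ''sp'')) ;;
      Cond (pos (Get ''ci'' (var ''v'')))
        (assign ''x'' (minus1 (Get ''ci'' (var ''v''))) ;;
         Put ''ci'' (var ''v'') (Get ''in'' (var ''x'')) ;;
         assign ''u'' (Get ''src'' (var ''x'')) ;;
         Cond (Less (wt (var ''x'')) (Const 1))
           (Cond (Less (Get ''cm'' (var ''u'')) (Const 1))
             push_scan
             (assign ''z'' (Get ''cm'' (var ''u'')) ;;
              Cond (Less (wt (var ''x'')) (Const 0))
                (Cond (Less (Get ''la'' (var ''i'')) (plus1 (Get ''la'' (var ''z''))))
                  (Put ''la'' (var ''i'') (plus1 (Get ''la'' (var ''z''))) ;;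
                   Put ''vi'' (var ''i'') (plus1 (var ''x'')))
                  Skip)
                (Cond (Less (Get ''la'' (var ''i'')) (Get ''la'' (var ''z'')))
                  (Put ''la'' (var ''i'') (Get ''la'' (var ''z'')) ;;
                   Put ''vi'' (var ''i'') (Get ''vi'' (var ''z'')))
                  Skip)))
           Skip)
        (assign ''sp'' (minus1 (var ''sp''))))
     (assign ''i'' (minus1 (var ''i'')) ;; assign ''u'' (Get ''od'' (var ''i'')) ;;
      Cond (Less (Get ''cm'' (var ''u'')) (Const 1))
        (Put ''la'' (var ''i'') (Const 0) ;; push_scan) Skip)"

definition scan_loop :: com where
  "scan_loop = While (Neg (Conj (Neg (pos (var ''sp''))) (Neg (Less (Const 1) (var ''i''))))) scan_body"

text \<open>The stack and the arrays indexed by numbers, \<open>od\<close>, \<open>la\<close> and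
  \<open>vi\<close>, are not cleared, since their cells are set before their content matters. Cell 0
  of \<open>la\<close> is never written and supplies the level of the vertices in no class.\<close>

definition levels_prog :: com where
  "levels_prog =
     (for_vertices (\<lambda>x. Put ''lw'' x (Const 0)) ;;
      for_vertices (\<lambda>x. Put ''ps'' x (Const 0)) ;;
      for_vertices (\<lambda>x. Put ''cu'' x (Get ''oh'' x)) ;;
      for_vertices (\<lambda>x. Put ''cm'' x (Const 0)) ;;
      for_vertices (\<lambda>x. Put ''ci'' x (Get ''ih'' x)) ;;
      (assign ''e'' (Const 0) ;; assign ''sp'' (Const 0) ;; assign ''c'' (Const 0)) ;;
      dfs_loop ;;
      (assign ''i'' (plus1 (var ''c'')) ;; assign ''sp'' (Const 0)) ;;
      scan_loop ;;
      for_vertices (\<lambda>x. Put ''lv'' x (Get ''la'' (Get ''cm'' x))))"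

context weighted
begin

lemma runs_dfs_loop:
  assumes s: "has_arcs s" "rw s = r"
    and init: "\<forall>v\<in>T. s ''lw'' v = 0 \<and> s ''ps'' v = 0 \<and> s ''cu'' v = oh v"
    "s ''e'' 0 = 0" "s ''sp'' 0 = 0" "s ''c'' 0 = 0"
  shows "runs dfs_loop s (100 * nat m + 1) (\<lambda>s'. postorder (s' ''lw'') (s' ''ps'') (s' ''od'') (s' ''c'' 0))"
proof -
  define I where "I = (\<lambda>k s'. \<exists>rest. dfs_inv k rest (s' ''e'' 0) (s' ''sp'' 0) (s' ''st'') (s' ''lw'')
    (s' ''cu'') (s' ''ps'') (s' ''od'') (s' ''c'' 0))"
  have "runs dfs_loop s (Suc (Suc (step_bound dfs_body) * (4 * nat m)))
    (\<lambda>s'. (\<exists>k. I k s') \<and> \<not> bval (Neg (Conj (Neg (pos (var ''sp''))) (Neg (Less (var ''e'') (var ''m''))))) s')"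
    unfolding dfs_loop_def
  proof (rule runs_While_straight)
    show "straight dfs_body" by (simp add: dfs_body_def push_dfs_def)
    show "I (4 * nat m) s" unfolding I_def using dfs_init[OF init(1)] init by auto
    fix k s' assume "I k s'" and ag: "agree_off (writes dfs_body) s s'"
      and b: "bval (Neg (Conj (Neg (pos (var ''sp''))) (Neg (Less (var ''e'') (var ''m''))))) s'"
    then obtain rest where inv: "dfs_inv k rest (s' ''e'' 0) (s' ''sp'' 0) (s' ''st'') (s' ''lw'')
      (s' ''cu'') (s' ''ps'') (s' ''od'') (s' ''c'' 0)" unfolding I_def by blast
    have h: "has_arcs s'" by (rule has_arcs_agree[OF ag s(1)]) (simp add: dfs_body_def push_dfs_def)
    have rw: "rw s' = r"
      using rw_agree[OF ag] s(2) by (simp add: dfs_body_def push_dfs_def)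
    have arr: "s' ''m'' 0 = m" "s' ''src'' = src" "s' ''dst'' = dst" "s' ''on'' = on"
      using h by (auto simp: has_arcs_def)
    have w: "s' ''q'' (s' ''b'' 0 + x) + s' ''y'' (src x) - s' ''y'' (dst x) = r x" for x
      using rw by (simp add: rw_def fun_eq_iff)
    show "\<exists>k'<k. I k' (result dfs_body s')"
    proof (cases "0 < s' ''sp'' 0")
      case False
      then have e: "s' ''e'' 0 < m" using b arr by simp
      note st = dfs_root[OF inv False e]
      show ?thesis
        using st False by (cases "s' ''lw'' (src (s' ''e'' 0)) < 1")
          (auto simp: I_def dfs_body_def push_dfs_def arr)
    next
      case sp: True
      let ?v = "s' ''st'' (s' ''sp'' 0)"
      show ?thesis
      proof (cases "0 < s' ''cu'' ?v")
        case True
        let ?x = "s' ''cu'' ?v - 1"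
        note st = dfs_edge[OF inv sp True]
        show ?thesis
          using st(1,2) sp True by (cases "r ?x < 1 \<and> s' ''lw'' (dst ?x) < 1")
            (auto simp: I_def dfs_body_def push_dfs_def arr wt_def w)
      next
        case False
        show ?thesis
          using dfs_finish[OF inv sp False] sp False
          by (auto simp: I_def dfs_body_def push_dfs_def arr)
      qed
    qed
  qed
  then show ?thesis
  proof (rule runs_agree_off[THEN runs_mono])
    show "Suc (Suc (step_bound dfs_body) * (4 * nat m)) \<le> 100 * nat m + 1"
      by (simp add: dfs_body_def push_dfs_def)
    fix s' assume a: "((\<exists>k. I k s') \<and> \<not> bval (Neg (Conj (Neg (pos (var ''sp''))) (Neg (Less (var ''e'') (var ''m''))))) s') \<and>
      agree_off (writes dfs_loop) s s'"
    then have ag: "agree_off (writes dfs_loop) s s'" by blast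
    have "has_arcs s'"
      by (rule has_arcs_agree[OF ag s(1)]) (simp add: dfs_loop_def dfs_body_def push_dfs_def)
    then show "postorder (s' ''lw'') (s' ''ps'') (s' ''od'') (s' ''c'' 0)"
    proof -
      obtain k rest where "dfs_inv k rest (s' ''e'' 0) (s' ''sp'' 0) (s' ''st'') (s' ''lw'')
        (s' ''cu'') (s' ''ps'') (s' ''od'') (s' ''c'' 0)" using a unfolding I_def by blast
      moreover have "s' ''m'' 0 = m" using \<open>has_arcs s'\<close> by (simp add: has_arcs_def)
      then have "\<not> 0 < s' ''sp'' 0" "\<not> s' ''e'' 0 < m" using a by auto
      ultimately show ?thesis by (rule dfs_done)
    qed
  qed
qed

lemma runs_scan_loop:
  assumes s: "has_arcs s" "rw s = r"
    and post: "postorder (s ''lw'') (s ''ps'') (s ''od'') (s ''c'' 0)"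
    and init: "\<forall>v\<in>T. s ''cm'' v = 0 \<and> s ''ci'' v = ih v" "s ''la'' 0 = 0"
      "s ''i'' 0 = s ''c'' 0 + 1" "s ''sp'' 0 = 0"
  shows "runs scan_loop s (200 * nat m + 100)
    (\<lambda>s'. levels (\<lambda>v. s' ''la'' (s' ''cm'' v)) (\<lambda>v. s' ''vi'' (s' ''cm'' v) - 1) \<and> s' ''la'' 0 = 0)"
proof -
  define I where "I = (\<lambda>k s'. \<exists>rest. scan_inv k rest (s' ''i'' 0) (s' ''sp'' 0) (s' ''st'') (s' ''cm'')
    (s' ''ci'') (s' ''la'') (s' ''vi'') (s ''lw'') (s ''ps'') (s ''od'') (s ''c'' 0))"
  let ?b = "Neg (Conj (Neg (pos (var ''sp''))) (Neg (Less (Const 1) (var ''i''))))"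
  obtain k0 where k0: "k0 \<le> 6 * nat m + 2" "I k0 s"
    using scan_init[where la = "s ''la''" and vi = "s ''vi''" and st = "s ''st''", OF post init(1,2)] init(3,4)
    unfolding I_def by auto
  have "runs scan_loop s (Suc (Suc (step_bound scan_body) * k0)) (\<lambda>s'. (\<exists>k. I k s') \<and> \<not> bval ?b s')"
    unfolding scan_loop_def
  proof (rule runs_While_straight)
    show "straight scan_body" by (simp add: scan_body_def push_scan_def)
    show "I k0 s" by fact
    fix k s' assume "I k s'" and ag: "agree_off (writes scan_body) s s'" and b: "bval ?b s'"
    then obtain rest where inv: "scan_inv k rest (s' ''i'' 0) (s' ''sp'' 0) (s' ''st'') (s' ''cm'')
      (s' ''ci'') (s' ''la'') (s' ''vi'') (s ''lw'') (s ''ps'') (s ''od'') (s ''c'' 0)" unfolding I_def by blast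
    have h: "has_arcs s'" by (rule has_arcs_agree[OF ag s(1)]) (simp add: scan_body_def push_scan_def)
    have rw: "rw s' = r"
      using rw_agree[OF ag] s(2) by (simp add: scan_body_def push_scan_def)
    have arr: "s' ''src'' = src" "s' ''dst'' = dst" "s' ''in'' = inx"
      using h by (auto simp: has_arcs_def)
    have od: "s' ''od'' = s ''od''"
      using agree_offD[OF ag, of "''od''"] by (simp add: scan_body_def push_scan_def)
    have w: "s' ''q'' (s' ''b'' 0 + x) + s' ''y'' (src x) - s' ''y'' (dst x) = r x" for x
      using rw by (simp add: rw_def fun_eq_iff)
    show "\<exists>k'<k. I k' (result scan_body s')"
    proof (cases "0 < s' ''sp'' 0")
      case False
      then have e: "1 < s' ''i'' 0" using b by simp
      note st = scan_root[OF post inv False e]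
      show ?thesis
        using st False by (cases "s' ''cm'' (s ''od'' (s' ''i'' 0 - 1)) < 1")
          (auto simp: I_def scan_body_def push_scan_def od)
    next
      case sp: True
      let ?v = "s' ''st'' (s' ''sp'' 0)"
      show ?thesis
      proof (cases "0 < s' ''ci'' ?v")
        case True
        let ?x = "s' ''ci'' ?v - 1"
        note st = scan_edge[OF post inv sp True]
        consider (a) "r ?x < 1" "s' ''cm'' (src ?x) < 1"
          | (b) "\<not> s' ''cm'' (src ?x) < 1" "r ?x < 0" "s' ''la'' (s' ''i'' 0) < s' ''la'' (s' ''cm'' (src ?x)) + 1"
          | (c) "\<not> s' ''cm'' (src ?x) < 1" "r ?x < 1" "\<not> r ?x < 0" "s' ''la'' (s' ''i'' 0) < s' ''la'' (s' ''cm'' (src ?x))"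
          | (d) "\<not> r ?x < 1"
          | (e) "\<not> s' ''cm'' (src ?x) < 1" "r ?x < 0" "\<not> s' ''la'' (s' ''i'' 0) < s' ''la'' (s' ''cm'' (src ?x)) + 1"
          | (f) "\<not> s' ''cm'' (src ?x) < 1" "r ?x < 1" "\<not> r ?x < 0" "\<not> s' ''la'' (s' ''i'' 0) < s' ''la'' (s' ''cm'' (src ?x))"
          by fastforce
        then show ?thesis
        proof cases
          case a
          from st(1)[OF a] show ?thesis
            using a sp True by (auto simp: I_def scan_body_def push_scan_def arr wt_def w)
        next
          case b
          from st(2)[OF b] show ?thesis
            using b sp True by (auto simp: I_def scan_body_def push_scan_def arr wt_def w)
        next
          case c
          from st(3)[OF c] show ?thesis
            using c sp True by (auto simp: I_def scan_body_def push_scan_def arr wt_def w)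
        next
          case d
          from st(4) d show ?thesis
            using sp True by (auto simp: I_def scan_body_def push_scan_def arr wt_def w)
        next
          case e
          from st(4) e show ?thesis
            using sp True by (auto simp: I_def scan_body_def push_scan_def arr wt_def w)
        next
          case f
          from st(4) f show ?thesis
            using sp True by (auto simp: I_def scan_body_def push_scan_def arr wt_def w)
        qed
      next
        case False
        show ?thesis
          using scan_pop[OF inv sp False] sp False
          by (auto simp: I_def scan_body_def push_scan_def)
      qed
    qed
  qed
  then show ?thesis
  proof (rule runs_mono)
    have "step_bound scan_body \<le> 30" by (simp add: scan_body_def push_scan_def)
    then have "Suc (step_bound scan_body) * k0 \<le> 31 * (6 * nat m + 2)" using k0 by (intro mult_mono) auto
    then show "Suc (Suc (step_bound scan_body) * k0) \<le> 200 * nat m + 100" by simp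
    fix s' assume "(\<exists>k. I k s') \<and> \<not> bval ?b s'"
    then show "levels (\<lambda>v. s' ''la'' (s' ''cm'' v)) (\<lambda>v. s' ''vi'' (s' ''cm'' v) - 1) \<and> s' ''la'' 0 = 0"
      unfolding I_def using scan_done[OF post] scan_invD(5) by auto
  qed
qed

end

context arcs
begin

lemma triple_set_vertices:
  assumes "\<And>s. A s \<Longrightarrow> has_arcs s"
    and "\<And>s x s'. A s \<Longrightarrow> agree_off {a, ''e''} s s' \<Longrightarrow> aval (f x) s' = F s (aval x s')"
    and "a \<notin> {''e'', ''m'', ''src'', ''dst''}"
    and "\<And>s s'. A s \<Longrightarrow> agree_off {a, ''e''} s s' \<Longrightarrow> s' a = (\<lambda>v. if v \<in> T then F s v else s a v) \<Longrightarrow> Q s'"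
  shows "triple A (for_vertices (\<lambda>x. Put a x (f x))) (8 * nat m + 2) Q"
proof (rule tripleI)
  fix s assume s: "A s"
  show "runs (for_vertices (\<lambda>x. Put a x (f x))) s (8 * nat m + 2) Q"
    by (rule runs_set_vertices[OF assms(1)[OF s] _ assms(3), THEN runs_mono])
      (use assms(2,4) s in auto)
qed

end

context weighted
begin

lemma levels_cong: "levels lv via \<Longrightarrow> \<forall>v\<in>T. lv' v = lv v \<Longrightarrow> levels lv' via"
  by (simp add: levels_def)

definition base :: "store \<Rightarrow> bool" where
  "base s \<longleftrightarrow> has_arcs s \<and> rw s = r \<and> s ''la'' 0 = 0"

lemma base_agree:
  assumes "base s" "agree_off X s s'"
    "X \<inter> {''m'', ''src'', ''dst'', ''oh'', ''on'', ''ih'', ''in'', ''q'', ''b'', ''y'', ''la''} = {}"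
  shows "base s'"
proof -
  have "has_arcs s'" by (rule has_arcs_agree[OF assms(2)]) (use assms(1,3) in \<open>auto simp: base_def\<close>)
  moreover have "rw s' = r" using rw_agree[OF assms(2)] assms(1,3) by (auto simp: base_def)
  moreover have "s' ''la'' = s ''la''" by (rule agree_offD[OF assms(2)]) (use assms(3) in auto)
  ultimately show ?thesis using assms(1) by (simp add: base_def)
qed

lemma base_heads: "base s \<Longrightarrow> s ''oh'' = oh" "base s \<Longrightarrow> s ''ih'' = ih"
  by (simp_all add: base_def has_arcs_def)

lemma base_assign: 
  assumes "base s" "a \<notin> {''m'', ''src'', ''dst'', ''oh'', ''on'', ''ih'', ''in'', ''q'', ''b'', ''y'', ''la''}"
  shows "base (s(a := f))"
  by (rule base_agree[OF assms(1), of "{a}"]) (use assms(2) in \<open>auto simp: agree_off_def\<close>)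

definition levels_state :: "store \<Rightarrow> bool" where
  "levels_state s \<longleftrightarrow> base s \<and> levels (s ''lv'') (\<lambda>v. s ''vi'' (s ''cm'' v) - 1)"

lemma triple_levels: "triple base levels_prog (500 * nat m + 200) levels_state"
proof -
  define Q1 where "Q1 = (\<lambda>s. base s \<and> (\<forall>v\<in>T. s ''lw'' v = 0))"
  define Q2 where "Q2 = (\<lambda>s. Q1 s \<and> (\<forall>v\<in>T. s ''ps'' v = 0))"
  define Q3 where "Q3 = (\<lambda>s. Q2 s \<and> (\<forall>v\<in>T. s ''cu'' v = oh v))"
  define Q4 where "Q4 = (\<lambda>s. Q3 s \<and> (\<forall>v\<in>T. s ''cm'' v = 0))"
  define Q5 where "Q5 = (\<lambda>s. Q4 s \<and> (\<forall>v\<in>T. s ''ci'' v = ih v))"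
  define Q6 where "Q6 = (\<lambda>s. Q5 s \<and> s ''e'' 0 = 0 \<and> s ''sp'' 0 = 0 \<and> s ''c'' 0 = 0)"
  define Q7 where "Q7 = (\<lambda>s. base s \<and> (\<forall>v\<in>T. s ''cm'' v = 0 \<and> s ''ci'' v = ih v) \<and>
    postorder (s ''lw'') (s ''ps'') (s ''od'') (s ''c'' 0))"
  define Q8 where "Q8 = (\<lambda>s. Q7 s \<and> s ''i'' 0 = s ''c'' 0 + 1 \<and> s ''sp'' 0 = 0)"
  define Q9 where "Q9 = (\<lambda>s. base s \<and> levels (\<lambda>v. s ''la'' (s ''cm'' v)) (\<lambda>v. s ''vi'' (s ''cm'' v) - 1))"
  note defs = Q1_def Q2_def Q3_def Q4_def Q5_def
  let ?start = "assign ''e'' (Const 0) ;; assign ''sp'' (Const 0) ;; assign ''c'' (Const 0)"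
  let ?next = "assign ''i'' (plus1 (var ''c'')) ;; assign ''sp'' (Const 0)"
  have arcs: "has_arcs s" if "base s" for s using that by (simp add: base_def)
  have "triple base (for_vertices (\<lambda>x. Put ''lw'' x (Const 0))) (8 * nat m + 2) Q1"
    by (rule triple_set_vertices[where F = "\<lambda>s v. 0"])
      (auto simp: Q1_def arcs elim: base_agree)
  also have "triple Q1 (for_vertices (\<lambda>x. Put ''ps'' x (Const 0))) (8 * nat m + 2) Q2"
    by (rule triple_set_vertices[where F = "\<lambda>s v. 0"])
      (auto simp: defs arcs agree_offD elim: base_agree)
  also have "triple Q2 (for_vertices (\<lambda>x. Put ''cu'' x (Get ''oh'' x))) (8 * nat m + 2) Q3"
    by (rule triple_set_vertices[where F = "\<lambda>s v. oh v"])
      (auto simp: defs arcs base_heads agree_offD elim: base_agree)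
  also have "triple Q3 (for_vertices (\<lambda>x. Put ''cm'' x (Const 0))) (8 * nat m + 2) Q4"
    by (rule triple_set_vertices[where F = "\<lambda>s v. 0"])
      (auto simp: defs arcs agree_offD elim: base_agree)
  also have "triple Q4 (for_vertices (\<lambda>x. Put ''ci'' x (Get ''ih'' x))) (8 * nat m + 2) Q5"
    by (rule triple_set_vertices[where F = "\<lambda>s v. ih v"])
      (auto simp: defs arcs base_heads agree_offD elim: base_agree)
  also have "triple Q5 ?start (step_bound ?start) Q6"
    by (rule triple_straight) (auto simp: Q6_def defs base_assign)
  also have "triple Q6 dfs_loop (100 * nat m + 1) Q7"
  proof (rule tripleI)
    fix s assume s: "Q6 s"
    have "runs dfs_loop s (100 * nat m + 1) (\<lambda>s'. postorder (s' ''lw'') (s' ''ps'') (s' ''od'') (s' ''c'' 0))"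
      by (rule runs_dfs_loop) (use s in \<open>auto simp: Q6_def defs base_def\<close>)
    then show "runs dfs_loop s (100 * nat m + 1) Q7"
    proof (rule runs_agree_off[THEN runs_mono])
      fix s' assume a: "postorder (s' ''lw'') (s' ''ps'') (s' ''od'') (s' ''c'' 0) \<and>
        agree_off (writes dfs_loop) s s'"
      have "base s'" using base_agree[of s "writes dfs_loop" s'] a s
        by (auto simp: Q6_def defs dfs_loop_def dfs_body_def push_dfs_def)
      moreover have "s' ''cm'' = s ''cm''" "s' ''ci'' = s ''ci''"
        using a by (auto intro!: agree_offD simp: dfs_loop_def dfs_body_def push_dfs_def)
      ultimately show "Q7 s'" using a s by (auto simp: Q7_def Q6_def defs)
    qed simp
  qed
  also have "triple Q7 ?next (step_bound ?next) Q8"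
    by (rule triple_straight) (auto simp: Q8_def Q7_def base_assign)
  also have "triple Q8 scan_loop (200 * nat m + 100) Q9"
  proof (rule tripleI)
    fix s assume s: "Q8 s"
    have "runs scan_loop s (200 * nat m + 100)
      (\<lambda>s'. levels (\<lambda>v. s' ''la'' (s' ''cm'' v)) (\<lambda>v. s' ''vi'' (s' ''cm'' v) - 1) \<and> s' ''la'' 0 = 0)"
      by (rule runs_scan_loop) (use s in \<open>auto simp: Q8_def Q7_def base_def\<close>)
    then show "runs scan_loop s (200 * nat m + 100) Q9"
    proof (rule runs_agree_off[THEN runs_mono])
      fix s' assume a: "(levels (\<lambda>v. s' ''la'' (s' ''cm'' v)) (\<lambda>v. s' ''vi'' (s' ''cm'' v) - 1) \<and> s' ''la'' 0 = 0) \<and>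
        agree_off (writes scan_loop) s s'"
      then have ag: "agree_off (writes scan_loop) s s'" by blast
      have "has_arcs s'"
        by (rule has_arcs_agree[OF ag]) (use s in \<open>auto simp: Q8_def Q7_def base_def scan_loop_def scan_body_def push_scan_def\<close>)
      moreover have "rw s' = r" using rw_agree[OF ag] s
        by (auto simp: Q8_def Q7_def base_def scan_loop_def scan_body_def push_scan_def)
      ultimately show "Q9 s'" using a by (auto simp: Q9_def base_def)
    qed simp
  qed
  also have "triple Q9 (for_vertices (\<lambda>x. Put ''lv'' x (Get ''la'' (Get ''cm'' x)))) (8 * nat m + 2) levels_state"
    by (rule triple_set_vertices[where F = "\<lambda>s v. s ''la'' (s ''cm'' v)"])
      (auto simp: Q9_def arcs agree_offD levels_state_def elim: base_agree levels_cong)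
  finally have "triple base levels_prog (8 * nat m + 2 + (8 * nat m + 2) + (8 * nat m + 2) + (8 * nat m + 2) + (8 * nat m + 2) +
      step_bound ?start + (100 * nat m + 1) + step_bound ?next + (200 * nat m + 100) + (8 * nat m + 2)) levels_state"
    unfolding levels_prog_def .
  then show ?thesis unfolding triple_def by (auto elim!: runs_mono)
qed

section \<open>Counting the heads of negative edges by level\<close>

text \<open>\<open>be\<close> and \<open>bj\<close> are size and number of a fullest level,
  \<open>t\<close> is the highest level with a head and \<open>te\<close> the end of a chain leading
  there: the data of the two possible repairs. \<open>ct\<close> is described only at levels of edge
  heads, which are the cells that the program clears.\<close>

definition count_ok where
  "count_ok N lv via mk ct be bj t te \<longleftrightarrow>
     (\<forall>v\<in>T. mk v = (if v \<in> N then 1 else 0 :: int)) \<and>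
     (\<forall>x\<in>E. ct (lv (dst x)) = int (card {w \<in> N. lv w = lv (dst x)})) \<and>
     0 \<le> be \<and> (\<forall>v\<in>N. int (card {w \<in> N. lv w = lv v}) \<le> be) \<and>
     (0 < be \<longrightarrow> (\<exists>v\<in>N. lv v = bj) \<and> int (card {w \<in> N. lv w = bj}) = be) \<and>
     0 \<le> t \<and> (\<forall>v\<in>N. lv v \<le> (t :: int)) \<and> (0 < t \<longrightarrow> (\<exists>v\<in>N. lv v = t \<and> te = via v))"

definition count_inv where
  "count_inv lv via i = count_ok (dst ` {x \<in> {0..<i}. r x < 0}) lv via"

lemma count_step:
  assumes lv: "levels lv via" and inv: "count_inv lv via i mk ct be bj t te" and i: "0 \<le> i" "i < m"
  defines "u \<equiv> dst i" and "j \<equiv> lv (dst i)"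
  shows "\<not> (r i < 0 \<and> mk u < 1) \<Longrightarrow> count_inv lv via (i + 1) mk ct be bj t te"
    and "r i < 0 \<Longrightarrow> mk u < 1 \<Longrightarrow> count_inv lv via (i + 1) (mk(u := 1)) (ct(j := ct j + 1))
      (if be < ct j + 1 then ct j + 1 else be) (if be < ct j + 1 then j else bj)
      (if t < j then j else t) (if t < j then via u else te)"
proof -
  define N where "N = dst ` {x \<in> {0..<i}. r x < 0}"
  define N' where "N' = dst ` {x \<in> {0..<i + 1}. r x < 0}"
  have iE: "i \<in> E" using i by (simp add: E_def)
  have ins: "{0..<i + 1} = insert i {0..<i}" using i by auto
  have I: "\<forall>v\<in>T. mk v = (if v \<in> N then 1 else 0)"
     "\<forall>x\<in>E. ct (lv (dst x)) = int (card {w \<in> N. lv w = lv (dst x)})"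
     "0 \<le> be" "\<forall>v\<in>N. int (card {w \<in> N. lv w = lv v}) \<le> be"
     "0 < be \<longrightarrow> (\<exists>v\<in>N. lv v = bj) \<and> int (card {w \<in> N. lv w = bj}) = be"
     "0 \<le> t" "\<forall>v\<in>N. lv v \<le> t" "0 < t \<longrightarrow> (\<exists>v\<in>N. lv v = t \<and> te = via v)"
    using inv unfolding count_inv_def N_def[symmetric] count_ok_def by simp_all
  {
    assume "\<not> (r i < 0 \<and> mk u < 1)"
    then have "N' = N" using I(1) iE ins unfolding N_def N'_def u_def by (auto split: if_splits)
    then show "count_inv lv via (i + 1) mk ct be bj t te"
      using inv unfolding count_inv_def N_def N'_def by simp
  next
    assume a: "r i < 0" "mk u < 1"
    have N': "N' = insert u N" using ins a(1) unfolding N_def N'_def u_def by auto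
    have uN: "u \<notin> N" using I(1) a(2) iE by (auto simp: u_def split: if_splits)
    have fin: "finite N"
      unfolding N_def by (rule finite_imageI, rule finite_subset[of _ "{0..<i}"]) auto
    have card: "card {w \<in> N'. lv w = l} = (if l = j then Suc (card {w \<in> N. lv w = l}) else card {w \<in> N. lv w = l})" for l
    proof (cases "l = j")
      case True
      then have "{w \<in> N'. lv w = l} = insert u {w \<in> N. lv w = l}" using N' by (auto simp: j_def u_def)
      then show ?thesis using uN fin True by simp
    next
      case False
      then have "{w \<in> N'. lv w = l} = {w \<in> N. lv w = l}" using N' by (auto simp: j_def u_def)
      then show ?thesis using False by simp
    qed
    have ctj: "ct j = int (card {w \<in> N. lv w = j})" using I(2) iE by (simp add: j_def)
    have j1: "1 \<le> j" using level_head[OF lv, of u] iE a(1) by (auto simp: heads_def j_def u_def)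
    have cle: "int (card {w \<in> N. lv w = l}) \<le> be" for l
    proof (cases "\<exists>v\<in>N. lv v = l")
      case False
      then have e: "{w \<in> N. lv w = l} = {}" by blast
      show ?thesis unfolding e using I(3) by simp
    qed (use I(4) in blast)
    show "count_inv lv via (i + 1) (mk(u := 1)) (ct(j := ct j + 1))
      (if be < ct j + 1 then ct j + 1 else be) (if be < ct j + 1 then j else bj)
      (if t < j then j else t) (if t < j then via u else te)"
      unfolding count_inv_def N'_def[symmetric] count_ok_def
    proof -
      show "(\<forall>v\<in>T. (mk(u := 1)) v = (if v \<in> N' then 1 else 0)) \<and>
       (\<forall>x\<in>E. (ct(j := ct j + 1)) (lv (dst x)) = int (card {w \<in> N'. lv w = lv (dst x)})) \<and>
       0 \<le> (if be < ct j + 1 then ct j + 1 else be) \<and>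
       (\<forall>v\<in>N'. int (card {w \<in> N'. lv w = lv v}) \<le> (if be < ct j + 1 then ct j + 1 else be)) \<and>
       (0 < (if be < ct j + 1 then ct j + 1 else be) \<longrightarrow>
         (\<exists>v\<in>N'. lv v = (if be < ct j + 1 then j else bj)) \<and>
         int (card {w \<in> N'. lv w = (if be < ct j + 1 then j else bj)}) = (if be < ct j + 1 then ct j + 1 else be)) \<and>
       0 \<le> (if t < j then j else t) \<and> (\<forall>v\<in>N'. lv v \<le> (if t < j then j else t)) \<and>
       (0 < (if t < j then j else t) \<longrightarrow>
         (\<exists>v\<in>N'. lv v = (if t < j then j else t) \<and> (if t < j then via u else te) = via v))"
      proof (intro conjI)
        show "\<forall>v\<in>T. (mk(u := 1)) v = (if v \<in> N' then 1 else 0)" using I(1) N' by auto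
        show "\<forall>x\<in>E. (ct(j := ct j + 1)) (lv (dst x)) = int (card {w \<in> N'. lv w = lv (dst x)})"
          using I(2) card ctj by auto
        show "0 \<le> (if be < ct j + 1 then ct j + 1 else be)" using I(3) by auto
        show "\<forall>v\<in>N'. int (card {w \<in> N'. lv w = lv v}) \<le> (if be < ct j + 1 then ct j + 1 else be)"
        proof
          fix v
          show "int (card {w \<in> N'. lv w = lv v}) \<le> (if be < ct j + 1 then ct j + 1 else be)"
            using cle[of "lv v"] card[of "lv v"] ctj by auto
        qed
        have uj: "lv u = j" by (simp add: j_def u_def)
        show "0 < (if be < ct j + 1 then ct j + 1 else be) \<longrightarrow>
         (\<exists>v\<in>N'. lv v = (if be < ct j + 1 then j else bj)) \<and>
         int (card {w \<in> N'. lv w = (if be < ct j + 1 then j else bj)}) = (if be < ct j + 1 then ct j + 1 else be)"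
        proof (cases "be < ct j + 1")
          case True
          then show ?thesis using N' card[of j] ctj uj by auto
        next
          case False
          \<comment> \<open>If \<open>bj\<close> were \<open>j\<close>, the increased count of
            \<open>j\<close> would exceed \<open>be\<close>; hence the count of the recorded level
            does not change.\<close>
          have "bj \<noteq> j" if "0 < be" using that I(5) False ctj by auto
          then show ?thesis using False I(5) N' card[of bj] by auto
        qed
        show "0 \<le> (if t < j then j else t)" using I(6) by simp
        show "\<forall>v\<in>N'. lv v \<le> (if t < j then j else t)" using I(7) N' uj by fastforce
        show "0 < (if t < j then j else t) \<longrightarrow>
         (\<exists>v\<in>N'. lv v = (if t < j then j else t) \<and> (if t < j then via u else te) = via v)"
          using I(8) N' uj by auto
      qed
    qed
  }
qed

lemma count_done:
  assumes lv: "levels lv via" and inv: "count_inv lv via m mk ct be bj t te"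
  shows "0 \<le> be" "be < 1 \<Longrightarrow> heads r = {}"
    and "\<not> be < 1 \<Longrightarrow> 1 \<le> bj \<and> int (card {w \<in> heads r. lv w = bj}) = be \<and> 1 \<le> t \<and>
      (\<exists>v\<in>heads r. lv v = t \<and> te = via v) \<and> int (card (heads r)) \<le> be * t"
proof -
  define N where "N = heads r"
  have "{x \<in> {0..<m}. r x < 0} = {x \<in> E. r x < 0}" by (auto simp: E_def)
  then have N: "N = dst ` {x \<in> {0..<m}. r x < 0}" by (simp add: N_def heads_def)
  have I: "0 \<le> be" "\<forall>v\<in>N. int (card {w \<in> N. lv w = lv v}) \<le> be"
     "0 < be \<longrightarrow> (\<exists>v\<in>N. lv v = bj) \<and> int (card {w \<in> N. lv w = bj}) = be"
     "0 \<le> t" "\<forall>v\<in>N. lv v \<le> t" "0 < t \<longrightarrow> (\<exists>v\<in>N. lv v = t \<and> te = via v)"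
    using inv unfolding count_inv_def N[symmetric] count_ok_def by simp_all
  have fin: "finite N" by (simp add: N_def)
  have pos: "1 \<le> lv v" if "v \<in> N" for v using that level_head[OF lv] by (simp add: N_def)
  show "0 \<le> be" by fact
  {
    assume "be < 1"
    show "heads r = {}"
    proof (rule ccontr)
      assume "heads r \<noteq> {}"
      then obtain v where v: "v \<in> N" by (auto simp: N_def)
      then have "{w \<in> N. lv w = lv v} \<noteq> {}" by blast
      then have "0 < card {w \<in> N. lv w = lv v}" using fin by (simp add: card_gt_0_iff)
      then show False using I(2) v \<open>be < 1\<close> by fastforce
    qed
  next
    assume "\<not> be < 1"
    then have b: "\<exists>v\<in>N. lv v = bj" "int (card {w \<in> N. lv w = bj}) = be" using I(3) by auto
    then obtain v where v: "v \<in> N" "lv v = bj" by blast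
    then have "1 \<le> bj" "1 \<le> t" using pos[of v] I(5) by force+
    moreover have "int (card N) \<le> be * t"
      using card_le_classes[OF fin, of lv t be] I pos v by auto
    ultimately show "1 \<le> bj \<and> int (card {w \<in> heads r. lv w = bj}) = be \<and> 1 \<le> t \<and>
      (\<exists>v\<in>heads r. lv v = t \<and> te = via v) \<and> int (card (heads r)) \<le> be * t"
      using b I(6) unfolding N_def by auto
  }
qed

end

section \<open>Programs for counting, and their correctness\<close>

definition count_body :: com where
  "count_body = (assign ''u'' (Get ''dst'' (var ''e'')) ;;
     Cond (Conj (Less (wt (var ''e'')) (Const 0)) (Less (Get ''mk'' (var ''u'')) (Const 1)))
       (Put ''mk'' (var ''u'') (Const 1) ;; assign ''j'' (Get ''lv'' (var ''u'')) ;;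
        Put ''ct'' (var ''j'') (plus1 (Get ''ct'' (var ''j''))) ;;
        Cond (Less (var ''be'') (Get ''ct'' (var ''j'')))
          (assign ''be'' (Get ''ct'' (var ''j'')) ;; assign ''bj'' (var ''j'')) Skip ;;
        Cond (Less (var ''t'') (var ''j''))
          (assign ''t'' (var ''j'') ;; assign ''te'' (minus1 (Get ''vi'' (Get ''cm'' (var ''u''))))) Skip)
       Skip)"

definition count_prog :: com where
  "count_prog =
     (for_edges (Put ''ct'' (Get ''lv'' (Get ''dst'' (var ''e''))) (Const 0)) ;;
      for_vertices (\<lambda>x. Put ''mk'' x (Const 0)) ;;
      (assign ''be'' (Const 0) ;; assign ''t'' (Const 0)) ;;
      for_edges count_body)"

context weighted
begin

definition counted :: "store \<Rightarrow> bool" where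
  "counted s \<longleftrightarrow> levels_state s \<and> (\<exists>mk ct. count_inv (s ''lv'') (\<lambda>v. s ''vi'' (s ''cm'' v) - 1) m mk ct
     (s ''be'' 0) (s ''bj'' 0) (s ''t'' 0) (s ''te'' 0))"

lemma levels_state_agree:
  assumes "levels_state s" "agree_off X s s'"
    "X \<inter> {''m'', ''src'', ''dst'', ''oh'', ''on'', ''ih'', ''in'', ''q'', ''b'', ''y'', ''la'', ''lv'', ''vi'', ''cm''} = {}"
  shows "levels_state s'"
proof -
  have "base s'" using base_agree[of s X s'] assms by (auto simp: levels_state_def)
  moreover have "s' ''lv'' = s ''lv''" "s' ''vi'' = s ''vi''" "s' ''cm'' = s ''cm''"
    using assms(3) by (auto intro!: agree_offD[OF assms(2)])
  ultimately show ?thesis using assms(1) by (simp add: levels_state_def)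
qed

lemma triple_count: "triple levels_state count_prog (40 * nat m + 20) counted"
proof -
  define Q1 where "Q1 = (\<lambda>s. levels_state s \<and> (\<forall>x\<in>E. s ''ct'' (s ''lv'' (dst x)) = 0))"
  define Q2 where "Q2 = (\<lambda>s. Q1 s \<and> (\<forall>v\<in>T. s ''mk'' v = 0))"
  define Q3 where "Q3 = (\<lambda>s. Q2 s \<and> s ''be'' 0 = 0 \<and> s ''t'' 0 = 0)"
  let ?start = "assign ''be'' (Const 0) ;; assign ''t'' (Const 0)"
  have arcs: "has_arcs s" if "levels_state s" for s using that by (simp add: levels_state_def base_def)
  have set: "levels_state (s(a := f))" if "levels_state s"
    "a \<notin> {''m'', ''src'', ''dst'', ''oh'', ''on'', ''ih'', ''in'', ''q'', ''b'', ''y'', ''la'', ''lv'', ''vi'', ''cm''}" for s a f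
    by (rule levels_state_agree[OF that(1), of "{a}"]) (use that(2) in \<open>auto simp: agree_off_def\<close>)
  have "triple levels_state (for_edges (Put ''ct'' (Get ''lv'' (Get ''dst'' (var ''e''))) (Const 0))) (3 * nat m + 2) Q1"
  proof (rule tripleI)
    fix s assume s: "levels_state s"
    define I where "I = (\<lambda>i s'. agree_off {''e'', ''ct''} s s' \<and> (\<forall>x\<in>{0..<i}. s' ''ct'' (s ''lv'' (dst x)) = 0))"
    let ?p = "Put ''ct'' (Get ''lv'' (Get ''dst'' (var ''e''))) (Const 0)"
    have "runs (for_edges ?p) s ((step_bound ?p + 2) * nat m + 2) (I m)"
    proof (rule runs_for_edges)
      show "straight ?p" "''e'' \<notin> writes ?p" "''m'' \<notin> writes ?p" by auto
      show "s ''m'' 0 = m" "0 \<le> m" using arcs[OF s] m_nonneg by (auto simp: has_arcs_def)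
      show "I 0 (s(''e'' := (s ''e'')(0 := 0)))" by (simp add: I_def agree_off_def)
      fix i s' assume I: "I i s'" and i: "0 \<le> i" "i < m" "s' ''e'' 0 = i"
      have ag: "agree_off {''e'', ''ct''} s s'" using I by (simp add: I_def)
      have sd: "s' ''dst'' = dst" "s' ''lv'' = s ''lv''"
        using agree_offD[OF ag] arcs[OF s] by (auto simp: has_arcs_def)
      have "{0..<i + 1} = insert i {0..<i}" using i by auto
      then show "I (i + 1) (result (?p ;; assign ''e'' (plus1 (var ''e''))) s')"
        using I i sd unfolding I_def by (auto simp: agree_off_def)
    qed
    then show "runs (for_edges ?p) s (3 * nat m + 2) Q1"
    proof (rule runs_mono)
      fix s' assume I: "I m s'"
      then have ag: "agree_off {''e'', ''ct''} s s'" by (simp add: I_def)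
      have "levels_state s'" by (rule levels_state_agree[OF s ag]) auto
      moreover have "s' ''lv'' = s ''lv''" by (rule agree_offD[OF ag]) auto
      ultimately show "Q1 s'" using I by (auto simp: Q1_def I_def E_def)
    qed simp
  qed
  also have "triple Q1 (for_vertices (\<lambda>x. Put ''mk'' x (Const 0))) (8 * nat m + 2) Q2"
  proof (rule triple_set_vertices[where F = "\<lambda>s v. 0"])
    fix s s' assume "Q1 s" and ag: "agree_off {''mk'', ''e''} s s'" "s' ''mk'' = (\<lambda>v. if v \<in> T then 0 else s ''mk'' v)"
    then show "Q2 s'" using levels_state_agree[OF _ ag(1)] agree_offD[OF ag(1)]
      by (auto simp: Q2_def Q1_def)
  qed (auto simp: Q1_def arcs)
  also have "triple Q2 ?start (step_bound ?start) Q3"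
    by (rule triple_straight) (auto simp: Q1_def Q2_def Q3_def set)
  also have "triple Q3 (for_edges count_body) (20 * nat m + 2) counted"
  proof (rule tripleI)
    fix s assume s: "Q3 s"
    have ls: "levels_state s" and lev: "levels (s ''lv'') (\<lambda>v. s ''vi'' (s ''cm'' v) - 1)"
      using s by (auto simp: Q1_def Q2_def Q3_def levels_state_def)
    let ?via = "\<lambda>v. s ''vi'' (s ''cm'' v) - 1"
    define I where "I = (\<lambda>i s'. count_inv (s ''lv'') ?via i (s' ''mk'') (s' ''ct'')
      (s' ''be'' 0) (s' ''bj'' 0) (s' ''t'' 0) (s' ''te'' 0))"
    have "runs (for_edges count_body) s ((step_bound count_body + 2) * nat m + 2) (I m)"
    proof (rule runs_for_edges)
      show "straight count_body" "''e'' \<notin> writes count_body" "''m'' \<notin> writes count_body"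
        by (auto simp: count_body_def)
      show "s ''m'' 0 = m" "0 \<le> m" using arcs[OF ls] m_nonneg by (auto simp: has_arcs_def)
      have empty: "dst ` {x \<in> {0..<0}. r x < 0} = {}" by simp
      show "I 0 (s(''e'' := (s ''e'')(0 := 0)))"
        unfolding I_def count_inv_def empty
        using s by (simp add: count_ok_def Q1_def Q2_def Q3_def)
      fix i s' assume I: "I i s'" and i: "0 \<le> i" "i < m" "s' ''e'' 0 = i"
        and ag: "agree_off (insert ''e'' (writes count_body)) s s'"
      have "levels_state s'" by (rule levels_state_agree[OF ls ag]) (auto simp: count_body_def)
      then have sd: "s' ''dst'' = dst" "s' ''src'' = src" and rw: "rw s' = r"
        by (auto simp: levels_state_def base_def has_arcs_def)
      have w: "s' ''q'' (s' ''b'' 0 + x) + s' ''y'' (src x) - s' ''y'' (dst x) = r x" for x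
        using rw by (simp add: rw_def fun_eq_iff)
      have eq: "s' ''lv'' = s ''lv''" "s' ''vi'' = s ''vi''" "s' ''cm'' = s ''cm''"
        using agree_offD[OF ag] by (auto simp: count_body_def)
      note st = count_step[OF lev I[unfolded I_def] i(1,2)]
      show "I (i + 1) (result (count_body ;; assign ''e'' (plus1 (var ''e''))) s')"
      proof (cases "r i < 0 \<and> s' ''mk'' (dst i) < 1")
        case False
        then show ?thesis using st(1) i(3) unfolding I_def by (auto simp: count_body_def sd wt_def w)
      next
        case True
        then show ?thesis using st(2) i(3) unfolding I_def
          by (cases "s' ''be'' 0 < s' ''ct'' (s ''lv'' (dst i)) + 1"; cases "s' ''t'' 0 < s ''lv'' (dst i)")
            (auto simp: count_body_def sd wt_def w eq)
      qed
    qed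
    then show "runs (for_edges count_body) s (20 * nat m + 2) counted"
    proof (rule runs_agree_off[THEN runs_mono])
      show "(step_bound count_body + 2) * nat m + 2 \<le> 20 * nat m + 2" by (simp add: count_body_def)
      fix s' assume a: "I m s' \<and> agree_off (writes (for_edges count_body)) s s'"
      then have ag: "agree_off (writes (for_edges count_body)) s s'" by blast
      have "levels_state s'" by (rule levels_state_agree[OF ls ag]) (auto simp: count_body_def for_edges_def)
      moreover have "s' ''lv'' = s ''lv''" "s' ''vi'' = s ''vi''" "s' ''cm'' = s ''cm''"
        using agree_offD[OF ag] by (auto simp: count_body_def for_edges_def)
      ultimately show "counted s'" using a unfolding counted_def I_def by auto
    qed
  qed
  finally have "triple levels_state count_prog (3 * nat m + 2 + (8 * nat m + 2) + step_bound ?start + (20 * nat m + 2)) counted"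
    unfolding count_prog_def .
  then show ?thesis unfolding triple_def by (auto elim!: runs_mono)
qed

end

section \<open>Lowering programs\<close>

text \<open>The detour through \<open>zz\<close> makes both passes repeatable; subtracting in place
  would lower a vertex once per edge end.\<close>

definition apply_prog :: com where
  "apply_prog = (for_vertices (\<lambda>x. Put ''zz'' x (Sub (Get ''y'' x) (Get ''d'' x))) ;;
     for_vertices (\<lambda>x. Put ''y'' x (Get ''zz'' x)))"

definition cut_prog :: "aexp \<Rightarrow> com" where
  "cut_prog j = (for_vertices (\<lambda>x. Cond (Less (Get ''lv'' x) j) (Put ''d'' x (Const 0)) (Put ''d'' x (Const 1))) ;;
     apply_prog)"

definition dial_body :: com where
  "dial_body = Cond (pos (var ''p''))
     (assign ''x'' (minus1 (var ''p'')) ;; assign ''p'' (Get ''on'' (var ''x'')) ;;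
      assign ''u'' (Get ''dst'' (var ''x'')) ;; assign ''z'' (wt (var ''x'')) ;;
      Cond (pos (var ''z'')) (assign ''z'' (Sub (var ''i'') (var ''z''))) (assign ''z'' (var ''i'')) ;;
      Cond (Conj (pos (var ''z'')) (Less (Get ''d'' (var ''u'')) (Const 1)))
        (Put ''lk'' (var ''x'') (Get ''bk'' (var ''z'')) ;; Put ''bk'' (var ''z'') (plus1 (var ''x'')))
        Skip)
     (Cond (pos (Get ''bk'' (var ''i'')))
       (assign ''x'' (minus1 (Get ''bk'' (var ''i''))) ;; Put ''bk'' (var ''i'') (Get ''lk'' (var ''x'')) ;;
        assign ''u'' (Get ''dst'' (var ''x'')) ;;
        Cond (Less (Get ''d'' (var ''u'')) (Const 1))
          (Put ''d'' (var ''u'') (var ''i'') ;; assign ''p'' (Get ''oh'' (var ''u''))) Skip)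
       (assign ''i'' (minus1 (var ''i'')) ;;
        Cond (pos (var ''i''))
          (assign ''u'' (Get ''dst'' (var ''ce'')) ;;
           assign ''ce'' (minus1 (Get ''vi'' (Get ''cm'' (Get ''src'' (var ''ce''))))) ;;
           Cond (Less (Get ''d'' (var ''u'')) (Const 1))
             (Put ''d'' (var ''u'') (var ''i'') ;; assign ''p'' (Get ''oh'' (var ''u''))) Skip)
          Skip))"

definition dial_loop :: com where
  "dial_loop = While (pos (var ''i'')) dial_body"

definition chain_prog :: com where
  "chain_prog = (for_vertices (\<lambda>x. Put ''d'' x (Const 0)) ;;
     (assign ''i'' (plus1 (var ''t'')) ;; assign ''ce'' (var ''te'') ;; assign ''p'' (Const 0)) ;; dial_loop ;; apply_prog)"

definition select_prog :: com where
  "select_prog = Cond (Less (var ''be'') (var ''t'')) chain_prog (cut_prog (var ''bj''))"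

text \<open>The levels are computed again because the repair has changed the lengths. The cut at
  level 1 that follows provides the decrease of the maximum of \<open>P\<close>.\<close>

definition unit_body :: com where
  "unit_body = (levels_prog ;; count_prog ;;
     Cond (Less (var ''be'') (Const 1))
       (assign ''g'' (Const 0))
       (select_prog ;; levels_prog ;; cut_prog (Const 1)))"

definition unit_prog :: com where
  "unit_prog = (assign ''g'' (Const 1) ;; While (pos (var ''g'')) unit_body)"

lemmas prog_defs = levels_prog_def dfs_loop_def dfs_body_def push_dfs_def scan_loop_def scan_body_def
  push_scan_def count_prog_def count_body_def apply_prog_def cut_prog_def dial_body_def dial_loop_def
  chain_prog_def select_prog_def unit_body_def for_vertices_def for_edges_def

context arcs
begin

lemma heads_cong: "\<forall>e\<in>E. r e = r' e \<Longrightarrow> heads r = heads r'"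
  unfolding heads_def by (metis (mono_tags, lifting) Collect_cong)

text \<open>Lengths read from memory agree with the intended ones only on \<open>E\<close>;
  elsewhere the cells hold arbitrary values.\<close>

lemma weighted_cong:
  assumes "weighted m src dst oh on ih inx outs ins r P" "\<forall>e\<in>E. r' e = r e"
  shows "weighted m src dst oh on ih inx outs ins r' P"
proof -
  interpret w: weighted m src dst oh on ih inx outs ins r P by fact
  show ?thesis using w.P_nonneg w.feasible assms(2) by unfold_locales auto
qed

lemma runs_apply:
  assumes s: "has_arcs s"
  shows "runs apply_prog s (16 * nat m + 4) (\<lambda>s'. agree_off {''e'', ''zz'', ''y''} s s' \<and>
    (\<forall>v\<in>T. s' ''y'' v = s ''y'' v - s ''d'' v) \<and> (\<forall>e\<in>E. rw s' e = shifted (rw s) (s ''d'') e))"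
proof -
  define Q where "Q = (\<lambda>s'. agree_off {''e'', ''zz''} s s' \<and> (\<forall>v\<in>T. s' ''zz'' v = s ''y'' v - s ''d'' v))"
  have "runs (for_vertices (\<lambda>x. Put ''zz'' x (Sub (Get ''y'' x) (Get ''d'' x)))) s (8 * nat m + 2) Q"
  proof (rule runs_set_vertices[OF s, where F = "\<lambda>v. s ''y'' v - s ''d'' v", THEN runs_mono])
    fix x s' assume ag: "agree_off {''zz'', ''e''} s s'"
    have "s' ''y'' = s ''y''" "s' ''d'' = s ''d''" by (rule agree_offD[OF ag]; simp)+
    then show "aval (Sub (Get ''y'' x) (Get ''d'' x)) s' = s ''y'' (aval x s') - s ''d'' (aval x s')" by simp
  qed (simp_all add: Q_def insert_commute)
  then have "runs apply_prog s (8 * nat m + 2 + (8 * nat m + 2)) (\<lambda>s'. agree_off {''e'', ''zz'', ''y''} s s' \<and>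
    (\<forall>v\<in>T. s' ''y'' v = s ''y'' v - s ''d'' v))"
    unfolding apply_prog_def
  proof (rule runs_Seq)
    fix s1 assume s1: "Q s1"
    then have ag: "agree_off {''e'', ''zz''} s s1" by (simp add: Q_def)
    have a1: "has_arcs s1" by (rule has_arcs_agree[OF ag s]) simp
    show "runs (for_vertices (\<lambda>x. Put ''y'' x (Get ''zz'' x))) s1 (8 * nat m + 2)
     (\<lambda>s'. agree_off {''e'', ''zz'', ''y''} s s' \<and> (\<forall>v\<in>T. s' ''y'' v = s ''y'' v - s ''d'' v))"
    proof (rule runs_set_vertices[OF a1, where F = "\<lambda>v. s1 ''zz'' v", THEN runs_mono])
      fix x s' assume ag: "agree_off {''y'', ''e''} s1 s'"
      have "s' ''zz'' = s1 ''zz''" by (rule agree_offD[OF ag]) simp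
      then show "aval (Get ''zz'' x) s' = s1 ''zz'' (aval x s')" by simp
    next
      fix s' assume h: "agree_off {''y'', ''e''} s1 s' \<and> s' ''y'' = (\<lambda>v. if v \<in> T then s1 ''zz'' v else s1 ''y'' v)"
      have "agree_off {''e'', ''zz'', ''y''} s s'"
        by (rule agree_off_trans[OF ag, of "{''y'', ''e''}"]) (use h in auto)
      then show "agree_off {''e'', ''zz'', ''y''} s s' \<and> (\<forall>v\<in>T. s' ''y'' v = s ''y'' v - s ''d'' v)"
        using h s1 by (simp add: Q_def)
    qed simp_all
  qed
  then show ?thesis
  proof (rule runs_mono)
    fix s' assume a: "agree_off {''e'', ''zz'', ''y''} s s' \<and> (\<forall>v\<in>T. s' ''y'' v = s ''y'' v - s ''d'' v)"
    then have ag: "agree_off {''e'', ''zz'', ''y''} s s'" by blast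
    have "s' ''q'' = s ''q''" "s' ''b'' = s ''b''" using agree_offD[OF ag] by auto
    then show "agree_off {''e'', ''zz'', ''y''} s s' \<and>
    (\<forall>v\<in>T. s' ''y'' v = s ''y'' v - s ''d'' v) \<and> (\<forall>e\<in>E. rw s' e = shifted (rw s) (s ''d'') e)"
      using a by (auto simp: rw_def shifted_def)
  qed simp
qed

definition lowered :: "store \<Rightarrow> (int \<Rightarrow> int) \<Rightarrow> store \<Rightarrow> bool" where
  "lowered s L s' \<longleftrightarrow> (\<forall>v\<in>T. s' ''y'' v = s ''y'' v - L v) \<and> (\<forall>e\<in>E. rw s' e = shifted (rw s) L e)"

end

context weighted
begin

lemma runs_cut:
  assumes s: "levels_state s" and j: "\<And>s'. agree_off {''d'', ''e''} s s' \<Longrightarrow> aval j s' = l"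
  shows "runs (cut_prog j) s (24 * nat m + 6) (lowered s (cut (s ''lv'') l))"
proof -
  have a: "has_arcs s" using s by (simp add: levels_state_def base_def)
  define Q where "Q = (\<lambda>s'. agree_off {''d'', ''e''} s s' \<and> (\<forall>v\<in>T. s' ''d'' v = cut (s ''lv'') l v))"
  have "runs (for_vertices (\<lambda>x. Cond (Less (Get ''lv'' x) j) (Put ''d'' x (Const 0)) (Put ''d'' x (Const 1))))
      s (8 * nat m + 2) Q"
  proof (rule runs_for_vertices[OF a, where F = "cut (s ''lv'') l", THEN runs_mono])
    fix x s' assume ag: "agree_off {''d'', ''e''} s s'"
    have "s' ''lv'' = s ''lv''" by (rule agree_offD[OF ag]) simp
    then show "result (Cond (Less (Get ''lv'' x) j) (Put ''d'' x (Const 0)) (Put ''d'' x (Const 1))) s' =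
      s'(''d'' := (s' ''d'')(aval x s' := cut (s ''lv'') l (aval x s')))"
      using j[OF ag] by (simp add: cut_def)
  qed (auto simp: Q_def)
  then have "runs (cut_prog j) s (8 * nat m + 2 + (16 * nat m + 4)) (lowered s (cut (s ''lv'') l))"
    unfolding cut_prog_def
  proof (rule runs_Seq)
    fix s1 assume s1: "Q s1"
    then have ag: "agree_off {''d'', ''e''} s s1" by (simp add: Q_def)
    have a1: "has_arcs s1" by (rule has_arcs_agree[OF ag a]) simp
    have rw: "rw s1 = rw s" by (rule rw_agree[OF ag]) simp
    have y: "s1 ''y'' = s ''y''" by (rule agree_offD[OF ag]) simp
    show "runs apply_prog s1 (16 * nat m + 4) (lowered s (cut (s ''lv'') l))"
      by (rule runs_apply[OF a1, THEN runs_mono])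
        (use s1 in \<open>auto simp: lowered_def rw y Q_def shifted_def\<close>)
  qed
  then show ?thesis by (rule runs_mono) auto
qed

end

context chained
begin

lemma runs_dial_loop:
  assumes s: "has_arcs s" "rw s = r" and via: "via = (\<lambda>v. s ''vi'' (s ''cm'' v) - 1)"
    and init: "\<forall>v\<in>T. s ''d'' v = 0" "\<forall>j. s ''bk'' j = 0" "s ''i'' 0 = t + 1" "s ''ce'' 0 = te" "s ''p'' 0 = 0"
  shows "runs dial_loop s (200 * nat m + 100) (\<lambda>s'. (\<forall>j. s' ''bk'' j = 0) \<and> good_lowering (s' ''d'') \<and>
    int (card (heads (shifted r (s' ''d'')))) + t \<le> int (card (heads r)))"
proof -
  define I where "I = (\<lambda>k s'. \<exists>pl bl. dial_inv k pl bl (s' ''i'' 0) (s' ''ce'' 0) (s' ''p'' 0)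
    (s' ''d'') (s' ''bk'') (s' ''lk''))"
  let ?k = "nat (t + 1) + 3 * nat m"
  have "runs dial_loop s (Suc (Suc (step_bound dial_body) * ?k))
    (\<lambda>s'. (\<exists>k. I k s') \<and> \<not> bval (pos (var ''i'')) s')"
    unfolding dial_loop_def
  proof (rule runs_While_straight)
    show "straight dial_body" by (simp add: dial_body_def)
    show "I ?k s" unfolding I_def using dial_init[OF init(1,2)] init(3-5) by auto
    fix k s' assume "I k s'" and ag: "agree_off (writes dial_body) s s'" and b: "bval (pos (var ''i'')) s'"
    then obtain pl bl where inv: "dial_inv k pl bl (s' ''i'' 0) (s' ''ce'' 0) (s' ''p'' 0)
      (s' ''d'') (s' ''bk'') (s' ''lk'')" unfolding I_def by blast
    have i: "0 < s' ''i'' 0" using b by simp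
    have h: "has_arcs s'" by (rule has_arcs_agree[OF ag s(1)]) (simp add: dial_body_def)
    have rw: "rw s' = r" using rw_agree[OF ag] s(2) by (simp add: dial_body_def)
    have arr: "s' ''src'' = src" "s' ''dst'' = dst" "s' ''on'' = on" "s' ''oh'' = oh"
      using h by (auto simp: has_arcs_def)
    have eq: "s' ''vi'' = s ''vi''" "s' ''cm'' = s ''cm''"
      using agree_offD[OF ag] by (auto simp: dial_body_def)
    have w: "s' ''q'' (s' ''b'' 0 + x) + s' ''y'' (src x) - s' ''y'' (dst x) = r x" for x
      using rw by (simp add: rw_def fun_eq_iff)
    show "\<exists>k'<k. I k' (result dial_body s')"
    proof (cases "0 < s' ''p'' 0")
      case p: True
      let ?x = "s' ''p'' 0 - 1"
      note st = dial_scan[OF inv i p]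
      show ?thesis
      proof (cases "0 < r ?x")
        case True
        then have mx: "max 0 (r ?x) = r ?x" by simp
        show ?thesis using st True p
          by (cases "0 < s' ''i'' 0 - r ?x \<and> s' ''d'' (dst ?x) < 1")
            (auto simp: I_def dial_body_def arr wt_def w mx)
      next
        case False
        then have mx: "max 0 (r ?x) = 0" by simp
        show ?thesis using st False p i
          by (cases "s' ''d'' (dst ?x) < 1") (auto simp: I_def dial_body_def arr wt_def w mx)
      qed
    next
      case p: False
      show ?thesis
      proof (cases "0 < s' ''bk'' (s' ''i'' 0)")
        case bk: True
        note st = dial_pop[OF inv i p bk]
        show ?thesis using st bk p
          by (cases "s' ''d'' (dst (s' ''bk'' (s' ''i'' 0) - 1)) < 1") (auto simp: I_def dial_body_def arr)
      next
        case bk: False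
        note st = dial_next[OF inv i p bk]
        show ?thesis
        proof (cases "0 < s' ''i'' 0 - 1")
          case False
          then show ?thesis using st(1)[OF False] bk p by (auto simp: I_def dial_body_def arr)
        next
          case True
          show ?thesis using st(2,3)[OF True] bk p True
            by (cases "s' ''d'' (dst (s' ''ce'' 0)) < 1") (auto simp: I_def dial_body_def arr via eq)
        qed
      qed
    qed
  qed
  then show ?thesis
  proof (rule runs_mono)
    have "step_bound dial_body \<le> 40" by (simp add: dial_body_def)
    moreover have "?k \<le> 4 * nat m + 1" using t_le_m t_pos by auto
    ultimately have "Suc (step_bound dial_body) * ?k \<le> 41 * (4 * nat m + 1)" by (intro mult_mono) auto
    then show "Suc (Suc (step_bound dial_body) * ?k) \<le> 200 * nat m + 100" by simp
    fix s' assume a: "(\<exists>k. I k s') \<and> \<not> bval (pos (var ''i'')) s'"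
    then obtain k pl bl where inv: "dial_inv k pl bl (s' ''i'' 0) (s' ''ce'' 0) (s' ''p'' 0)
      (s' ''d'') (s' ''bk'') (s' ''lk'')" unfolding I_def by blast
    have "\<not> 0 < s' ''i'' 0" using a by simp
    from dial_done[OF inv this] show "(\<forall>j. s' ''bk'' j = 0) \<and> good_lowering (s' ''d'') \<and>
      int (card (heads (shifted r (s' ''d'')))) + t \<le> int (card (heads r))" by blast
  qed
qed

end

context weighted
begin

lemma runs_chain:
  assumes s: "levels_state s" "\<forall>j. s ''bk'' j = 0" and r: "\<forall>e\<in>E. - 1 \<le> r e"
    and t: "1 \<le> s ''t'' 0"
    and te: "v \<in> heads r" "s ''lv'' v = s ''t'' 0" "s ''te'' 0 = s ''vi'' (s ''cm'' v) - 1"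
  shows "runs chain_prog s (250 * nat m + 150) (\<lambda>s'. (\<forall>j. s' ''bk'' j = 0) \<and>
    (\<exists>L. good_lowering L \<and> lowered s L s' \<and>
      int (card (heads (shifted r L))) + s ''t'' 0 \<le> int (card (heads r))))"
proof -
  define via where "via = (\<lambda>v. s ''vi'' (s ''cm'' v) - 1)"
  have lev: "levels (s ''lv'') via" and b: "base s" using s by (auto simp: levels_state_def via_def)
  have a: "has_arcs s" and rws: "rw s = r" using b by (auto simp: base_def)
  have "v \<in> T" using te(1) heads_subset_T by blast
  then have e: "s ''te'' 0 \<in> E" "r (s ''te'' 0) < 0" "s ''lv'' (src (s ''te'' 0)) = s ''t'' 0 - 1"
    using lev te t unfolding levels_def via_def by auto
  interpret c: chained m src dst oh on ih inx outs ins r P "s ''lv''" via "s ''te'' 0" "s ''t'' 0"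
    by unfold_locales (use lev r e t in auto)
  define Q1 where "Q1 = (\<lambda>s'. agree_off {''d'', ''e''} s s' \<and> (\<forall>v\<in>T. s' ''d'' v = 0))"
  define Q2 where "Q2 = (\<lambda>s'. agree_off {''d'', ''e'', ''i'', ''ce'', ''p''} s s' \<and> (\<forall>v\<in>T. s' ''d'' v = 0) \<and>
    s' ''i'' 0 = s ''t'' 0 + 1 \<and> s' ''ce'' 0 = s ''te'' 0 \<and> s' ''p'' 0 = 0)"
  define Q3 where "Q3 = (\<lambda>s'. has_arcs s' \<and> rw s' = r \<and> s' ''y'' = s ''y'' \<and> (\<forall>j. s' ''bk'' j = 0) \<and> good_lowering (s' ''d'') \<and>
    int (card (heads (shifted r (s' ''d'')))) + s ''t'' 0 \<le> int (card (heads r)))"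
  define Q4 where "Q4 = (\<lambda>s'. (\<forall>j. s' ''bk'' j = 0) \<and> (\<exists>L. good_lowering L \<and> lowered s L s' \<and>
      int (card (heads (shifted r L))) + s ''t'' 0 \<le> int (card (heads r))))"
  let ?start = "assign ''i'' (plus1 (var ''t'')) ;; assign ''ce'' (var ''te'') ;; assign ''p'' (Const 0)"
  have "triple (\<lambda>s'. s' = s) (for_vertices (\<lambda>x. Put ''d'' x (Const 0))) (8 * nat m + 2) Q1"
    by (rule triple_set_vertices[where F = "\<lambda>s v. 0"]) (auto simp: Q1_def a)
  also have "triple Q1 ?start (step_bound ?start) Q2"
    by (rule triple_straight) (auto simp: Q1_def Q2_def agree_off_def)
  also have "triple Q2 dial_loop (200 * nat m + 100) Q3"
  proof (rule tripleI)
    fix s1 assume s1: "Q2 s1"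
    then have ag: "agree_off {''d'', ''e'', ''i'', ''ce'', ''p''} s s1" by (simp add: Q2_def)
    have a1: "has_arcs s1" by (rule has_arcs_agree[OF ag a]) simp
    have rw1: "rw s1 = r" using rw_agree[OF ag] rws by simp
    have eq: "s1 ''vi'' = s ''vi''" "s1 ''cm'' = s ''cm''" "s1 ''bk'' = s ''bk''" "s1 ''y'' = s ''y''"
      using agree_offD[OF ag] by auto
    have "runs dial_loop s1 (200 * nat m + 100) (\<lambda>s'. (\<forall>j. s' ''bk'' j = 0) \<and> good_lowering (s' ''d'') \<and>
      int (card (heads (shifted r (s' ''d'')))) + s ''t'' 0 \<le> int (card (heads r)))"
      by (rule c.runs_dial_loop[OF a1 rw1]) (use s1 s(2) eq in \<open>auto simp: Q2_def via_def\<close>)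
    then show "runs dial_loop s1 (200 * nat m + 100) Q3"
    proof (rule runs_agree_off[THEN runs_mono])
      fix s' assume h: "((\<forall>j. s' ''bk'' j = 0) \<and> good_lowering (s' ''d'') \<and>
        int (card (heads (shifted r (s' ''d'')))) + s ''t'' 0 \<le> int (card (heads r))) \<and>
        agree_off (writes dial_loop) s1 s'"
      then have ag': "agree_off (writes dial_loop) s1 s'" by blast
      have "has_arcs s'" by (rule has_arcs_agree[OF ag' a1]) (simp add: dial_loop_def dial_body_def)
      moreover have "rw s' = r" using rw_agree[OF ag'] rw1 by (simp add: dial_loop_def dial_body_def)
      moreover have "s' ''y'' = s1 ''y''" by (rule agree_offD[OF ag']) (simp add: dial_loop_def dial_body_def)
      ultimately show "Q3 s'" using h eq by (simp add: Q3_def)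
    qed simp
  qed
  also have "triple Q3 apply_prog (16 * nat m + 4) Q4"
  proof (rule tripleI)
    fix s1 assume s1: "Q3 s1"
    then have a1: "has_arcs s1" by (simp add: Q3_def)
    show "runs apply_prog s1 (16 * nat m + 4) Q4"
    proof (rule runs_apply[OF a1, THEN runs_mono])
      fix s' assume h: "agree_off {''e'', ''zz'', ''y''} s1 s' \<and> (\<forall>v\<in>T. s' ''y'' v = s1 ''y'' v - s1 ''d'' v) \<and>
        (\<forall>e\<in>E. rw s' e = shifted (rw s1) (s1 ''d'') e)"
      then have "s' ''bk'' = s1 ''bk''" by (auto intro!: agree_offD)
      moreover have "lowered s (s1 ''d'') s'" using h s1 rws by (simp add: lowered_def Q3_def)
      ultimately show "Q4 s'" using s1 unfolding Q4_def Q3_def by auto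
    qed simp
  qed
  finally have "triple (\<lambda>s'. s' = s) chain_prog
    (8 * nat m + 2 + step_bound ?start + (200 * nat m + 100) + (16 * nat m + 4)) Q4"
    unfolding chain_prog_def .
  then show ?thesis unfolding triple_def Q4_def by (auto elim!: runs_mono)
qed

text \<open>\<open>c\<close> will be the larger of \<open>be\<close> and \<open>t\<close>, the
  number of heads that the chosen repair removes at least. Only its square matters for the count of
  rounds.\<close>

definition selected :: "store \<Rightarrow> store \<Rightarrow> bool" where
  "selected s s' \<longleftrightarrow> (\<forall>j. s' ''bk'' j = 0) \<and> (\<exists>L c. good_lowering L \<and> lowered s L s' \<and>
     int (card (heads (shifted r L))) + c \<le> int (card (heads r)) \<and> 0 \<le> c \<and> int (card (heads r)) \<le> c * c)"

lemma runs_select: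
  assumes s: "counted s" "\<forall>j. s ''bk'' j = 0" "\<not> s ''be'' 0 < 1" and r: "\<forall>e\<in>E. - 1 \<le> r e"
  shows "runs select_prog s (250 * nat m + 151) (selected s)"
proof -
  let ?via = "\<lambda>v. s ''vi'' (s ''cm'' v) - 1"
  have ls: "levels_state s" using s(1) by (simp add: counted_def)
  then have lev: "levels (s ''lv'') ?via" by (simp add: levels_state_def)
  obtain mk ct where cnt: "count_inv (s ''lv'') ?via m mk ct (s ''be'' 0) (s ''bj'' 0) (s ''t'' 0) (s ''te'' 0)"
    using s(1) by (auto simp: counted_def)
  note cd = count_done(3)[OF lev cnt s(3)]
  have "runs select_prog s (Suc (250 * nat m + 150)) (selected s)"
    unfolding select_prog_def
  proof (rule runs_Cond)
    assume "bval (Less (var ''be'') (var ''t'')) s"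
    then have lt: "s ''be'' 0 < s ''t'' 0" by simp
    obtain v where v: "v \<in> heads r" "s ''lv'' v = s ''t'' 0" "s ''te'' 0 = ?via v" using cd by blast
    have "int (card (heads r)) \<le> s ''be'' 0 * s ''t'' 0" using cd by blast
    also have "\<dots> \<le> s ''t'' 0 * s ''t'' 0" using lt cd by (intro mult_right_mono) auto
    finally have c: "int (card (heads r)) \<le> s ''t'' 0 * s ''t'' 0" .
    have t1: "1 \<le> s ''t'' 0" using cd by blast
    show "runs chain_prog s (250 * nat m + 150) (selected s)"
    proof (rule runs_chain[OF ls s(2) r t1 v, THEN runs_mono])
      fix s' assume "(\<forall>j. s' ''bk'' j = 0) \<and> (\<exists>L. good_lowering L \<and> lowered s L s' \<and>
        int (card (heads (shifted r L))) + s ''t'' 0 \<le> int (card (heads r)))"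
      then obtain L where "\<forall>j. s' ''bk'' j = 0" "good_lowering L" "lowered s L s'"
        "int (card (heads (shifted r L))) + s ''t'' 0 \<le> int (card (heads r))" by blast
      then show "selected s s'"
        using c t1 unfolding selected_def by (intro conjI exI[of _ L] exI[of _ "s ''t'' 0"]) auto
    qed simp
  next
    assume "\<not> bval (Less (var ''be'') (var ''t'')) s"
    then have ge: "s ''t'' 0 \<le> s ''be'' 0" by simp
    let ?j = "s ''bj'' 0" and ?N = "{w \<in> heads r. s ''lv'' w = s ''bj'' 0}"
    let ?L = "cut (s ''lv'') ?j"
    have j: "1 \<le> ?j" "int (card ?N) = s ''be'' 0" using cd by auto
    have "int (card (heads r)) \<le> s ''be'' 0 * s ''t'' 0" using cd by blast
    also have "\<dots> \<le> s ''be'' 0 * s ''be'' 0" using ge cd by (intro mult_left_mono) auto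
    finally have c: "int (card (heads r)) \<le> s ''be'' 0 * s ''be'' 0" .
    have good: "good_lowering ?L" by (rule cut_good[OF lev j(1)])
    have "heads (shifted r ?L) \<subseteq> heads r - ?N"
      using good_lowering_heads[OF good] cut_heads[OF lev r] by blast
    then have "card (heads (shifted r ?L)) \<le> card (heads r - ?N)" by (intro card_mono) auto
    also have "\<dots> = card (heads r) - card ?N" by (intro card_Diff_subset) auto
    finally have "card (heads (shifted r ?L)) \<le> card (heads r) - card ?N" .
    moreover have "card ?N \<le> card (heads r)" by (intro card_mono) auto
    ultimately have card: "int (card (heads (shifted r ?L))) + s ''be'' 0 \<le> int (card (heads r))" using j(2) by linarith
    have "runs (cut_prog (var ''bj'')) s (24 * nat m + 6) (lowered s ?L)"
      by (rule runs_cut[OF ls]) (auto simp: agree_offD)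
    then show "runs (cut_prog (var ''bj'')) s (250 * nat m + 150) (selected s)"
    proof (rule runs_agree_off[THEN runs_mono])
      fix s' assume h: "lowered s ?L s' \<and> agree_off (writes (cut_prog (var ''bj''))) s s'"
      then have "s' ''bk'' = s ''bk''"
        by (auto intro!: agree_offD simp: cut_prog_def apply_prog_def for_vertices_def for_edges_def)
      then show "selected s s'"
        using h good card c s(2,3) unfolding selected_def by (intro conjI exI[of _ ?L] exI[of _ "s ''be'' 0"]) auto
    qed simp
  qed
  then show ?thesis by (rule runs_mono) auto
qed

end

section \<open>One scale\<close>

text \<open>A potential for the number of rounds: it drops whenever at least the square root of the
  current number of heads disappears.\<close>

definition iters :: "nat \<Rightarrow> nat" where
  "iters k = nat \<lfloor>2 * sqrt (real k)\<rfloor>"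

lemma iters_mono: "k \<le> k' \<Longrightarrow> iters k \<le> iters k'"
  unfolding iters_def by (intro nat_mono floor_mono) simp

text \<open>The reason is that \<open>k - sqrt k \<le> (sqrt k - 1 / 2)\<^sup>2\<close>.\<close>

lemma iters_less:
  assumes "int k' + c \<le> int k" "0 \<le> c" "int k \<le> c * c" "0 < k"
  shows "iters k' < iters k"
proof -
  define s where "s = sqrt (real k)"
  have s: "s * s = real k" "1 \<le> s" using assms(4) by (auto simp: s_def)
  have "real k \<le> real_of_int (c * c)" using assms(3) by linarith
  then have "s * s \<le> real_of_int c * real_of_int c" using s by simp
  then have "s \<le> real_of_int c" using assms(2) s(2) by (smt (verit) mult_mono of_int_0_le_iff mult_strict_mono)
  then have "real k' \<le> s * s - s" using assms(1) s(1) by linarith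
  also have "\<dots> \<le> (s - 1/2) ^ 2" by (simp add: power2_eq_square algebra_simps)
  finally have "sqrt (real k') \<le> sqrt ((s - 1/2) ^ 2)" by (rule real_sqrt_le_mono)
  then have "2 * sqrt (real k') \<le> 2 * s - 1" using s(2) by simp
  then have "\<lfloor>2 * sqrt (real k')\<rfloor> \<le> \<lfloor>2 * s\<rfloor> - 1" by linarith
  moreover have "1 \<le> \<lfloor>2 * s\<rfloor>" using s(2) by linarith
  ultimately show ?thesis unfolding iters_def s_def[symmetric] by linarith
qed

lemma agree_off_keep: "agree_off X s s' \<Longrightarrow> K \<inter> X = {} \<Longrightarrow> a \<in> K \<Longrightarrow> s' a = s a"
  by (auto simp: agree_off_def)

lemma writes_levels: "{''bk'', ''y'', ''g''} \<inter> writes levels_prog = {}"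
  by (simp add: prog_defs)

lemma writes_count: "{''bk'', ''y'', ''g''} \<inter> writes count_prog = {}"
  by (simp add: prog_defs)

lemma writes_select: "{''m'', ''src'', ''dst'', ''oh'', ''on'', ''ih'', ''in'', ''la'', ''g''} \<inter> writes select_prog = {}"
  by (simp add: prog_defs)

lemma writes_cut1: "{''m'', ''src'', ''dst'', ''oh'', ''on'', ''ih'', ''in'', ''la'', ''g'', ''bk''} \<inter>
    writes (cut_prog (Const 1)) = {}"
  by (simp add: prog_defs)

section \<open>Rounds and their number within a scale\<close>

context arcs
begin

lemma has_arcs_keep:
  assumes "agree_off X s s'" "K \<inter> X = {}" "has_arcs s" "{''m'', ''src'', ''dst'', ''oh'', ''on'', ''ih'', ''in''} \<subseteq> K"
  shows "has_arcs s'"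
  by (rule has_arcs_agree[OF assms(1,3)]) (use assms(2,4) in blast)

text \<open>\<open>M\<close> bounds the current certificate and falls in each repairing round.
  \<open>S\<close> is fixed during a scale: since \<open>P\<close> is nonnegative, the last
  inequality keeps \<open>y v\<close> above \<open>- S v\<close>, which is the bound that the next
  scale starts from.\<close>

definition unit_inv :: "(int \<Rightarrow> int) \<Rightarrow> int \<Rightarrow> store \<Rightarrow> bool" where
  "unit_inv S M s \<longleftrightarrow> has_arcs s \<and> s ''la'' 0 = 0 \<and> (\<forall>j. s ''bk'' j = 0) \<and> (\<forall>e\<in>E. - 1 \<le> rw s e) \<and>
     (\<forall>v\<in>T. s ''y'' v \<le> 0) \<and>
     (\<exists>P. weighted m src dst oh on ih inx outs ins (rw s) P \<and>
        (\<forall>v\<in>T. P v \<le> M \<and> P v \<le> S v + s ''y'' v))"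

lemma runs_unit_body:
  assumes inv: "unit_inv S M s"
  shows "runs unit_body s (1500 * nat m + 700) (\<lambda>s'.
    heads (rw s) = {} \<and> s' ''g'' 0 = 0 \<and> unit_inv S M s' \<and> rw s' = rw s \<or>
    1 \<le> M \<and> s' ''g'' 0 = s ''g'' 0 \<and> unit_inv S (M - 1) s' \<and>
      iters (card (heads (rw s'))) < iters (card (heads (rw s))))"
proof -
  obtain P where P: "weighted m src dst oh on ih inx outs ins (rw s) P" "\<forall>v\<in>T. P v \<le> M"
    "\<forall>v\<in>T. P v \<le> S v + s ''y'' v" using inv by (auto simp: unit_inv_def)
  have i: "has_arcs s" "s ''la'' 0 = 0" "\<forall>j. s ''bk'' j = 0" "\<forall>e\<in>E. - 1 \<le> rw s e" "\<forall>v\<in>T. s ''y'' v \<le> 0"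
    using inv by (auto simp: unit_inv_def)
  define Z where "Z = (\<lambda>s'. heads (rw s) = {} \<and> s' ''g'' 0 = 0 \<and> unit_inv S M s' \<and> rw s' = rw s \<or>
    1 \<le> M \<and> s' ''g'' 0 = s ''g'' 0 \<and> unit_inv S (M - 1) s' \<and>
      iters (card (heads (rw s'))) < iters (card (heads (rw s))))"
  interpret w: weighted m src dst oh on ih inx outs ins "rw s" P by (rule P(1))
  have "w.base s" using i by (simp add: w.base_def)
  define Q1 where "Q1 = (\<lambda>s'. w.levels_state s' \<and> s' ''bk'' = s ''bk'' \<and> s' ''y'' = s ''y'' \<and> s' ''g'' = s ''g'')"
  define Q2 where "Q2 = (\<lambda>s'. w.counted s' \<and> s' ''bk'' = s ''bk'' \<and> s' ''y'' = s ''y'' \<and> s' ''g'' = s ''g'')"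
  have 1: "triple (\<lambda>s'. s' = s) levels_prog (500 * nat m + 200) Q1"
  proof (rule tripleI)
    fix s0 assume "s0 = s"
    show "runs levels_prog s0 (500 * nat m + 200) Q1"
      unfolding \<open>s0 = s\<close>
    proof (rule w.triple_levels[THEN tripleD, OF \<open>w.base s\<close>, THEN runs_agree_off, THEN runs_mono])
      fix s' assume a: "w.levels_state s' \<and> agree_off (writes levels_prog) s s'"
      then have ag: "agree_off (writes levels_prog) s s'" by blast
      have "s' ''bk'' = s ''bk''" "s' ''y'' = s ''y''" "s' ''g'' = s ''g''"
        using agree_off_keep[OF ag writes_levels] by auto
      then show "Q1 s'" using a by (simp add: Q1_def)
    qed simp
  qed
  have 2: "triple Q1 count_prog (40 * nat m + 20) Q2"
  proof (rule tripleI)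
    fix s1 assume s1: "Q1 s1"
    then have l: "w.levels_state s1" by (simp add: Q1_def)
    show "runs count_prog s1 (40 * nat m + 20) Q2"
    proof (rule w.triple_count[THEN tripleD, OF l, THEN runs_agree_off, THEN runs_mono])
      fix s' assume a: "w.counted s' \<and> agree_off (writes count_prog) s1 s'"
      then have ag: "agree_off (writes count_prog) s1 s'" by blast
      have "s' ''bk'' = s1 ''bk''" "s' ''y'' = s1 ''y''" "s' ''g'' = s1 ''g''"
        using agree_off_keep[OF ag writes_count] by auto
      then show "Q2 s'" using a s1 by (simp add: Q1_def Q2_def)
    qed simp
  qed
  have 3: "triple Q2 (Cond (Less (var ''be'') (Const 1)) (assign ''g'' (Const 0))
       (select_prog ;; levels_prog ;; cut_prog (Const 1))) (Suc (800 * nat m + 400)) Z"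
  proof (rule tripleI, rule runs_Cond)
    fix s2 assume s2: "Q2 s2" and be: "bval (Less (var ''be'') (Const 1)) s2"
    have c: "w.counted s2" and eq: "s2 ''bk'' = s ''bk''" "s2 ''y'' = s ''y''" using s2 by (auto simp: Q2_def)
    then have ls: "w.levels_state s2" by (simp add: w.counted_def)
    then have lev: "w.levels (s2 ''lv'') (\<lambda>v. s2 ''vi'' (s2 ''cm'' v) - 1)" and b: "w.base s2"
      by (auto simp: w.levels_state_def)
    have "heads (rw s) = {}"
      using c be w.count_done(2)[OF lev] by (auto simp: w.counted_def)
    moreover have "w.base (s2(''g'' := (s2 ''g'')(0 := 0)))" by (rule w.base_assign[OF b]) simp
    then have "has_arcs (s2(''g'' := (s2 ''g'')(0 := 0)))" "rw (s2(''g'' := (s2 ''g'')(0 := 0))) = rw s"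
      "s2 ''la'' 0 = 0" by (auto simp: w.base_def)
    ultimately have "Z (s2(''g'' := (s2 ''g'')(0 := 0)))"
      using P i eq unfolding Z_def unit_inv_def by auto
    then show "runs (assign ''g'' (Const 0)) s2 (800 * nat m + 400) Z"
      using runs_straight[of "assign ''g'' (Const 0)" Z s2] by (auto elim: runs_mono)
  next
    fix s2 assume s2: "Q2 s2" and be: "\<not> bval (Less (var ''be'') (Const 1)) s2"
    have c: "w.counted s2" and eq: "s2 ''bk'' = s ''bk''" "s2 ''y'' = s ''y''" "s2 ''g'' = s ''g''"
      using s2 by (auto simp: Q2_def)
    then have ls: "w.levels_state s2" by (simp add: w.counted_def)
    then have lev: "w.levels (s2 ''lv'') (\<lambda>v. s2 ''vi'' (s2 ''cm'' v) - 1)" and b: "w.base s2"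
      by (auto simp: w.levels_state_def)
    have a2: "has_arcs s2" "rw s2 = rw s" "s2 ''la'' 0 = 0" using b by (auto simp: w.base_def)
    have be': "\<not> s2 ''be'' 0 < 1" using be by simp
    have ne: "heads (rw s) \<noteq> {}"
    proof -
      obtain mk ct where "w.count_inv (s2 ''lv'') (\<lambda>v. s2 ''vi'' (s2 ''cm'' v) - 1) m mk ct
        (s2 ''be'' 0) (s2 ''bj'' 0) (s2 ''t'' 0) (s2 ''te'' 0)" using c by (auto simp: w.counted_def)
      from w.count_done(3)[OF lev this be'] show ?thesis by blast
    qed
    \<comment> \<open>With \<open>P\<close> bounded by 0 there would be no negative edge, so a round
      that repairs something can afford to replace \<open>M\<close> by \<open>M - 1\<close>.\<close>
    have M: "1 \<le> M"
    proof (rule ccontr)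
      assume "\<not> 1 \<le> M"
      then have "\<forall>v\<in>T. P v \<le> 0" using P(2) by fastforce
      then show False using w.heads_empty_if_zero ne by blast
    qed
    have bk2: "\<forall>j. s2 ''bk'' j = 0" using eq i by simp
    define Q3 where "Q3 = (\<lambda>s3. has_arcs s3 \<and> s3 ''la'' 0 = 0 \<and> (\<forall>j. s3 ''bk'' j = 0) \<and> s3 ''g'' = s ''g'' \<and>
      (\<exists>L c. w.good_lowering L \<and> lowered s L s3 \<and> int (card (heads (shifted (rw s) L))) + c \<le> int (card (heads (rw s))) \<and>
         0 \<le> c \<and> int (card (heads (rw s))) \<le> c * c))"
    have "runs select_prog s2 (250 * nat m + 151) Q3"
    proof (rule w.runs_select[OF c bk2 be' i(4), THEN runs_agree_off, THEN runs_mono])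
      fix s' assume h: "w.selected s2 s' \<and> agree_off (writes select_prog) s2 s'"
      then have ag: "agree_off (writes select_prog) s2 s'" by blast
      have "has_arcs s'" by (rule has_arcs_keep[OF ag writes_select a2(1)]) simp
      moreover have "s' ''la'' = s2 ''la''" "s' ''g'' = s2 ''g''"
        using agree_off_keep[OF ag writes_select] by auto
      moreover have "lowered s2 = lowered s" by (intro ext) (simp only: lowered_def a2 eq)
      ultimately show "Q3 s'" using h a2 eq by (simp add: Q3_def w.selected_def)
    qed simp
    then have "runs (select_prog ;; levels_prog ;; cut_prog (Const 1)) s2
      (250 * nat m + 151 + (500 * nat m + 200) + (24 * nat m + 6)) Z"
    proof -
      define A where "A = (\<lambda>s4. \<exists>s3 L c P1. Q3 s3 \<and> w.good_lowering L \<and> lowered s L s3 \<and>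
        int (card (heads (shifted (rw s) L))) + c \<le> int (card (heads (rw s))) \<and>
         0 \<le> c \<and> int (card (heads (rw s))) \<le> c * c \<and> P1 = (\<lambda>v. if v \<in> T then P v - L v else 0) \<and>
        weighted m src dst oh on ih inx outs ins (rw s3) P1 \<and>
        weighted.levels_state m src dst oh on ih inx (rw s3) P1 s4 \<and> s4 ''bk'' = s3 ''bk'' \<and> s4 ''y'' = s3 ''y'' \<and> s4 ''g'' = s3 ''g'')"
      have "triple (\<lambda>s'. s' = s2) select_prog (250 * nat m + 151) Q3" using \<open>runs select_prog s2 _ Q3\<close> by (simp add: triple_def)
      also have "triple Q3 levels_prog (500 * nat m + 200) A"
      proof (rule tripleI)
        fix s3 assume s3: "Q3 s3"
        then obtain L c where L: "w.good_lowering L" "lowered s L s3"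
          "int (card (heads (shifted (rw s) L))) + c \<le> int (card (heads (rw s)))"
          "0 \<le> c" "int (card (heads (rw s))) \<le> c * c" by (auto simp: Q3_def)
        define P1 where "P1 = (\<lambda>v. if v \<in> T then P v - L v else 0)"
        have W: "weighted m src dst oh on ih inx outs ins (rw s3) P1"
          unfolding P1_def by (rule weighted_cong[OF w.weighted_lower[OF L(1)]]) (use L(2) in \<open>auto simp: lowered_def\<close>)
        interpret w1: weighted m src dst oh on ih inx outs ins "rw s3" P1 by (rule W)
        have b3: "w1.base s3" using s3 by (simp add: w1.base_def Q3_def)
        show "runs levels_prog s3 (500 * nat m + 200) A"
        proof (rule w1.triple_levels[THEN tripleD, OF b3, THEN runs_agree_off, THEN runs_mono])
          fix s4 assume h: "w1.levels_state s4 \<and> agree_off (writes levels_prog) s3 s4"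
          then have ag: "agree_off (writes levels_prog) s3 s4" by blast
          have "s4 ''bk'' = s3 ''bk''" "s4 ''y'' = s3 ''y''" "s4 ''g'' = s3 ''g''"
            using agree_off_keep[OF ag writes_levels] by auto
          then show "A s4" unfolding A_def using h s3 L W P1_def by blast
        qed simp
      qed
      also have "triple A (cut_prog (Const 1)) (24 * nat m + 6) Z"
      proof (rule tripleI)
        fix s4 assume "A s4"
        then obtain s3 L c P1 where h: "Q3 s3" "w.good_lowering L" "lowered s L s3"
          "int (card (heads (shifted (rw s) L))) + c \<le> int (card (heads (rw s)))"
          "0 \<le> c" "int (card (heads (rw s))) \<le> c * c" "P1 = (\<lambda>v. if v \<in> T then P v - L v else 0)"
          "weighted m src dst oh on ih inx outs ins (rw s3) P1"
          "weighted.levels_state m src dst oh on ih inx (rw s3) P1 s4"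
          "s4 ''bk'' = s3 ''bk''" "s4 ''y'' = s3 ''y''" "s4 ''g'' = s3 ''g''" unfolding A_def by blast
        interpret w1: weighted m src dst oh on ih inx outs ins "rw s3" P1 by (rule h(8))
        have b4: "w1.base s4" and lev4: "w1.levels (s4 ''lv'') (\<lambda>v. s4 ''vi'' (s4 ''cm'' v) - 1)"
          using h(9) by (auto simp: w1.levels_state_def)
        have a4: "has_arcs s4" "rw s4 = rw s3" "s4 ''la'' 0 = 0" using b4 by (auto simp: w1.base_def)
        have r3: "\<forall>e\<in>E. rw s3 e = shifted (rw s) L e" using h(3) by (simp add: lowered_def)
        have r3b: "\<forall>e\<in>E. - 1 \<le> rw s3 e" using w.good_lowering_bound[OF h(2) i(4)] r3 by simp
        have P1M: "\<forall>v\<in>T. P1 v \<le> M" using P(2) h(2,7) by (fastforce simp: w.good_lowering_def)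
        have "runs (cut_prog (Const 1)) s4 (24 * nat m + 6) (lowered s4 (w1.cut (s4 ''lv'') 1))"
          by (rule w1.runs_cut[OF h(9)]) simp
        then show "runs (cut_prog (Const 1)) s4 (24 * nat m + 6) Z"
        proof (rule runs_agree_off[THEN runs_mono])
          fix s5 assume k: "lowered s4 (w1.cut (s4 ''lv'') 1) s5 \<and> agree_off (writes (cut_prog (Const 1))) s4 s5"
          let ?C = "w1.cut (s4 ''lv'') 1"
          let ?P2 = "\<lambda>v. if v \<in> T then min (P1 v - ?C v) (M - 1) else 0"
          have ag: "agree_off (writes (cut_prog (Const 1))) s4 s5" using k by blast
          have a5: "has_arcs s5" by (rule has_arcs_keep[OF ag writes_cut1 a4(1)]) simp
          have eq5: "s5 ''bk'' = s4 ''bk''" "s5 ''la'' = s4 ''la''" "s5 ''g'' = s4 ''g''"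
            using agree_off_keep[OF ag writes_cut1] by auto
          have r5: "\<forall>e\<in>E. rw s5 e = shifted (rw s3) ?C e" using k a4 by (simp add: lowered_def)
          have gC: "w1.good_lowering ?C" by (rule w1.cut_good[OF lev4]) simp
          have W2: "weighted m src dst oh on ih inx outs ins (rw s5) ?P2"
            by (rule weighted_cong[OF w1.weighted_cut1[OF lev4 r3b P1M M] r5])
          have r5b: "\<forall>e\<in>E. - 1 \<le> rw s5 e" using w1.good_lowering_bound[OF gC r3b] r5 by simp
          have y5: "s5 ''y'' v = s ''y'' v - L v - ?C v" if "v \<in> T" for v
            using k h(3,11) that by (simp add: lowered_def)
          have L0: "0 \<le> L v" "0 \<le> ?C v" if "v \<in> T" for v
            using h(2) gC that by (auto simp: w.good_lowering_def w1.good_lowering_def)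
          have "unit_inv S (M - 1) s5"
            unfolding unit_inv_def
          proof (intro conjI exI[of _ ?P2] ballI)
            show "has_arcs s5" "s5 ''la'' 0 = 0" "\<forall>j. s5 ''bk'' j = 0"
              using a5 eq5 a4 h(1,10) by (auto simp: Q3_def)
            show "weighted m src dst oh on ih inx outs ins (rw s5) ?P2" by (rule W2)
            fix e assume "e \<in> E" then show "- 1 \<le> rw s5 e" using r5b by blast
          next
            fix v assume v: "v \<in> T"
            show "s5 ''y'' v \<le> 0" using y5[OF v] L0[OF v] i(5) v by fastforce
            show "?P2 v \<le> M - 1" using v by simp
            have "P v \<le> S v + s ''y'' v" using P(3) v by blast
            then show "?P2 v \<le> S v + s5 ''y'' v" using y5[OF v] v h(7) by simp
          qed
          moreover have "iters (card (heads (rw s5))) < iters (card (heads (rw s)))"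
          proof -
            have "heads (rw s5) \<subseteq> heads (rw s3)"
              using w1.good_lowering_heads[OF gC] heads_cong[OF r5] by simp
            moreover have "heads (rw s3) = heads (shifted (rw s) L)" by (rule heads_cong[OF r3])
            ultimately have "card (heads (rw s5)) \<le> card (heads (shifted (rw s) L))"
              by (metis card_mono finite_heads)
            moreover have "0 < card (heads (rw s))" using ne by (simp add: card_gt_0_iff)
            moreover have "iters (card (heads (shifted (rw s) L))) < iters (card (heads (rw s)))"
              by (rule iters_less[OF h(4,5,6) calculation(2)])
            ultimately show ?thesis using iters_mono by (meson order_le_less_trans)
          qed
          moreover have "s5 ''g'' 0 = s ''g'' 0" using eq5 h(1,12) by (simp add: Q3_def)
          ultimately show "Z s5" using M by (simp add: Z_def)
        qed simp
      qed
      finally show ?thesis by (simp add: triple_def)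
    qed
    then show "runs (select_prog ;; levels_prog ;; cut_prog (Const 1)) s2 (800 * nat m + 400) Z"
      by (rule runs_mono) auto
  qed
  have "triple (\<lambda>s'. s' = s) unit_body (500 * nat m + 200 + (40 * nat m + 20) + Suc (800 * nat m + 400)) Z"
    unfolding unit_body_def by (rule triple_Seq[OF triple_Seq[OF 1 2] 3])
  then show ?thesis unfolding triple_def Z_def by (auto elim!: runs_mono)
qed

lemma unit_inv_mono: "unit_inv S M s \<Longrightarrow> M \<le> M' \<Longrightarrow> unit_inv S M' s"
  unfolding unit_inv_def by (meson order_trans)

text \<open>A repairing round lowers \<open>M\<close> and the potential of the heads simultaneously,
  so their minimum bounds the number of such rounds. \<open>Suc\<close> accounts for the final
  round, which only finds that no head is left.\<close>

lemma runs_unit: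
  assumes inv: "unit_inv S M s" and "0 \<le> M"
  shows "runs unit_prog s ((1500 * nat m + 701) * Suc (min (nat M) (iters (card (heads (rw s))))) + 2)
    (\<lambda>s'. unit_inv S M s' \<and> heads (rw s') = {})"
proof -
  let ?c = "1500 * nat m + 701"
  define I where "I = (\<lambda>k s'. \<exists>M'. 0 \<le> M' \<and> M' \<le> M \<and> unit_inv S M' s' \<and>
    (s' ''g'' 0 = 1 \<and> ?c * Suc (min (nat M') (iters (card (heads (rw s'))))) \<le> k \<or>
     s' ''g'' 0 = 0 \<and> heads (rw s') = {}))"
  let ?k = "?c * Suc (min (nat M) (iters (card (heads (rw s)))))"
  have 1: "runs (assign ''g'' (Const 1)) s 1 (I ?k)"
  proof -
    let ?s = "s(''g'' := (s ''g'')(0 := 1))"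
    have ag: "agree_off {''g''} s ?s" by (simp add: agree_off_def)
    have h: "has_arcs ?s" by (rule has_arcs_agree[OF ag]) (use inv in \<open>auto simp: unit_inv_def\<close>)
    have r: "rw ?s = rw s" by (rule rw_agree[OF ag]) simp
    have "unit_inv S M ?s" using inv h r by (simp add: unit_inv_def)
    then have "I ?k ?s" unfolding I_def using \<open>0 \<le> M\<close> r by (intro exI[of _ M]) auto
    then show ?thesis using runs_straight[of "assign ''g'' (Const 1)" "I ?k" s] by simp
  qed
  have 2: "runs (While (pos (var ''g'')) unit_body) s1 (Suc ?k)
      (\<lambda>s'. (\<exists>k'. I k' s') \<and> \<not> bval (pos (var ''g'')) s')" if s1: "I ?k s1" for s1
    using s1
  proof (rule runs_While)
    fix k s' assume "I k s'" and b: "bval (pos (var ''g'')) s'"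
    then obtain M' where M': "0 \<le> M'" "M' \<le> M" "unit_inv S M' s'" "s' ''g'' 0 = 1"
      "?c * Suc (min (nat M') (iters (card (heads (rw s'))))) \<le> k" unfolding I_def by auto
    let ?h = "iters (card (heads (rw s')))"
    have k1: "?c + ?c * min (nat M') ?h \<le> k" using M'(5) by simp
    have "runs unit_body s' (1500 * nat m + 700) (I (k - ?c))"
    proof (rule runs_unit_body[OF M'(3), THEN runs_mono])
      fix s2 assume a: "heads (rw s') = {} \<and> s2 ''g'' 0 = 0 \<and> unit_inv S M' s2 \<and> rw s2 = rw s' \<or>
        1 \<le> M' \<and> s2 ''g'' 0 = s' ''g'' 0 \<and> unit_inv S (M' - 1) s2 \<and> iters (card (heads (rw s2))) < ?h"
      then show "I (k - ?c) s2"
      proof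
        assume "heads (rw s') = {} \<and> s2 ''g'' 0 = 0 \<and> unit_inv S M' s2 \<and> rw s2 = rw s'"
        then show ?thesis unfolding I_def using M' by (intro exI[of _ M']) auto
      next
        assume h: "1 \<le> M' \<and> s2 ''g'' 0 = s' ''g'' 0 \<and> unit_inv S (M' - 1) s2 \<and>
          iters (card (heads (rw s2))) < ?h"
        have "Suc (min (nat (M' - 1)) (iters (card (heads (rw s2))))) \<le> min (nat M') ?h" using h by auto
        then have "?c * Suc (min (nat (M' - 1)) (iters (card (heads (rw s2))))) \<le> ?c * min (nat M') ?h"
          by (rule mult_le_mono2)
        also have "\<dots> \<le> k - ?c" using k1 by linarith
        finally show ?thesis unfolding I_def using M' h by (intro exI[of _ "M' - 1"]) auto
      qed
    qed simp
    then show "\<exists>k' B. B + k' < k \<and> runs unit_body s' B (I k')"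
      using k1 by (intro exI[of _ "k - ?c"] exI[of _ "1500 * nat m + 700"]) auto
  qed
  have "runs unit_prog s (1 + Suc ?k) (\<lambda>s'. (\<exists>k'. I k' s') \<and> \<not> bval (pos (var ''g'')) s')"
    unfolding unit_prog_def by (rule runs_Seq[OF 1 2])
  then show ?thesis
  proof (rule runs_mono)
    fix s' assume "(\<exists>k'. I k' s') \<and> \<not> bval (pos (var ''g'')) s'"
    then show "unit_inv S M s' \<and> heads (rw s') = {}" unfolding I_def using unit_inv_mono by auto
  qed simp
qed

end

section \<open>Scaling\<close>

primrec halved :: "nat \<Rightarrow> int \<Rightarrow> int" where
  "halved 0 x = x"
| "halved (Suc i) x = halved i x div 2"

primrec ceiled :: "nat \<Rightarrow> int \<Rightarrow> int" where
  "ceiled 0 x = x"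
| "ceiled (Suc i) x = (ceiled i x + 1) div 2"

lemma halved_nonneg: "0 \<le> x \<Longrightarrow> 0 \<le> halved i x"
  by (induction i) auto

lemma halved_mono: "x \<le> y \<Longrightarrow> halved i x \<le> halved i y"
  by (induction i) (auto intro: zdiv_mono1)

text \<open>Rounding \<open>c\<close> up makes good for what is lost when \<open>q\<close> is
  rounded down.\<close>

lemma halved_feasible: "p \<le> c + q \<Longrightarrow> halved i p \<le> ceiled i c + halved i q"
proof (induction i)
  case (Suc i)
  then have "halved i p \<le> ceiled i c + halved i q" by simp
  then show ?case by simp
qed simp

lemma halved_shift: "halved (Suc i) x = halved i (x div 2)"
  by (induction i) auto

text \<open>The number of binary digits, which will bound the number of scales.\<close>

fun bits :: "int \<Rightarrow> nat" where
  "bits x = (if x \<le> 0 then 0 else Suc (bits (x div 2)))"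

declare bits.simps [simp del]

lemma bits_0 [simp]: "x \<le> 0 \<Longrightarrow> bits x = 0"
  by (simp add: bits.simps)

lemma bits_Suc: "1 \<le> x \<Longrightarrow> bits x = Suc (bits (x div 2))"
  by (simp add: bits.simps)

lemma bits_le: "1 \<le> x \<Longrightarrow> 2 ^ bits x \<le> 2 * x"
proof (induction x rule: bits.induct)
  case (1 x)
  show ?case
  proof (cases "1 \<le> x div 2")
    case True
    then have "2 ^ bits (x div 2) \<le> 2 * (x div 2)" using 1 by auto
    then show ?thesis using 1(2) by (simp add: bits_Suc)
  next
    case False
    then show ?thesis using 1(2) by (simp add: bits_Suc)
  qed
qed

lemma halved_pos: "i < bits x \<Longrightarrow> 1 \<le> halved i x"
proof (induction i arbitrary: x)
  case 0
  then show ?case by (cases "x \<le> 0") auto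
next
  case (Suc i)
  then have x: "1 \<le> x" by (cases "x \<le> 0") auto
  then have "i < bits (x div 2)" using Suc.prems by (simp add: bits_Suc)
  then show ?case using Suc.IH halved_shift by metis
qed

text \<open>A geometric series. It makes the rounds of all scales together linear in the initial
  bound on the certificate.\<close>

lemma sum_halved: "0 \<le> x \<Longrightarrow> (\<Sum>i<bits x. halved i x) \<le> 2 * x"
proof (induction x rule: bits.induct)
  case (1 x)
  show ?case
  proof (cases "x \<le> 0")
    case False
    then have "(\<Sum>i<bits x. halved i x) = x + (\<Sum>i<bits (x div 2). halved i (x div 2))"
      by (simp add: bits_Suc sum.lessThan_Suc_shift halved_shift del: halved.simps(2) sum.lessThan_Suc)
    also have "\<dots> \<le> x + 2 * (x div 2)" using 1 False by auto
    finally show ?thesis by simp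
  qed (use 1(2) in simp)
qed

section \<open>Programs for building the scales and going back through them\<close>

definition up_body :: com where
  "up_body = (assign ''z'' (Add (var ''b'') (var ''e'')) ;;
     Put ''q'' (Add (var ''z'') (var ''m'')) (Half (plus1 (Get ''q'' (var ''z'')))) ;;
     Cond (Less (Get ''q'' (Add (var ''z'') (var ''m''))) (Const 0)) (assign ''f'' (Const 1)) Skip)"

text \<open>Scale \<open>i\<close> occupies the \<open>m\<close> cells of \<open>q\<close> from
  address \<open>i * m\<close> on. The flag \<open>f\<close> tells whether the newest scale has a
  negative length, so stopping requires no knowledge of the distance.\<close>

definition up_prog :: com where
  "up_prog = While (pos (var ''f''))
     (assign ''f'' (Const 0) ;; for_edges up_body ;; assign ''b'' (Add (var ''b'') (var ''m'')))"

text \<open>Lowering by \<open>- y\<close> doubles the duals when the scale becomes finer.\<close>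

definition down_body :: com where
  "down_body = (assign ''b'' (Sub (var ''b'') (var ''m'')) ;;
     for_vertices (\<lambda>x. Put ''d'' x (Sub (Const 0) (Get ''y'' x))) ;; apply_prog ;; unit_prog)"

definition down_prog :: com where
  "down_prog = While (pos (var ''b'')) down_body"

text \<open>Lowering by \<open>- y0\<close> adds the prediction back.\<close>

definition finish_prog :: com where
  "finish_prog = (for_vertices (\<lambda>x. Put ''d'' x (Sub (Const 0) (Get ''y0'' x))) ;; apply_prog)"

definition solve_prog :: com where
  "solve_prog = (for_vertices (\<lambda>x. Put ''y'' x (Const 0)) ;; up_prog ;; down_prog ;; finish_prog)"

lemma writes_up: "{''m'', ''src'', ''dst'', ''oh'', ''on'', ''ih'', ''in'', ''la'', ''bk'', ''y'', ''y0''} \<inter>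
    writes up_prog = {}"
  by (simp add: up_prog_def up_body_def for_edges_def)

lemma writes_unit: "{''q'', ''b'', ''y0''} \<inter> writes unit_prog = {}"
  by (simp add: prog_defs unit_prog_def)

lemma writes_down: "{''y0''} \<inter> writes down_prog = {}"
  by (simp add: prog_defs unit_prog_def down_prog_def down_body_def)

text \<open>\<open>P0\<close> certifies the lengths relative to the prediction before any scaling,
  and \<open>M\<close> is an upper bound for it. At scale \<open>i\<close> the halves
  \<open>halved i (P0 v)\<close> and \<open>halved i M\<close> take over these roles.\<close>

locale scaling = arcs +
  fixes w P0 :: "int \<Rightarrow> int" and M :: int and n :: nat
  assumes P0_nonneg: "0 \<le> P0 v" and P0_le: "P0 v \<le> M"
    and P0_feasible: "e \<in> E \<Longrightarrow> P0 (src e) \<le> w e + P0 (dst e)"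
    and card_T: "card T \<le> n"
begin

lemma M_nonneg: "0 \<le> M"
  using P0_nonneg P0_le order_trans by blast

text \<open>If \<open>halved i M\<close> were 0, the halved certificate would vanish everywhere and
  all lengths at scale \<open>i\<close> would be nonnegative. Hence at most \<open>bits M\<close>
  scales are built.\<close>

lemma neg_halved:
  assumes "x \<in> E" "ceiled i (w x) < 0"
  shows "1 \<le> halved i M"
  using halved_feasible[OF P0_feasible[OF assms(1)], of i] halved_nonneg[OF P0_nonneg, of i "src x"]
    halved_mono[OF P0_le, of i "dst x"] assms(2) by linarith

definition scaled :: "nat \<Rightarrow> store \<Rightarrow> bool" where
  "scaled i s \<longleftrightarrow> (\<forall>j\<le>i. \<forall>x\<in>E. s ''q'' (int j * m + x) = ceiled j (w x))"

lemma runs_up_edges: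
  assumes s: "s ''m'' 0 = m" and b: "s ''b'' 0 = int i * m" and sc: "scaled i s" and f: "s ''f'' 0 = 0"
  shows "runs (for_edges up_body) s (6 * nat m + 2) (\<lambda>s'. scaled (Suc i) s' \<and>
    s' ''f'' 0 = (if \<exists>x\<in>E. ceiled (Suc i) (w x) < 0 then 1 else 0))"
proof -
  define g where "g = (\<lambda>x. (s ''q'' (s ''b'' 0 + x) + 1) div 2)"
  define I where "I = (\<lambda>k s'. (\<forall>a < s ''b'' 0 + m. s' ''q'' a = s ''q'' a) \<and>
    (\<forall>x\<in>{0..<k}. s' ''q'' (s ''b'' 0 + m + x) = g x) \<and>
    s' ''f'' 0 = (if \<exists>x\<in>{0..<k}. g x < 0 then 1 else 0))"
  have "runs (for_edges up_body) s ((step_bound up_body + 2) * nat m + 2) (I m)"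
  proof (rule runs_for_edges)
    show "straight up_body" "''e'' \<notin> writes up_body" "''m'' \<notin> writes up_body" by (auto simp: up_body_def)
    show "s ''m'' 0 = m" "0 \<le> m" using s m_nonneg by auto
    show "I 0 (s(''e'' := (s ''e'')(0 := 0)))" using f by (simp add: I_def)
    fix k s' assume I: "I k s'" and k: "0 \<le> k" "k < m" "s' ''e'' 0 = k"
      and ag: "agree_off (insert ''e'' (writes up_body)) s s'"
    have eq: "s' ''b'' = s ''b''" "s' ''m'' = s ''m''" using agree_offD[OF ag] by (auto simp: up_body_def)
    have qk: "s' ''q'' (s ''b'' 0 + k) = s ''q'' (s ''b'' 0 + k)" using I k by (simp add: I_def)
    have sp: "(\<exists>x\<in>{0..<k + 1}. g x < 0) \<longleftrightarrow> (\<exists>x\<in>{0..<k}. g x < 0) \<or> g k < 0"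
    proof -
      have "{0..<k + 1} = insert k {0..<k}" using k by auto
      then show ?thesis by auto
    qed
    have gk: "(s ''q'' (s ''b'' 0 + k) + 1) div 2 = g k" by (simp add: g_def)
    let ?r = "result (up_body ;; assign ''e'' (plus1 (var ''e''))) s'"
    have r: "?r ''q'' = (s' ''q'')(s ''b'' 0 + k + m := g k)" "?r ''f'' 0 = (if g k < 0 then 1 else s' ''f'' 0)"
      using eq s k qk gk by (auto simp: up_body_def)
    show "I (k + 1) ?r"
      unfolding I_def r
    proof (intro conjI allI impI ballI)
      fix a assume "a < s ''b'' 0 + m"
      then show "((s' ''q'')(s ''b'' 0 + k + m := g k)) a = s ''q'' a" using I k by (simp add: I_def)
    next
      fix x assume x: "x \<in> {0..<k + 1}"
      show "((s' ''q'')(s ''b'' 0 + k + m := g k)) (s ''b'' 0 + m + x) = g x"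
        using I x by (cases "x = k") (auto simp: I_def add.commute add.left_commute)
    next
      show "(if g k < 0 then 1 else s' ''f'' 0) = (if \<exists>x\<in>{0..<k + 1}. g x < 0 then 1 else 0)"
        unfolding sp using I by (auto simp: I_def)
    qed
  qed
  then show ?thesis
  proof (rule runs_mono)
    show "(step_bound up_body + 2) * nat m + 2 \<le> 6 * nat m + 2" by (simp add: up_body_def)
    fix s' assume I: "I m s'"
    have g: "g x = ceiled (Suc i) (w x)" if "x \<in> E" for x
      using sc that b by (simp add: g_def scaled_def)
    have "scaled (Suc i) s'"
      unfolding scaled_def
    proof (intro allI impI ballI)
      fix j x assume j: "j \<le> Suc i" and x: "x \<in> E"
      show "s' ''q'' (int j * m + x) = ceiled j (w x)"
      proof (cases "j = Suc i")
        case True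
        have e: "int (Suc i) * m + x = s ''b'' 0 + m + x" using b by (simp add: algebra_simps)
        show ?thesis unfolding True e using I x g[OF x] by (simp add: I_def E_def)
      next
        case False
        then have "int j * m \<le> int i * m" using j m_nonneg by (intro mult_right_mono) auto
        moreover have "x < m" using x by (simp add: E_def)
        ultimately have "int j * m + x < s ''b'' 0 + m" using b by linarith
        then show ?thesis using I sc False j x by (simp add: I_def scaled_def)
      qed
    qed
    moreover have "(\<exists>x\<in>{0..<m}. g x < 0) \<longleftrightarrow> (\<exists>x\<in>E. ceiled (Suc i) (w x) < 0)"
      using g by (auto simp: E_def)
    ultimately show "scaled (Suc i) s' \<and> s' ''f'' 0 = (if \<exists>x\<in>E. ceiled (Suc i) (w x) < 0 then 1 else 0)"
      using I by (simp add: I_def)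
  qed
qed

text \<open>The equation for \<open>bits M\<close> ties the number of scales built so far to the
  digits still available, since each further scale uses up one of them.\<close>

definition up_inv :: "nat \<Rightarrow> store \<Rightarrow> bool" where
  "up_inv i s \<longleftrightarrow> s ''m'' 0 = m \<and> s ''b'' 0 = int i * m \<and> scaled i s \<and>
     s ''f'' 0 = (if \<exists>x\<in>E. ceiled i (w x) < 0 then 1 else 0) \<and> bits M = i + bits (halved i M)"

lemma runs_up:
  assumes "up_inv 0 s"
  shows "runs up_prog s ((6 * nat m + 5) * bits M + 1) (\<lambda>s'. \<exists>i\<le>bits M. s' ''b'' 0 = int i * m \<and>
    scaled i s' \<and> (\<forall>x\<in>E. 0 \<le> ceiled i (w x)))"
proof -
  define I where "I = (\<lambda>k s'. \<exists>i. up_inv i s' \<and> k = (6 * nat m + 5) * bits (halved i M))"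
  have "runs up_prog s (Suc ((6 * nat m + 5) * bits M)) (\<lambda>s'. (\<exists>k. I k s') \<and> \<not> bval (pos (var ''f'')) s')"
    unfolding up_prog_def
  proof (rule runs_While)
    show "I ((6 * nat m + 5) * bits M) s" unfolding I_def using assms by (intro exI[of _ 0]) simp
    fix k s' assume "I k s'" and f: "bval (pos (var ''f'')) s'"
    then obtain i where i: "up_inv i s'" "k = (6 * nat m + 5) * bits (halved i M)" unfolding I_def by blast
    then have "\<exists>x\<in>E. ceiled i (w x) < 0" using f unfolding up_inv_def by (auto split: if_splits)
    then have h: "1 \<le> halved i M" using neg_halved by blast
    then have bits: "bits (halved i M) = Suc (bits (halved (Suc i) M))" by (simp add: bits_Suc)
    define Q where "Q = (\<lambda>s1. scaled (Suc i) s1 \<and> s1 ''f'' 0 = (if \<exists>x\<in>E. ceiled (Suc i) (w x) < 0 then 1 else 0) \<and>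
      s1 ''b'' 0 = int i * m \<and> s1 ''m'' 0 = m)"
    define Z where "Z = I ((6 * nat m + 5) * bits (halved (Suc i) M))"
    have "triple (\<lambda>s1. s1 = s') (assign ''f'' (Const 0)) 1 (\<lambda>s1. s1 = s'(''f'' := (s' ''f'')(0 := 0)))"
      using triple_straight[of "assign ''f'' (Const 0)" "\<lambda>s1. s1 = s'" "\<lambda>s1. s1 = s'(''f'' := (s' ''f'')(0 := 0))"] by simp
    also have "triple (\<lambda>s1. s1 = s'(''f'' := (s' ''f'')(0 := 0))) (for_edges up_body) (6 * nat m + 2) Q"
    proof (rule tripleI)
      fix s1 assume s1: "s1 = s'(''f'' := (s' ''f'')(0 := 0))"
      have "scaled i s1" using i(1) by (simp add: s1 up_inv_def scaled_def)
      then have "runs (for_edges up_body) s1 (6 * nat m + 2) (\<lambda>s'. scaled (Suc i) s' \<and>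
        s' ''f'' 0 = (if \<exists>x\<in>E. ceiled (Suc i) (w x) < 0 then 1 else 0))"
        using i(1) by (intro runs_up_edges) (auto simp: s1 up_inv_def)
      then show "runs (for_edges up_body) s1 (6 * nat m + 2) Q"
      proof (rule runs_agree_off[THEN runs_mono])
        fix s2 assume a: "(scaled (Suc i) s2 \<and> s2 ''f'' 0 = (if \<exists>x\<in>E. ceiled (Suc i) (w x) < 0 then 1 else 0)) \<and>
          agree_off (writes (for_edges up_body)) s1 s2"
        then have ag: "agree_off (writes (for_edges up_body)) s1 s2" by blast
        have "s2 ''b'' = s1 ''b''" "s2 ''m'' = s1 ''m''"
          using agree_offD[OF ag] by (auto simp: for_edges_def up_body_def)
        then show "Q s2" using a i(1) by (simp add: Q_def s1 up_inv_def)
      qed simp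
    qed
    also have "triple Q (assign ''b'' (Add (var ''b'') (var ''m''))) 1 Z"
    proof (rule tripleI)
      fix s1 assume s1: "Q s1"
      let ?s = "s1(''b'' := (s1 ''b'')(0 := s1 ''b'' 0 + s1 ''m'' 0))"
      have "up_inv (Suc i) ?s"
        using s1 i(1) bits by (simp add: up_inv_def Q_def scaled_def algebra_simps)
      then have "Z ?s" unfolding Z_def I_def by blast
      then show "runs (assign ''b'' (Add (var ''b'') (var ''m''))) s1 1 Z"
        using runs_straight[of "assign ''b'' (Add (var ''b'') (var ''m''))" Z s1] by simp
    qed
    finally have "runs (assign ''f'' (Const 0) ;; for_edges up_body ;; assign ''b'' (Add (var ''b'') (var ''m''))) s'
      (1 + (6 * nat m + 2) + 1) (I ((6 * nat m + 5) * bits (halved (Suc i) M)))" unfolding triple_def Z_def by blast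
    moreover have "1 + (6 * nat m + 2) + 1 + (6 * nat m + 5) * bits (halved (Suc i) M) < k"
      unfolding i(2) bits by (simp del: halved.simps)
    ultimately show "\<exists>k' B. B + k' < k \<and> runs (assign ''f'' (Const 0) ;; for_edges up_body ;;
      assign ''b'' (Add (var ''b'') (var ''m''))) s' B (I k')" by blast
  qed
  then show ?thesis
  proof (rule runs_mono)
    fix s' assume "(\<exists>k. I k s') \<and> \<not> bval (pos (var ''f'')) s'"
    then obtain i where i: "up_inv i s'" "\<not> 0 < s' ''f'' 0" unfolding I_def by auto
    then have "\<not> (\<exists>x\<in>E. ceiled i (w x) < 0)" unfolding up_inv_def by (auto split: if_splits)
    then show "\<exists>i\<le>bits M. s' ''b'' 0 = int i * m \<and> scaled i s' \<and> (\<forall>x\<in>E. 0 \<le> ceiled i (w x))"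
      using i(1) unfolding up_inv_def by (intro exI[of _ i]) auto
  qed simp
qed

definition down_inv :: "nat \<Rightarrow> store \<Rightarrow> bool" where
  "down_inv i s \<longleftrightarrow> has_arcs s \<and> s ''la'' 0 = 0 \<and> (\<forall>j. s ''bk'' j = 0) \<and> s ''b'' 0 = int i * m \<and> scaled i s \<and>
     (\<forall>e\<in>E. 0 \<le> ceiled i (w e) + s ''y'' (src e) - s ''y'' (dst e)) \<and>
     (\<forall>v\<in>T. s ''y'' v \<le> 0 \<and> 0 \<le> halved i (P0 v) + s ''y'' v)"

definition scale_time :: "nat \<Rightarrow> nat" where
  "scale_time i = (1600 * nat m + 800) * Suc (min (nat (halved i M)) (iters n))"

lemma iters_heads: "iters (card (heads r)) \<le> iters n"
proof -
  have "card (heads r) \<le> card T" by (intro card_mono heads_subset_T) simp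
  then show ?thesis using card_T iters_mono by simp
qed

text \<open>The subtracted 1 is left for the test of the surrounding loop.\<close>

lemma runs_down_body:
  assumes inv: "down_inv (Suc i) s"
  shows "runs down_body s (scale_time i - 1) (down_inv i)"
proof -
  have h: "has_arcs s" "s ''la'' 0 = 0" "\<forall>j. s ''bk'' j = 0" "s ''b'' 0 = int (Suc i) * m" "scaled i s"
    "\<forall>e\<in>E. 0 \<le> ceiled (Suc i) (w e) + s ''y'' (src e) - s ''y'' (dst e)"
    "\<forall>v\<in>T. s ''y'' v \<le> 0 \<and> 0 \<le> halved (Suc i) (P0 v) + s ''y'' v"
    using inv unfolding down_inv_def scaled_def by auto
  have arr: "s ''m'' 0 = m" using h(1) by (simp add: has_arcs_def)
  define Q1 where "Q1 = (\<lambda>s1. agree_off {''b''} s s1 \<and> s1 ''b'' 0 = int i * m)"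
  define Q2 where "Q2 = (\<lambda>s1. agree_off {''b'', ''d'', ''e''} s s1 \<and> s1 ''b'' 0 = int i * m \<and>
    (\<forall>v\<in>T. s1 ''d'' v = - s ''y'' v))"
  define Q3 where "Q3 = (\<lambda>s1. agree_off {''b'', ''d'', ''e'', ''zz'', ''y''} s s1 \<and> s1 ''b'' 0 = int i * m \<and>
    (\<forall>v\<in>T. s1 ''y'' v = 2 * s ''y'' v))"
  have "triple (\<lambda>s1. s1 = s) (assign ''b'' (Sub (var ''b'') (var ''m''))) 1 Q1"
    using triple_straight[of "assign ''b'' (Sub (var ''b'') (var ''m''))" "\<lambda>s1. s1 = s" Q1] h(4) arr
    by (simp add: Q1_def agree_off_def algebra_simps)
  also have "triple Q1 (for_vertices (\<lambda>x. Put ''d'' x (Sub (Const 0) (Get ''y'' x)))) (8 * nat m + 2) Q2"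
  proof (rule triple_set_vertices[where F = "\<lambda>s1 v. - s ''y'' v"])
    fix s1 assume s1: "Q1 s1"
    then have ag: "agree_off {''b''} s s1" by (simp add: Q1_def)
    show "has_arcs s1" by (rule has_arcs_agree[OF ag h(1)]) simp
    fix s2 assume ag2: "agree_off {''d'', ''e''} s1 s2"
    have "s2 ''y'' = s1 ''y''" by (rule agree_offD[OF ag2]) simp
    also have "\<dots> = s ''y''" by (rule agree_offD[OF ag]) simp
    finally show "aval (Sub (Const 0) (Get ''y'' x)) s2 = - s ''y'' (aval x s2)" for x by simp
    have "s2 ''b'' = s1 ''b''" by (rule agree_offD[OF ag2]) simp
    moreover have "agree_off {''b'', ''d'', ''e''} s s2" by (rule agree_off_trans[OF ag ag2]) simp
    moreover assume "s2 ''d'' = (\<lambda>v. if v \<in> T then - s ''y'' v else s1 ''d'' v)"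
    ultimately show "Q2 s2" using s1 by (simp add: Q1_def Q2_def)
  qed simp
  also have "triple Q2 apply_prog (16 * nat m + 4) Q3"
  proof (rule tripleI)
    fix s1 assume s1: "Q2 s1"
    then have ag: "agree_off {''b'', ''d'', ''e''} s s1" by (simp add: Q2_def)
    have a1: "has_arcs s1" by (rule has_arcs_agree[OF ag h(1)]) simp
    have y1: "s1 ''y'' = s ''y''" by (rule agree_offD[OF ag]) simp
    show "runs apply_prog s1 (16 * nat m + 4) Q3"
    proof (rule runs_apply[OF a1, THEN runs_mono])
      fix s2 assume k: "agree_off {''e'', ''zz'', ''y''} s1 s2 \<and> (\<forall>v\<in>T. s2 ''y'' v = s1 ''y'' v - s1 ''d'' v) \<and>
        (\<forall>e\<in>E. rw s2 e = shifted (rw s1) (s1 ''d'') e)"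
      then have ag2: "agree_off {''e'', ''zz'', ''y''} s1 s2" by blast
      have "s2 ''b'' = s1 ''b''" by (rule agree_offD[OF ag2]) simp
      moreover have "agree_off {''b'', ''d'', ''e'', ''zz'', ''y''} s s2" by (rule agree_off_trans[OF ag ag2]) auto
      ultimately show "Q3 s2" using k s1 y1 by (simp add: Q2_def Q3_def)
    qed simp
  qed
  also have "triple Q3 unit_prog ((1500 * nat m + 701) * Suc (min (nat (halved i M)) (iters n)) + 2) (down_inv i)"
  proof (rule tripleI)
    fix s1 assume s1: "Q3 s1"
    then have ag: "agree_off {''b'', ''d'', ''e'', ''zz'', ''y''} s s1" by (simp add: Q3_def)
    have a1: "has_arcs s1" by (rule has_arcs_agree[OF ag h(1)]) simp
    have eq: "s1 ''q'' = s ''q''" "s1 ''la'' = s ''la''" "s1 ''bk'' = s ''bk''" using agree_offD[OF ag] by auto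
    have b1: "s1 ''b'' 0 = int i * m" and y1: "\<forall>v\<in>T. s1 ''y'' v = 2 * s ''y'' v" using s1 by (auto simp: Q3_def)
    have sc1: "scaled i s1" using h(5) eq by (simp add: scaled_def)
    have r1: "rw s1 e = ceiled i (w e) + s1 ''y'' (src e) - s1 ''y'' (dst e)" if "e \<in> E" for e
      using sc1 b1 that by (simp add: rw_def scaled_def)
    let ?P = "\<lambda>v. if v \<in> T then halved i (P0 v) + s1 ''y'' v else 0"
    have W: "weighted m src dst oh on ih inx outs ins (rw s1) ?P"
    proof unfold_locales
      fix v
      have "0 \<le> halved i (P0 v) + 2 * s ''y'' v" if "v \<in> T"
      proof -
        have "0 \<le> halved i (P0 v) div 2 + s ''y'' v" using h(7) that by simp
        then show ?thesis by linarith
      qed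
      then show "0 \<le> ?P v" using y1 by simp
    next
      fix e assume e: "e \<in> E"
      show "?P (src e) \<le> rw s1 e + ?P (dst e)"
        using halved_feasible[OF P0_feasible[OF e], of i] r1[OF e] e by simp
    qed
    have "unit_inv (\<lambda>v. halved i (P0 v)) (halved i M) s1"
      unfolding unit_inv_def
    proof (intro conjI exI[of _ ?P] ballI)
      show "has_arcs s1" "s1 ''la'' 0 = 0" "\<forall>j. s1 ''bk'' j = 0" using a1 eq h by auto
      show "weighted m src dst oh on ih inx outs ins (rw s1) ?P" by (rule W)
      fix v assume v: "v \<in> T"
      show "s1 ''y'' v \<le> 0" using y1 h(7) v by auto
      then show "?P v \<le> halved i M" using v halved_mono[OF P0_le, of i v] by simp
      show "?P v \<le> halved i (P0 v) + s1 ''y'' v" using v by simp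
    next
      fix e assume e: "e \<in> E"
      \<comment> \<open>Twice the rounded-up half exceeds the length by at most 1. Doubling this
        inequality therefore gives the bound \<open>- 1\<close> with which a scale has to
        start.\<close>
      have "0 \<le> (ceiled i (w e) + 1) div 2 + s ''y'' (src e) - s ''y'' (dst e)" using h(6) e by simp
      then show "- 1 \<le> rw s1 e" using r1[OF e] y1 e by simp
    qed
    from runs_unit[OF this halved_nonneg[OF M_nonneg]]
    show "runs unit_prog s1 ((1500 * nat m + 701) * Suc (min (nat (halved i M)) (iters n)) + 2) (down_inv i)"
    proof (rule runs_agree_off[THEN runs_mono])
      have "Suc (min (nat (halved i M)) (iters (card (heads (rw s1))))) \<le> Suc (min (nat (halved i M)) (iters n))"
        using iters_heads[of "rw s1"] by auto
      then show "(1500 * nat m + 701) * Suc (min (nat (halved i M)) (iters (card (heads (rw s1))))) + 2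
        \<le> (1500 * nat m + 701) * Suc (min (nat (halved i M)) (iters n)) + 2"
        by (intro add_mono mult_le_mono2) auto
      fix s2 assume k: "(unit_inv (\<lambda>v. halved i (P0 v)) (halved i M) s2 \<and> heads (rw s2) = {}) \<and>
        agree_off (writes unit_prog) s1 s2"
      then have ag2: "agree_off (writes unit_prog) s1 s2" by blast
      have eq2: "s2 ''q'' = s1 ''q''" "s2 ''b'' = s1 ''b''" using agree_off_keep[OF ag2 writes_unit] by auto
      obtain P where P: "weighted m src dst oh on ih inx outs ins (rw s2) P" "\<forall>v\<in>T. P v \<le> halved i (P0 v) + s2 ''y'' v"
        using k by (auto simp: unit_inv_def)
      interpret wp: weighted m src dst oh on ih inx outs ins "rw s2" P by (rule P(1))
      have sc2: "scaled i s2" using sc1 eq2 by (simp add: scaled_def)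
      have r2: "rw s2 e = ceiled i (w e) + s2 ''y'' (src e) - s2 ''y'' (dst e)" if "e \<in> E" for e
        using sc2 eq2 b1 that by (simp add: rw_def scaled_def)
      have "0 \<le> rw s2 e" if "e \<in> E" for e using k that by (force simp: heads_def)
      then have "\<forall>e\<in>E. 0 \<le> ceiled i (w e) + s2 ''y'' (src e) - s2 ''y'' (dst e)" using r2 by simp
      moreover have "0 \<le> halved i (P0 v) + s2 ''y'' v" if "v \<in> T" for v
        using P(2) wp.P_nonneg[of v] that by force
      ultimately show "down_inv i s2"
        using k eq2 b1 sc2 unfolding down_inv_def unit_inv_def by auto
    qed
  qed
  finally have "runs down_body s (1 + (8 * nat m + 2) + (16 * nat m + 4) +
      ((1500 * nat m + 701) * Suc (min (nat (halved i M)) (iters n)) + 2)) (down_inv i)"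
    unfolding down_body_def triple_def by blast
  then show ?thesis
    by (rule runs_mono) (auto simp: scale_time_def algebra_simps)
qed

lemma runs_down:
  assumes "down_inv i s"
  shows "runs down_prog s (Suc (\<Sum>j<i. scale_time j)) (\<lambda>s'. has_arcs s' \<and>
    (\<forall>e\<in>E. 0 \<le> w e + s' ''y'' (src e) - s' ''y'' (dst e)))"
proof -
  define I where "I = (\<lambda>k s'. \<exists>i. down_inv i s' \<and> k = (\<Sum>j<i. scale_time j))"
  have "runs down_prog s (Suc (\<Sum>j<i. scale_time j)) (\<lambda>s'. (\<exists>k. I k s') \<and> \<not> bval (pos (var ''b'')) s')"
    unfolding down_prog_def
  proof (rule runs_While)
    show "I (\<Sum>j<i. scale_time j) s" unfolding I_def using assms by blast
    fix k s' assume "I k s'" and b: "bval (pos (var ''b'')) s'"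
    then obtain i where i: "down_inv i s'" "k = (\<Sum>j<i. scale_time j)" unfolding I_def by blast
    have "0 < int i * m" using i(1) b by (simp add: down_inv_def)
    then obtain i' where i': "i = Suc i'" by (cases i) auto
    have "runs down_body s' (scale_time i' - 1) (I (\<Sum>j<i'. scale_time j))"
      by (rule runs_down_body[THEN runs_mono]) (use i(1) i' in \<open>auto simp: I_def\<close>)
    moreover have "0 < scale_time i'" by (simp add: scale_time_def)
    then have "scale_time i' - 1 + (\<Sum>j<i'. scale_time j) < k" unfolding i(2) i' by simp
    ultimately show "\<exists>k' B. B + k' < k \<and> runs down_body s' B (I k')" by blast
  qed
  then show ?thesis
  proof (rule runs_mono)
    fix s' assume "(\<exists>k. I k s') \<and> \<not> bval (pos (var ''b'')) s'"
    then obtain i where i: "down_inv i s'" "\<not> 0 < int i * m" unfolding I_def down_inv_def by auto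
    \<comment> \<open>Without edges \<open>b\<close> is 0 at every scale and the claim is vacuous;
      with an edge, \<open>b = 0\<close> identifies scale 0.\<close>
    have "i = 0" if "e \<in> E" for e
    proof -
      have "0 < m" using that by (simp add: E_def)
      then show ?thesis using i(2) by (cases i) auto
    qed
    then show "has_arcs s' \<and> (\<forall>e\<in>E. 0 \<le> w e + s' ''y'' (src e) - s' ''y'' (dst e))"
      using i(1) unfolding down_inv_def by auto
  qed simp
qed

lemma runs_finish:
  assumes h: "has_arcs s" and r: "\<forall>e\<in>E. 0 \<le> w e + s ''y'' (src e) - s ''y'' (dst e)"
  shows "runs finish_prog s (24 * nat m + 6) (\<lambda>s'. \<forall>e\<in>E. 0 \<le> w e + (s' ''y'' (src e) - s ''y0'' (src e)) -
    (s' ''y'' (dst e) - s ''y0'' (dst e)))"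
proof -
  define Q where "Q = (\<lambda>s1. agree_off {''d'', ''e''} s s1 \<and> (\<forall>v\<in>T. s1 ''d'' v = - s ''y0'' v))"
  define Z where "Z = (\<lambda>s'. \<forall>e\<in>E. 0 \<le> w e + (s' ''y'' (src e) - s ''y0'' (src e)) -
    (s' ''y'' (dst e) - s ''y0'' (dst e)))"
  have "triple (\<lambda>s1. s1 = s) (for_vertices (\<lambda>x. Put ''d'' x (Sub (Const 0) (Get ''y0'' x)))) (8 * nat m + 2) Q"
  proof (rule triple_set_vertices[where F = "\<lambda>s1 v. - s ''y0'' v"])
    fix s1 s2 assume s1: "s1 = s" and ag2: "agree_off {''d'', ''e''} s1 s2"
    have "s2 ''y0'' = s ''y0''" unfolding s1[symmetric] by (rule agree_offD[OF ag2]) simp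
    then show "aval (Sub (Const 0) (Get ''y0'' x)) s2 = - s ''y0'' (aval x s2)" for x by simp
    assume "s2 ''d'' = (\<lambda>v. if v \<in> T then - s ''y0'' v else s1 ''d'' v)"
    then show "Q s2" using ag2 s1 by (simp add: Q_def)
  qed (use h in auto)
  also have "triple Q apply_prog (16 * nat m + 4) Z"
  proof (rule tripleI)
    fix s1 assume s1: "Q s1"
    then have ag: "agree_off {''d'', ''e''} s s1" by (simp add: Q_def)
    have a1: "has_arcs s1" by (rule has_arcs_agree[OF ag h]) simp
    have y1: "s1 ''y'' = s ''y''" by (rule agree_offD[OF ag]) simp
    show "runs apply_prog s1 (16 * nat m + 4) Z"
      by (rule runs_apply[OF a1, THEN runs_mono]) (use s1 y1 r in \<open>auto simp: Q_def Z_def\<close>)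
  qed
  finally show ?thesis unfolding finish_prog_def triple_def Z_def by (auto elim!: runs_mono)
qed

lemma runs_solve:
  assumes h: "has_arcs s" "s ''la'' 0 = 0" "\<forall>j. s ''bk'' j = 0" "s ''b'' 0 = 0"
    and q: "\<forall>x\<in>E. s ''q'' x = w x" and f: "s ''f'' 0 = (if \<exists>x\<in>E. w x < 0 then 1 else 0)"
  shows "runs solve_prog s (32 * nat m + 10 + (6 * nat m + 5) * bits M + (\<Sum>j<bits M. scale_time j))
    (\<lambda>s'. \<forall>e\<in>E. 0 \<le> w e + (s' ''y'' (src e) - s ''y0'' (src e)) - (s' ''y'' (dst e) - s ''y0'' (dst e)))"
proof -
  define Z where "Z = (\<lambda>s'. \<forall>e\<in>E. 0 \<le> w e + (s' ''y'' (src e) - s ''y0'' (src e)) -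
    (s' ''y'' (dst e) - s ''y0'' (dst e)))"
  define Q1 where "Q1 = (\<lambda>s1. up_inv 0 s1 \<and> has_arcs s1 \<and> s1 ''la'' 0 = 0 \<and> (\<forall>j. s1 ''bk'' j = 0) \<and>
    (\<forall>v\<in>T. s1 ''y'' v = 0) \<and> s1 ''y0'' = s ''y0'')"
  define Q2 where "Q2 = (\<lambda>s1. (\<exists>i\<le>bits M. down_inv i s1) \<and> s1 ''y0'' = s ''y0'')"
  define Q3 where "Q3 = (\<lambda>s1. has_arcs s1 \<and> (\<forall>e\<in>E. 0 \<le> w e + s1 ''y'' (src e) - s1 ''y'' (dst e)) \<and>
    s1 ''y0'' = s ''y0'')"
  have "triple (\<lambda>s1. s1 = s) (for_vertices (\<lambda>x. Put ''y'' x (Const 0))) (8 * nat m + 2) Q1"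
  proof (rule triple_set_vertices[where F = "\<lambda>s1 v. 0"])
    fix s1 s2 assume s1: "s1 = s" and ag: "agree_off {''y'', ''e''} s1 s2"
      and y: "s2 ''y'' = (\<lambda>v. if v \<in> T then 0 else s1 ''y'' v)"
    have a2: "has_arcs s2" by (rule has_arcs_agree[OF ag]) (use h s1 in auto)
    have "s2 ''la'' = s ''la''" "s2 ''bk'' = s ''bk''" "s2 ''b'' = s ''b''" "s2 ''q'' = s ''q''" "s2 ''f'' = s ''f''"
      "s2 ''y0'' = s ''y0''" using agree_offD[OF ag] s1 by auto
    then show "Q1 s2" using a2 y h q f by (auto simp: Q1_def up_inv_def scaled_def has_arcs_def)
  qed (use h in auto)
  also have "triple Q1 up_prog ((6 * nat m + 5) * bits M + 1) Q2"
  proof (rule tripleI)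
    fix s1 assume s1: "Q1 s1"
    then have u: "up_inv 0 s1" by (simp add: Q1_def)
    show "runs up_prog s1 ((6 * nat m + 5) * bits M + 1) Q2"
    proof (rule runs_up[OF u, THEN runs_agree_off, THEN runs_mono])
      fix s2 assume k: "(\<exists>i\<le>bits M. s2 ''b'' 0 = int i * m \<and> scaled i s2 \<and> (\<forall>x\<in>E. 0 \<le> ceiled i (w x))) \<and>
        agree_off (writes up_prog) s1 s2"
      then obtain i where i: "i \<le> bits M" "s2 ''b'' 0 = int i * m" "scaled i s2" "\<forall>x\<in>E. 0 \<le> ceiled i (w x)" by blast
      have ag: "agree_off (writes up_prog) s1 s2" using k by blast
      have a2: "has_arcs s2" by (rule has_arcs_keep[OF ag writes_up]) (use s1 in \<open>auto simp: Q1_def\<close>)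
      have "s2 ''la'' = s1 ''la''" "s2 ''bk'' = s1 ''bk''" "s2 ''y'' = s1 ''y''" "s2 ''y0'' = s1 ''y0''"
        using agree_off_keep[OF ag writes_up] by auto
      \<comment> \<open>The zero dual is feasible at the last scale because none of its lengths is
        negative.\<close>
      then have "down_inv i s2" using a2 i s1 halved_nonneg[OF P0_nonneg, of i]
        by (auto simp: down_inv_def Q1_def)
      then show "Q2 s2" using i(1) s1 \<open>s2 ''y0'' = s1 ''y0''\<close> by (auto simp: Q1_def Q2_def)
    qed simp
  qed
  also have "triple Q2 down_prog (Suc (\<Sum>j<bits M. scale_time j)) Q3"
  proof (rule tripleI)
    fix s1 assume s1: "Q2 s1"
    then obtain i where i: "i \<le> bits M" "down_inv i s1" by (auto simp: Q2_def)
    show "runs down_prog s1 (Suc (\<Sum>j<bits M. scale_time j)) Q3"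
    proof (rule runs_down[OF i(2), THEN runs_agree_off, THEN runs_mono])
      show "Suc (\<Sum>j<i. scale_time j) \<le> Suc (\<Sum>j<bits M. scale_time j)"
        using i(1) by (simp add: sum_mono2)
      fix s2 assume k: "(has_arcs s2 \<and> (\<forall>e\<in>E. 0 \<le> w e + s2 ''y'' (src e) - s2 ''y'' (dst e))) \<and>
        agree_off (writes down_prog) s1 s2"
      then have ag: "agree_off (writes down_prog) s1 s2" by blast
      have "s2 ''y0'' = s1 ''y0''" using agree_off_keep[OF ag writes_down] by auto
      then show "Q3 s2" using k s1 by (simp add: Q2_def Q3_def)
    qed
  qed
  also have "triple Q3 finish_prog (24 * nat m + 6) Z"
  proof (rule tripleI)
    fix s1 assume s1: "Q3 s1"
    then have k: "has_arcs s1" "\<forall>e\<in>E. 0 \<le> w e + s1 ''y'' (src e) - s1 ''y'' (dst e)" by (auto simp: Q3_def)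
    show "runs finish_prog s1 (24 * nat m + 6) Z"
      by (rule runs_finish[OF k, THEN runs_mono]) (use s1 in \<open>auto simp: Q3_def Z_def\<close>)
  qed
  finally show ?thesis unfolding solve_prog_def triple_def Z_def by (auto elim!: runs_mono)
qed

end

section \<open>Initialization\<close>

text \<open>The adjacency list after \<open>i\<close> edges, in the order in which pushing at the
  front leaves it.\<close>

definition keyed :: "(int \<Rightarrow> int) \<Rightarrow> int \<Rightarrow> int \<Rightarrow> int list" where
  "keyed key i v = filter (\<lambda>x. key x = v) (rev [0..i - 1])"

lemma keyed_0 [simp]: "keyed key 0 v = []"
  by (simp add: keyed_def)

lemma keyed_Suc: "0 \<le> i \<Longrightarrow> keyed key (i + 1) v = (if key i = v then i # keyed key i v else keyed key i v)"
  by (simp add: keyed_def upto_rec2)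

lemma keyed_props: "distinct (keyed key i v)" "set (keyed key i v) = {e \<in> {0..<i}. key e = v}"
  by (auto simp: keyed_def)

lemma linked_push:
  assumes "\<forall>v. linked nx (h v) (keyed key i v)" "0 \<le> i"
  shows "\<forall>v. linked (nx(i := h (key i))) ((h(key i := i + 1)) v) (keyed key (i + 1) v)"
proof
  fix v
  have "i \<notin> set (keyed key i v)" by (simp add: keyed_props)
  then show "linked (nx(i := h (key i))) ((h(key i := i + 1)) v) (keyed key (i + 1) v)"
    using assms by (auto simp: keyed_Suc)
qed

definition init_body :: com where
  "init_body =
     (Put ''on'' (var ''e'') (Get ''oh'' (Get ''src'' (var ''e''))) ;;
      Put ''oh'' (Get ''src'' (var ''e'')) (plus1 (var ''e'')) ;;
      Put ''in'' (var ''e'') (Get ''ih'' (Get ''dst'' (var ''e''))) ;;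
      Put ''ih'' (Get ''dst'' (var ''e'')) (plus1 (var ''e'')) ;;
      Put ''q'' (var ''e'') (Sub (Add (Get ''len'' (var ''e'')) (Get ''y'' (Get ''src'' (var ''e''))))
        (Get ''y'' (Get ''dst'' (var ''e'')))) ;;
      Put ''y0'' (Get ''src'' (var ''e'')) (Get ''y'' (Get ''src'' (var ''e''))) ;;
      Put ''y0'' (Get ''dst'' (var ''e'')) (Get ''y'' (Get ''dst'' (var ''e''))) ;;
      Cond (Less (Get ''q'' (var ''e'')) (Const 0)) (assign ''f'' (Const 1)) Skip)"

definition main_prog :: com where
  "main_prog = (for_edges init_body ;; solve_prog)"

lemma runs_init:
  fixes m :: int
  assumes m: "s ''m'' 0 = m" "0 \<le> m" and z: "s ''oh'' = (\<lambda>_. 0)" "s ''ih'' = (\<lambda>_. 0)" "s ''f'' 0 = 0"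
  defines "src \<equiv> s ''src''" and "dst \<equiv> s ''dst''"
  defines "w \<equiv> \<lambda>e. s ''len'' e + s ''y'' (src e) - s ''y'' (dst e)"
  shows "runs (for_edges init_body) s (11 * nat m + 2) (\<lambda>s'.
    agree_off (insert ''e'' (writes init_body)) s s' \<and>
    arcs m src dst (s' ''oh'') (s' ''on'') (s' ''ih'') (s' ''in'') (keyed src m) (keyed dst m) \<and>
    (\<forall>x\<in>{0..<m}. s' ''q'' x = w x \<and> s' ''y0'' (src x) = s ''y'' (src x) \<and> s' ''y0'' (dst x) = s ''y'' (dst x)) \<and>
    s' ''f'' 0 = (if \<exists>x\<in>{0..<m}. w x < 0 then 1 else 0))"
proof -
  define I where "I = (\<lambda>i s'. (\<forall>v. linked (s' ''on'') (s' ''oh'' v) (keyed src i v)) \<and>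
    (\<forall>v. linked (s' ''in'') (s' ''ih'' v) (keyed dst i v)) \<and>
    (\<forall>x\<in>{0..<i}. s' ''q'' x = w x \<and> s' ''y0'' (src x) = s ''y'' (src x) \<and> s' ''y0'' (dst x) = s ''y'' (dst x)) \<and>
    s' ''f'' 0 = (if \<exists>x\<in>{0..<i}. w x < 0 then 1 else 0))"
  have "runs (for_edges init_body) s ((step_bound init_body + 2) * nat m + 2) (I m)"
  proof (rule runs_for_edges)
    show "straight init_body" "''e'' \<notin> writes init_body" "''m'' \<notin> writes init_body" by (auto simp: init_body_def)
    show "s ''m'' 0 = m" "0 \<le> m" by fact+
    show "I 0 (s(''e'' := (s ''e'')(0 := 0)))" using z by (simp add: I_def)
    fix i s' assume I: "I i s'" and i: "0 \<le> i" "i < m" "s' ''e'' 0 = i"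
      and ag: "agree_off (insert ''e'' (writes init_body)) s s'"
    have eq: "s' ''src'' = src" "s' ''dst'' = dst" "s' ''len'' = s ''len''" "s' ''y'' = s ''y''"
      using agree_offD[OF ag] by (auto simp: init_body_def src_def dst_def)
    let ?r = "result (init_body ;; assign ''e'' (plus1 (var ''e''))) s'"
    have wi: "s ''len'' i + s ''y'' (src i) - s ''y'' (dst i) = w i" by (simp add: w_def)
    have r: "?r ''on'' = (s' ''on'')(i := s' ''oh'' (src i))" "?r ''oh'' = (s' ''oh'')(src i := i + 1)"
      "?r ''in'' = (s' ''in'')(i := s' ''ih'' (dst i))" "?r ''ih'' = (s' ''ih'')(dst i := i + 1)"
      "?r ''q'' = (s' ''q'')(i := w i)"
      "?r ''y0'' = (s' ''y0'')(src i := s ''y'' (src i), dst i := s ''y'' (dst i))"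
      "?r ''f'' 0 = (if w i < 0 then 1 else s' ''f'' 0)"
      using eq i(3) wi by (auto simp: init_body_def)
    have sp: "{0..<i + 1} = insert i {0..<i}" using i by auto
    show "I (i + 1) ?r"
      unfolding I_def r
    proof (intro conjI)
      show "\<forall>v. linked ((s' ''on'')(i := s' ''oh'' (src i))) (((s' ''oh'')(src i := i + 1)) v) (keyed src (i + 1) v)"
        using linked_push[of "s' ''on''" "s' ''oh''" src i] I i by (simp add: I_def)
      show "\<forall>v. linked ((s' ''in'')(i := s' ''ih'' (dst i))) (((s' ''ih'')(dst i := i + 1)) v) (keyed dst (i + 1) v)"
        using linked_push[of "s' ''in''" "s' ''ih''" dst i] I i by (simp add: I_def)
      show "\<forall>x\<in>{0..<i + 1}. ((s' ''q'')(i := w i)) x = w x \<and>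
        ((s' ''y0'')(src i := s ''y'' (src i), dst i := s ''y'' (dst i))) (src x) = s ''y'' (src x) \<and>
        ((s' ''y0'')(src i := s ''y'' (src i), dst i := s ''y'' (dst i))) (dst x) = s ''y'' (dst x)"
        using I i unfolding sp I_def by auto
      show "(if w i < 0 then 1 else s' ''f'' 0) = (if \<exists>x\<in>{0..<i + 1}. w x < 0 then 1 else 0)"
        using I unfolding sp I_def by auto
    qed
  qed
  then show ?thesis
  proof (rule runs_agree_off[THEN runs_mono])
    show "(step_bound init_body + 2) * nat m + 2 \<le> 11 * nat m + 2" by (simp add: init_body_def)
    fix s' assume a: "I m s' \<and> agree_off (writes (for_edges init_body)) s s'"
    have "arcs m src dst (s' ''oh'') (s' ''on'') (s' ''ih'') (s' ''in'') (keyed src m) (keyed dst m)"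
      by unfold_locales (use a m in \<open>auto simp: I_def keyed_props\<close>)
    moreover have "agree_off (insert ''e'' (writes init_body)) s s'"
      using a by (auto simp: agree_off_def for_edges_def)
    ultimately show "agree_off (insert ''e'' (writes init_body)) s s' \<and>
      arcs m src dst (s' ''oh'') (s' ''on'') (s' ''ih'') (s' ''in'') (keyed src m) (keyed dst m) \<and>
      (\<forall>x\<in>{0..<m}. s' ''q'' x = w x \<and> s' ''y0'' (src x) = s ''y'' (src x) \<and> s' ''y0'' (dst x) = s ''y'' (dst x)) \<and>
      s' ''f'' 0 = (if \<exists>x\<in>{0..<m}. w x < 0 then 1 else 0)"
      using a by (simp add: I_def)
  qed
qed

text \<open>The part \<open>43 * m + 12\<close> collects the initialization and the passes made
  once; the rest is charged per scale and per round.\<close>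

definition total_time :: "nat \<Rightarrow> nat \<Rightarrow> int \<Rightarrow> nat" where
  "total_time m n M = 43 * m + 12 + (6 * m + 5) * bits M +
     (\<Sum>j<bits M. (1600 * m + 800) * Suc (min (nat (halved j M)) (iters n)))"

lemma runs_main:
  fixes m :: int
  assumes m: "s ''m'' 0 = m" "0 \<le> m" and z: "s ''oh'' = (\<lambda>_. 0)" "s ''ih'' = (\<lambda>_. 0)" "s ''f'' 0 = 0"
    "s ''la'' 0 = 0" "\<forall>j. s ''bk'' j = 0" "s ''b'' 0 = 0"
  defines "src \<equiv> s ''src''" and "dst \<equiv> s ''dst''"
  assumes Q: "\<And>v. 0 \<le> Q v" "\<And>v. Q v \<le> M"
    "\<And>e. 0 \<le> e \<Longrightarrow> e < m \<Longrightarrow> Q (src e) \<le> s ''len'' e + s ''y'' (src e) - s ''y'' (dst e) + Q (dst e)"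
    and n: "card (src ` {0..<m} \<union> dst ` {0..<m}) \<le> n"
  shows "runs main_prog s (total_time (nat m) n M)
    (\<lambda>s'. \<forall>e\<in>{0..<m}. 0 \<le> s ''len'' e + s' ''y'' (src e) - s' ''y'' (dst e))"
proof -
  define w where "w = (\<lambda>e. s ''len'' e + s ''y'' (src e) - s ''y'' (dst e))"
  have "runs main_prog s (11 * nat m + 2 + (32 * nat m + 10 + (6 * nat m + 5) * bits M +
      (\<Sum>j<bits M. (1600 * nat m + 800) * Suc (min (nat (halved j M)) (iters n)))))
    (\<lambda>s'. \<forall>e\<in>{0..<m}. 0 \<le> s ''len'' e + s' ''y'' (src e) - s' ''y'' (dst e))"
    unfolding main_prog_def
  proof (rule runs_Seq)
    show "runs (for_edges init_body) s (11 * nat m + 2) (\<lambda>s'.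
      agree_off (insert ''e'' (writes init_body)) s s' \<and>
      arcs m src dst (s' ''oh'') (s' ''on'') (s' ''ih'') (s' ''in'') (keyed src m) (keyed dst m) \<and>
      (\<forall>x\<in>{0..<m}. s' ''q'' x = w x \<and> s' ''y0'' (src x) = s ''y'' (src x) \<and> s' ''y0'' (dst x) = s ''y'' (dst x)) \<and>
      s' ''f'' 0 = (if \<exists>x\<in>{0..<m}. w x < 0 then 1 else 0))"
      unfolding w_def src_def dst_def by (rule runs_init[OF m z(1-3)])
    fix s1 assume a: "agree_off (insert ''e'' (writes init_body)) s s1 \<and>
      arcs m src dst (s1 ''oh'') (s1 ''on'') (s1 ''ih'') (s1 ''in'') (keyed src m) (keyed dst m) \<and>
      (\<forall>x\<in>{0..<m}. s1 ''q'' x = w x \<and> s1 ''y0'' (src x) = s ''y'' (src x) \<and> s1 ''y0'' (dst x) = s ''y'' (dst x)) \<and>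
      s1 ''f'' 0 = (if \<exists>x\<in>{0..<m}. w x < 0 then 1 else 0)"
    then have ag: "agree_off (insert ''e'' (writes init_body)) s s1" by blast
    have eq: "s1 ''m'' = s ''m''" "s1 ''src'' = src" "s1 ''dst'' = dst" "s1 ''la'' = s ''la''"
      "s1 ''bk'' = s ''bk''" "s1 ''b'' = s ''b''"
      using agree_offD[OF ag] by (auto simp: init_body_def src_def dst_def)
    interpret arcs m src dst "s1 ''oh''" "s1 ''on''" "s1 ''ih''" "s1 ''in''" "keyed src m" "keyed dst m"
      using a by blast
    interpret sc: scaling m src dst "s1 ''oh''" "s1 ''on''" "s1 ''ih''" "s1 ''in''" "keyed src m" "keyed dst m" w Q M n
      by unfold_locales (use Q n in \<open>auto simp: w_def E_def T_def\<close>)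
    have h: "has_arcs s1" using eq m by (simp add: has_arcs_def)
    show "runs solve_prog s1 (32 * nat m + 10 + (6 * nat m + 5) * bits M +
      (\<Sum>j<bits M. (1600 * nat m + 800) * Suc (min (nat (halved j M)) (iters n))))
      (\<lambda>s'. \<forall>e\<in>{0..<m}. 0 \<le> s ''len'' e + s' ''y'' (src e) - s' ''y'' (dst e))"
      unfolding sc.scale_time_def[symmetric]
    proof (rule sc.runs_solve[THEN runs_mono])
      show "has_arcs s1" "s1 ''la'' 0 = 0" "\<forall>j. s1 ''bk'' j = 0" "s1 ''b'' 0 = 0"
        "\<forall>x\<in>E. s1 ''q'' x = w x" "s1 ''f'' 0 = (if \<exists>x\<in>E. w x < 0 then 1 else 0)"
        using h eq z a by (auto simp: E_def)
      fix s' assume k: "\<forall>e\<in>E. 0 \<le> w e + (s' ''y'' (src e) - s1 ''y0'' (src e)) - (s' ''y'' (dst e) - s1 ''y0'' (dst e))"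
      show "\<forall>e\<in>{0..<m}. 0 \<le> s ''len'' e + s' ''y'' (src e) - s' ''y'' (dst e)"
      proof
        fix e assume e: "e \<in> {0..<m}"
        then have "s1 ''y0'' (src e) = s ''y'' (src e)" "s1 ''y0'' (dst e) = s ''y'' (dst e)" using a by auto
        moreover have "0 \<le> w e + (s' ''y'' (src e) - s1 ''y0'' (src e)) - (s' ''y'' (dst e) - s1 ''y0'' (dst e))"
          using k e by (simp add: E_def)
        ultimately show "0 \<le> s ''len'' e + s' ''y'' (src e) - s' ''y'' (dst e)"
          unfolding w_def by linarith
      qed
    qed simp
  qed
  then show ?thesis by (rule runs_mono) (auto simp: total_time_def)
qed

section \<open>The running time\<close>

text \<open>The number \<open>B\<close> of scales and the number \<open>S\<close> of rounds are both
  bounded by both terms of the minimum: through the geometric sum and \<open>1 \<le> d1\<close> on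
  one side, through the digit count and \<open>iters n\<close> on the other. For
  \<open>D = 0\<close> there is no scale at all.\<close>

lemma total_time_bound:
  assumes D: "0 \<le> D" and m0: "m = 0 \<Longrightarrow> D = 0" and n: "1 \<le> m \<Longrightarrow> 1 \<le> n" and d1: "1 \<le> D \<Longrightarrow> 1 \<le> d1"
  shows "real (total_time m n (2 * D)) \<le> 30000 * (1 + real m * (1 + time_factor n d1 D))"
proof (cases "D = 0")
  case True
  then show ?thesis by (simp add: total_time_def time_factor_def)
next
  case False
  then have D1: "1 \<le> D" and m1: "1 \<le> m" using D m0 by (auto simp: Suc_le_eq)
  define B where "B = bits (2 * D)"
  define lg where "lg = log 2 (1 + real_of_int D)"
  define rn where "rn = sqrt (real n)"
  define tf where "tf = time_factor n d1 D"
  define h where "h = (\<lambda>j. nat (halved j (2 * D)))"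
  define S where "S = (\<Sum>j<B. Suc (min (h j) (iters n)))"
  have lg1: "1 \<le> lg"
  proof -
    have "log 2 2 \<le> log 2 (1 + real_of_int D)" using D1 by (subst log_le_cancel_iff) auto
    then show ?thesis by (simp add: lg_def)
  qed
  have rn1: "1 \<le> rn" using n m1 by (simp add: rn_def)
  have hpos: "1 \<le> h j" if "j < B" for j using halved_pos[of j "2 * D"] that by (simp add: h_def B_def)
  have sumh: "real (\<Sum>j<B. h j) \<le> 4 * real_of_int D"
  proof -
    have "int (\<Sum>j<B. h j) = (\<Sum>j<B. halved j (2 * D))"
      using D by (simp add: h_def halved_nonneg)
    also have "\<dots> \<le> 4 * D" using sum_halved[of "2 * D"] D by (simp add: B_def)
    finally show ?thesis by linarith
  qed
  have "B = (\<Sum>j<B. 1)" by simp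
  also have "\<dots> \<le> (\<Sum>j<B. h j)" by (intro sum_mono) (use hpos in force)
  finally have BD: "real B \<le> 4 * real_of_int D" using sumh by linarith
  \<comment> \<open>From \<open>2 ^ B \<le> 4 D\<close> one gets \<open>B \<le> 2 + log 2 D\<close>;
    the constant 2 is absorbed because \<open>lg\<close> is at least 1.\<close>
  have Blg: "real B \<le> 3 * lg"
  proof -
    have "(2 :: int) ^ B \<le> 4 * D" using bits_le[of "2 * D"] D1 by (simp add: B_def)
    then have "real_of_int (2 ^ B) \<le> real_of_int (4 * D)" by linarith
    then have "2 ^ B \<le> 4 * real_of_int D" by simp
    then have "log 2 (2 ^ B) \<le> log 2 (4 * real_of_int D)" using D1 by (subst log_le_cancel_iff) auto
    also have "\<dots> = log 2 4 + log 2 (real_of_int D)" using D1 by (simp add: log_mult)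
    also have "log 2 (4 :: real) = 2" using log_pow_cancel[of "2 :: real" 2] by simp
    also have "log 2 (real_of_int D) \<le> lg" unfolding lg_def using D1 by (subst log_le_cancel_iff) auto
    finally have "real B \<le> 2 + lg" by simp
    then show ?thesis using lg1 by linarith
  qed
  have it: "real (iters n) \<le> 2 * rn" unfolding iters_def rn_def using of_nat_floor[of "2 * sqrt (real n)"] by simp
  have S1: "real S \<le> 8 * real_of_int D"
  proof -
    have "S \<le> (\<Sum>j<B. 1 + h j)" unfolding S_def by (intro sum_mono) auto
    also have "\<dots> = B + (\<Sum>j<B. h j)" by (simp only: sum.distrib) simp
    finally have "real S \<le> real B + real (\<Sum>j<B. h j)" by (metis of_nat_add of_nat_mono)
    then show ?thesis using BD sumh by linarith
  qed
  have S2: "real S \<le> 9 * (rn * lg)"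
  proof -
    have "S \<le> (\<Sum>j<B. 1 + iters n)" unfolding S_def by (intro sum_mono) auto
    then have "S \<le> B * (1 + iters n)" by simp
    then have "real S \<le> real B * (1 + real (iters n))" by (metis of_nat_1 of_nat_add of_nat_mono of_nat_mult)
    also have "\<dots> \<le> (3 * lg) * (3 * rn)" using Blg it rn1 lg1 by (intro mult_mono) auto
    finally show ?thesis by (simp add: mult.commute)
  qed
  have dD: "real_of_int D \<le> real_of_int d1 * real_of_int D"
    using d1[OF D1] D1 by (simp add: mult_le_cancel_right1)
  have lgrn: "lg \<le> rn * lg" using rn1 lg1 by (simp add: mult_le_cancel_right1)
  have tf: "tf = min (real_of_int d1 * real_of_int D) (rn * lg)"
    by (simp add: tf_def time_factor_def rn_def lg_def)
  have Stf: "real S \<le> 9 * tf" and Btf: "real B \<le> 4 * tf"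
    unfolding tf using S1 S2 BD Blg dD lgrn by (auto simp: min_def)
  have "total_time m n (2 * D) = 43 * m + 12 + (6 * m + 5) * B + (1600 * m + 800) * S"
    by (simp only: total_time_def B_def S_def h_def sum_distrib_left)
  then have "real (total_time m n (2 * D)) = 43 * real m + 12 + (6 * real m + 5) * real B + (1600 * real m + 800) * real S"
    by simp
  \<comment> \<open>The additive 5 and 800 are absorbed by \<open>m \<ge> 1\<close>. The factor of
    \<open>m * tf\<close> then becomes \<open>11 * 4 + 2400 * 9 = 21644\<close>, which fits into
    30000.\<close>
  also have "\<dots> \<le> 43 * real m + 12 + (11 * real m) * real B + (2400 * real m) * real S"
    using m1 by (intro add_mono mult_right_mono) auto
  also have "\<dots> \<le> 43 * real m + 12 + (11 * real m) * (4 * tf) + (2400 * real m) * (9 * tf)"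
    using Stf Btf by (intro add_mono mult_left_mono) auto
  also have "\<dots> \<le> 30000 * (1 + real m * (1 + tf))"
  proof -
    have "0 \<le> real m * tf" using Btf by simp
    then show ?thesis by (simp add: algebra_simps)
  qed
  finally show ?thesis by (simp add: tf_def)
qed

section \<open>From the graph to the arrays\<close>

lemma array_of_nth: "i < length xs \<Longrightarrow> array_of xs (int i) = xs ! i"
  by (simp add: array_of_def)

theorem theorem4p2:
  shows "\<exists>(p :: com) (c :: real). \<forall>(G :: nat pair_pre_digraph) (l :: nat \<times> nat \<Rightarrow> int)
      (yhat :: nat \<Rightarrow> int) (ystar :: nat \<Rightarrow> int) (idx :: nat \<Rightarrow> nat) (es :: (nat \<times> nat) list).
    pair_fin_digraph G \<longrightarrow> no_negative_cycle G l \<longrightarrow>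
    closest_feasible_RE_dual G l yhat ystar \<longrightarrow>
    vertex_numbering G idx \<longrightarrow> edge_listing G es \<longrightarrow>
    (\<exists>t s. exec p (input_store G idx es l yhat) t s \<and>
       feasible_RE_dual G l (output_dual idx s) \<and>
       real t \<le> c * (1 + real (card (parcs G)) *
         (1 + time_factor (card (pverts G))
                (l1_dist (pverts G) yhat ystar) (linf_dist (pverts G) yhat ystar))))"
proof (intro exI[of _ main_prog] exI[of _ "30000 :: real"] allI impI)
  fix G :: "nat pair_pre_digraph" and l :: "nat \<times> nat \<Rightarrow> int" and yhat ystar :: "nat \<Rightarrow> int"
    and idx :: "nat \<Rightarrow> nat" and es :: "(nat \<times> nat) list"
  assume G: "pair_fin_digraph G" and close: "closest_feasible_RE_dual G l yhat ystar"
    and idx: "vertex_numbering G idx" and es: "edge_listing G es"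
  interpret pair_fin_digraph G by (rule G)
  define V where "V = pverts G"
  define N where "N = card V"
  define D where "D = linf_dist V yhat ystar"
  define d1 where "d1 = l1_dist V yhat ystar"
  define m where "m = length es"
  define s where "s = input_store G idx es l yhat"
  have fin: "finite V" by (simp add: V_def)
  have es': "set es = parcs G" "card (parcs G) = m"
    using es distinct_card[of es] by (auto simp: edge_listing_def m_def)
  have bij: "bij_betw idx V {..<N}" using idx by (simp add: vertex_numbering_def V_def N_def)
  have inV: "u \<in> V" "v \<in> V" if "(u, v) \<in> parcs G" for u v
    using that arc_fst_in_verts arc_snd_in_verts by (fastforce simp: V_def)+
  have idx_lt: "idx v < N" if "v \<in> V" for v using bij that by (auto simp: bij_betw_def)
  have idx_inv: "inv_into V idx (idx v) = v" if "v \<in> V" for v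
    using bij that by (simp add: bij_betw_def)
  have inv_V: "inv_into V idx i \<in> V" if "i < N" for i
    using bij that by (metis bij_betw_def inv_into_into lessThan_iff)
  have Dge: "\<bar>yhat v - ystar v\<bar> \<le> D" if "v \<in> V" for v
    unfolding D_def linf_dist_def using fin that by (intro Max_ge) auto
  have D0: "0 \<le> D" unfolding D_def linf_dist_def using fin by (intro Max_ge) auto
  have feas: "0 \<le> l (u, v) + ystar u - ystar v" if "(u, v) \<in> parcs G" for u v
    using close that by (force simp: closest_feasible_RE_dual_def feasible_RE_dual_def reduced_length_def)
  have store: "s ''m'' 0 = int m" "s ''oh'' = (\<lambda>_. 0)" "s ''ih'' = (\<lambda>_. 0)" "s ''f'' 0 = 0"
    "s ''la'' 0 = 0" "\<forall>j. s ''bk'' j = 0" "s ''b'' 0 = 0"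
    by (simp_all add: s_def input_store_def array_of_def es')
  have edge: "s ''src'' (int i) = int (idx (fst (es ! i)))" "s ''dst'' (int i) = int (idx (snd (es ! i)))"
    "s ''len'' (int i) = l (es ! i)" if "i < m" for i
    using that by (simp_all add: s_def input_store_def array_of_nth m_def case_prod_unfold)
  have y: "s ''y'' (int (idx v)) = yhat v" if "v \<in> V" for v
    using idx_lt[OF that] idx_inv[OF that] by (simp add: s_def input_store_def array_of_nth N_def V_def)
  have es_i: "(fst (es ! i), snd (es ! i)) \<in> parcs G" if "i < m" for i
    using es'(1) that m_def nth_mem by fastforce
  \<comment> \<open>Lowering the prediction by \<open>P0\<close> turns it into
    \<open>ystar - D\<close>, a uniform shift of a feasible dual; the shift by \<open>D\<close>
    makes the amounts nonnegative and at most \<open>2 D\<close>. The value 0 off the vertex numbers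
    keeps these bounds true for every integer.\<close>
  define P0 where "P0 = (\<lambda>i. if 0 \<le> i \<and> i < int N then
    D - (ystar (inv_into V idx (nat i)) - yhat (inv_into V idx (nat i))) else 0)"
  have P0v: "P0 (int (idx v)) = D - (ystar v - yhat v)" if "v \<in> V" for v
    using idx_lt[OF that] idx_inv[OF that] by (simp add: P0_def)
  have P0_bounds: "0 \<le> P0 i \<and> P0 i \<le> 2 * D" for i
  proof (cases "0 \<le> i \<and> i < int N")
    case True
    then have "inv_into V idx (nat i) \<in> V" by (intro inv_V) auto
    then show ?thesis using Dge[of "inv_into V idx (nat i)"] True by (auto simp: P0_def abs_le_iff)
  qed (use D0 in \<open>auto simp: P0_def\<close>)
  have P0_feas: "P0 (s ''src'' e) \<le> s ''len'' e + s ''y'' (s ''src'' e) - s ''y'' (s ''dst'' e) + P0 (s ''dst'' e)"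
    if e: "0 \<le> e" "e < int m" for e
  proof -
    obtain i where i: "e = int i" "i < m" using e by (metis nonneg_int_cases of_nat_less_iff)
    obtain u v where uv: "es ! i = (u, v)" by (cases "es ! i")
    have a: "(u, v) \<in> parcs G" using es_i[OF i(2)] uv by simp
    then show ?thesis using edge[OF i(2)] feas[OF a] inV[OF a] by (simp add: i(1) uv y P0v)
  qed
  have "s ''src'' ` {0..<int m} \<union> s ''dst'' ` {0..<int m} \<subseteq> {0..<int N}"
  proof -
    have "s ''src'' e \<in> {0..<int N} \<and> s ''dst'' e \<in> {0..<int N}" if e: "e \<in> {0..<int m}" for e
    proof -
      obtain i where i: "e = int i" "i < m" using e by (metis atLeastLessThan_iff nonneg_int_cases of_nat_less_iff)
      then show ?thesis using edge[OF i(2)] inV[OF es_i[OF i(2)]] idx_lt by simp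
    qed
    then show ?thesis by blast
  qed
  then have "card (s ''src'' ` {0..<int m} \<union> s ''dst'' ` {0..<int m}) \<le> card {0..<int N}"
    by (intro card_mono) auto
  then have card: "card (s ''src'' ` {0..<int m} \<union> s ''dst'' ` {0..<int m}) \<le> N" by simp
  have "runs main_prog s (total_time (nat (int m)) N (2 * D))
    (\<lambda>s'. \<forall>e\<in>{0..<int m}. 0 \<le> s ''len'' e + s' ''y'' (s ''src'' e) - s' ''y'' (s ''dst'' e))"
    by (rule runs_main[OF store(1) _ store(2-7), where Q = P0]) (use P0_bounds P0_feas card in auto)
  then obtain t s' where run: "exec main_prog s t s'" "t \<le> total_time m N (2 * D)"
    "\<forall>e\<in>{0..<int m}. 0 \<le> s ''len'' e + s' ''y'' (s ''src'' e) - s' ''y'' (s ''dst'' e)"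
    unfolding runs_def by auto
  have "feasible_RE_dual G l (output_dual idx s')"
    unfolding feasible_RE_dual_def
  proof
    fix e assume "e \<in> parcs G"
    then obtain i where i: "i < m" "es ! i = e" using es'(1) by (metis in_set_conv_nth m_def)
    obtain u v where uv: "e = (u, v)" by (cases e)
    have "int i \<in> {0..<int m}" using i by simp
    then have "0 \<le> s ''len'' (int i) + s' ''y'' (s ''src'' (int i)) - s' ''y'' (s ''dst'' (int i))"
      using run(3) by blast
    then show "0 \<le> reduced_length l (output_dual idx s') e"
      using edge[OF i(1)] i(2) uv by (simp add: reduced_length_def output_dual_def)
  qed
  moreover have "real t \<le> 30000 * (1 + real (card (parcs G)) *
         (1 + time_factor (card (pverts G)) (l1_dist (pverts G) yhat ystar) (linf_dist (pverts G) yhat ystar)))"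
  proof -
    \<comment> \<open>If there are no edges, the prediction itself is feasible, so by minimality
      \<open>ystar\<close> agrees with it on all vertices.\<close>
    have zero: "D = 0" if "m = 0"
    proof -
      have "parcs G = {}" using es'(1) that m_def by simp
      then have "feasible_RE_dual G l yhat" by (simp add: feasible_RE_dual_def)
      then have "d1 \<le> l1_dist V yhat yhat"
        using close by (simp add: closest_feasible_RE_dual_def d1_def V_def)
      then have "(\<Sum>v\<in>V. \<bar>yhat v - ystar v\<bar>) \<le> 0" by (simp add: l1_dist_def d1_def)
      then have "\<forall>v\<in>V. \<bar>yhat v - ystar v\<bar> = 0"
        using fin by (metis (no_types, lifting) abs_ge_zero antisym sum_nonneg sum_nonneg_eq_0_iff)
      then have e: "insert 0 ((\<lambda>v. \<bar>yhat v - ystar v\<bar>) ` V) = {0}" by auto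
      show ?thesis unfolding D_def linf_dist_def e by simp
    qed
    have "1 \<le> N" if "1 \<le> m"
    proof -
      have "fst (es ! 0) \<in> V" using inV[OF es_i[of 0]] that by simp
      then show ?thesis using fin by (auto simp: N_def card_gt_0_iff Suc_le_eq)
    qed
    \<comment> \<open>The largest deviation is attained at some vertex and is one of the terms of
      the 1-norm.\<close>
    moreover have "1 \<le> d1" if D1: "1 \<le> D"
    proof -
      have "D \<in> insert 0 ((\<lambda>v. \<bar>yhat v - ystar v\<bar>) ` V)"
        unfolding D_def linf_dist_def using fin by (intro Max_in) auto
      then obtain v where v: "v \<in> V" "D = \<bar>yhat v - ystar v\<bar>" using D1 by auto
      then have "D \<le> d1" unfolding d1_def l1_dist_def v(2) using fin by (intro member_le_sum) auto
      then show ?thesis using D1 by simp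
    qed
    ultimately have "real (total_time m N (2 * D)) \<le> 30000 * (1 + real m * (1 + time_factor N d1 D))"
      using D0 zero by (intro total_time_bound) auto
    then show ?thesis using run(2) es'(2) by (simp add: N_def V_def d1_def D_def)
  qed
  ultimately show "\<exists>t s. exec main_prog (input_store G idx es l yhat) t s \<and>
       feasible_RE_dual G l (output_dual idx s) \<and>
       real t \<le> 30000 * (1 + real (card (parcs G)) *
         (1 + time_factor (card (pverts G)) (l1_dist (pverts G) yhat ystar) (linf_dist (pverts G) yhat ystar)))"
    using run(1) s_def by blast
qed

end
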